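(* Let $G,H$ be countable groups, and $N$ a normal subgroup of $G$. Suppose that $G$, $H$, and $G/N$ all have the Haagerup Property. Then so does the permutational wreath product $H\wr_{G/N}G$.
   Context: A countable group has the Haagerup Property if it admits a metrically proper isometric action on a Hilbert space. If $X$ is a $G$-set, the permutational wreath product is $H\wr_X G=H^{(X)}\rtimes G$, where $H^{(X)}=\bigoplus_{x\in X}H$ is the group of finitely supported functions $X\to H$ and $G$ acts by permuting the coordinates: $(g\cdot w)(x)=w(g^{-1}x)$. Here $X=G/N$ with the left translation action of $G$. *)

theory Defs
  imports "HOL-Analysis.Analysis" "HOL-Algebra.Group_Action" "HOL-Algebra.Product_Groups"
begin

section \<open>The Hilbert space of square-summable real sequences\<close>

typedef ell2 = "{f :: nat \<Rightarrow> real. summable (\<lambda>n. (f n)\<^sup>2)}"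
  morphisms ell2_nth Abs_ell2
  by (rule exI [of _ "\<lambda>_. 0"]) simp

setup_lifting type_definition_ell2

lemma summable_ell2_nth: "summable (\<lambda>n. (ell2_nth x n)\<^sup>2)"
  using ell2_nth [of x] by simp

lemma summable_mult_square_summable:
  fixes f g :: "nat \<Rightarrow> real"
  assumes "summable (\<lambda>n. (f n)\<^sup>2)" "summable (\<lambda>n. (g n)\<^sup>2)"
  shows "summable (\<lambda>n. f n * g n)"
proof (rule summable_comparison_test)
  show "\<exists>N. \<forall>n\<ge>N. norm (f n * g n) \<le> (f n)\<^sup>2 + (g n)\<^sup>2"
  proof (intro exI allI impI)
    fix n
    have "0 \<le> (\<bar>f n\<bar> - \<bar>g n\<bar>)\<^sup>2" "0 \<le> \<bar>f n\<bar> * \<bar>g n\<bar>" by simp_all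
    then show "norm (f n * g n) \<le> (f n)\<^sup>2 + (g n)\<^sup>2"
      unfolding real_norm_def abs_mult power2_diff power2_abs by linarith
  qed
  show "summable (\<lambda>n. (f n)\<^sup>2 + (g n)\<^sup>2)"
    using assms by (rule summable_add)
qed

lemma summable_square_add:
  fixes f g :: "nat \<Rightarrow> real"
  assumes "summable (\<lambda>n. (f n)\<^sup>2)" "summable (\<lambda>n. (g n)\<^sup>2)"
  shows "summable (\<lambda>n. (f n + g n)\<^sup>2)"
proof -
  have "summable (\<lambda>n. (f n)\<^sup>2 + (g n)\<^sup>2 + 2 * (f n * g n))"
    using assms summable_mult_square_summable [OF assms]
    by (intro summable_add summable_mult)
  then show ?thesis by (simp add: power2_sum mult.assoc)
qed

lemma summable_ell2_mult: "summable (\<lambda>n. ell2_nth x n * ell2_nth y n)"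
  by (intro summable_mult_square_summable summable_ell2_nth)

instantiation ell2 :: real_inner
begin

lift_definition zero_ell2 :: ell2 is "\<lambda>_. 0" by simp

lift_definition plus_ell2 :: "ell2 \<Rightarrow> ell2 \<Rightarrow> ell2" is "\<lambda>f g n. f n + g n"
  by (rule summable_square_add)

lift_definition uminus_ell2 :: "ell2 \<Rightarrow> ell2" is "\<lambda>f n. - f n" by simp

lift_definition scaleR_ell2 :: "real \<Rightarrow> ell2 \<Rightarrow> ell2" is "\<lambda>c f n. c * f n"
  by (simp add: power_mult_distrib summable_mult)

definition minus_ell2 :: "ell2 \<Rightarrow> ell2 \<Rightarrow> ell2" where "minus_ell2 x y = x + - y"

lift_definition inner_ell2 :: "ell2 \<Rightarrow> ell2 \<Rightarrow> real" is "\<lambda>f g. \<Sum>n. f n * g n" .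

definition norm_ell2 :: "ell2 \<Rightarrow> real" where "norm_ell2 x = sqrt (inner x x)"

definition sgn_ell2 :: "ell2 \<Rightarrow> ell2" where "sgn_ell2 x = inverse (norm x) *\<^sub>R x"

definition dist_ell2 :: "ell2 \<Rightarrow> ell2 \<Rightarrow> real" where "dist_ell2 x y = norm (x - y)"

definition uniformity_ell2 :: "(ell2 \<times> ell2) filter"
  where "uniformity_ell2 = (INF e\<in>{0<..}. principal {(x, y). dist x y < e})"

definition open_ell2 :: "ell2 set \<Rightarrow> bool"
  where "open_ell2 U \<longleftrightarrow> (\<forall>x\<in>U. eventually (\<lambda>(x', y). x' = x \<longrightarrow> y \<in> U) uniformity)"

instance
proof
  fix x y z :: ell2 and a b :: real and U :: "ell2 set"
  show "x + y + z = x + (y + z)" by transfer (simp add: add.assoc)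
  show "x + y = y + x" by transfer (simp add: add.commute)
  show "0 + x = x" by transfer simp
  show "- x + x = 0" by transfer simp
  show "x - y = x + - y" by (rule minus_ell2_def)
  show "a *\<^sub>R (x + y) = a *\<^sub>R x + a *\<^sub>R y" by transfer (simp add: algebra_simps)
  show "(a + b) *\<^sub>R x = a *\<^sub>R x + b *\<^sub>R x" by transfer (simp add: algebra_simps)
  show "a *\<^sub>R b *\<^sub>R x = (a * b) *\<^sub>R x" by transfer (simp add: algebra_simps)
  show "1 *\<^sub>R x = x" by transfer simp
  show "sgn x = inverse (norm x) *\<^sub>R x" by (rule sgn_ell2_def)
  show "dist x y = norm (x - y)" by (rule dist_ell2_def)
  show "uniformity = (INF e\<in>{0<..}. principal {(x :: ell2, y). dist x y < e})"
    by (rule uniformity_ell2_def)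
  show "open U \<longleftrightarrow> (\<forall>x\<in>U. eventually (\<lambda>(x', y). x' = x \<longrightarrow> y \<in> U) uniformity)"
    by (rule open_ell2_def)
  have inner_self: "inner v v = (\<Sum>n. (ell2_nth v n)\<^sup>2)" for v :: ell2
    by (simp only: inner_ell2.rep_eq power2_eq_square)
  show "inner x y = inner y x" by transfer (simp add: mult.commute)
  show "inner (x + y) z = inner x z + inner y z"
    by (simp add: inner_ell2.rep_eq plus_ell2.rep_eq distrib_right suminf_add summable_ell2_mult)
  show "inner (a *\<^sub>R x) y = a * inner x y"
    by (simp add: inner_ell2.rep_eq scaleR_ell2.rep_eq mult.assoc suminf_mult summable_ell2_mult)
  show "0 \<le> inner x x"
    unfolding inner_self by (rule suminf_nonneg [OF summable_ell2_nth]) simp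
  show "inner x x = 0 \<longleftrightarrow> x = 0"
    unfolding inner_self suminf_eq_zero_iff [OF summable_ell2_nth zero_le_power2]
    by transfer (simp add: fun_eq_iff)
  show "norm x = sqrt (inner x x)" by (rule norm_ell2_def)
qed

end

lemma ell2_nth_diff: "ell2_nth (x - y) n = ell2_nth x n - ell2_nth y n"
  unfolding minus_ell2_def plus_ell2.rep_eq uminus_ell2.rep_eq by simp

lemma norm_ell2_power2: "(norm x)\<^sup>2 = (\<Sum>n. (ell2_nth x n)\<^sup>2)"
  unfolding power2_norm_eq_inner inner_ell2.rep_eq power2_eq_square [symmetric] ..

lemma sum_le_norm_ell2: "finite A \<Longrightarrow> (\<Sum>n\<in>A. (ell2_nth x n)\<^sup>2) \<le> (norm x)\<^sup>2"
  unfolding norm_ell2_power2 by (intro sum_le_suminf summable_ell2_nth) simp_all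

instance ell2 :: complete_space
proof
  fix X :: "nat \<Rightarrow> ell2"
  assume "Cauchy X"
  have nth_le: "\<bar>ell2_nth x n\<bar> \<le> norm x" for x n
  proof (rule power2_le_imp_le)
    show "\<bar>ell2_nth x n\<bar>\<^sup>2 \<le> (norm x)\<^sup>2"
      using sum_le_norm_ell2 [of "{n}" x] by simp
  qed simp
  have "Cauchy (\<lambda>k. ell2_nth (X k) n)" for n
  proof (rule metric_CauchyI)
    fix e :: real assume "0 < e"
    then obtain M where M: "\<forall>m\<ge>M. \<forall>k\<ge>M. dist (X m) (X k) < e"
      using metric_CauchyD [OF \<open>Cauchy X\<close>] by blast
    have le: "dist (ell2_nth (X m) n) (ell2_nth (X k) n) \<le> dist (X m) (X k)" for m k
      using nth_le [of "X m - X k" n] by (simp add: dist_norm ell2_nth_diff)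
    show "\<exists>M. \<forall>m\<ge>M. \<forall>k\<ge>M. dist (ell2_nth (X m) n) (ell2_nth (X k) n) < e"
      by (intro exI [of _ M] allI impI le_less_trans [OF le] M [rule_format])
  qed
  then have "convergent (\<lambda>k. ell2_nth (X k) n)" for n
    by (simp add: Cauchy_convergent_iff)
  then have f: "(\<lambda>k. ell2_nth (X k) n) \<longlonglongrightarrow> lim (\<lambda>k. ell2_nth (X k) n)" for n
    by (simp add: convergent_LIMSEQ_iff)
  define f where "f n = lim (\<lambda>k. ell2_nth (X k) n)" for n
  note f = f [folded f_def]
  have bound: "(\<Sum>n<N. (ell2_nth (X m) n - f n)\<^sup>2) \<le> e\<^sup>2"
    if "\<forall>m\<ge>M. \<forall>k\<ge>M. dist (X m) (X k) < e" and "M \<le> m" for e M m N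
  proof (rule LIMSEQ_le_const2)
    show "(\<lambda>k. \<Sum>n<N. (ell2_nth (X m) n - ell2_nth (X k) n)\<^sup>2)
        \<longlonglongrightarrow> (\<Sum>n<N. (ell2_nth (X m) n - f n)\<^sup>2)"
      by (intro tendsto_intros f)
    have "(\<Sum>n<N. (ell2_nth (X m) n - ell2_nth (X k) n)\<^sup>2) \<le> e\<^sup>2" if "M \<le> k" for k
    proof -
      have "(\<Sum>n<N. (ell2_nth (X m) n - ell2_nth (X k) n)\<^sup>2) \<le> (norm (X m - X k))\<^sup>2"
        using sum_le_norm_ell2 [of "{..<N}" "X m - X k"] by (simp add: ell2_nth_diff)
      also have "\<dots> \<le> e\<^sup>2"
        using \<open>\<forall>m\<ge>M. \<forall>k\<ge>M. dist (X m) (X k) < e\<close> \<open>M \<le> m\<close> that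
        by (intro power_mono) (simp_all add: dist_norm less_imp_le)
      finally show ?thesis .
    qed
    then show "\<exists>K. \<forall>k\<ge>K. (\<Sum>n<N. (ell2_nth (X m) n - ell2_nth (X k) n)\<^sup>2) \<le> e\<^sup>2"
      by blast
  qed
  have summ: "summable (\<lambda>n. (ell2_nth (X m) n - f n)\<^sup>2)"
    if "\<forall>m\<ge>M. \<forall>k\<ge>M. dist (X m) (X k) < e" and "M \<le> m" for e M m
  proof (rule bounded_imp_summable [where B = "e\<^sup>2"])
    show "(\<Sum>n\<le>N. (ell2_nth (X m) n - f n)\<^sup>2) \<le> e\<^sup>2" for N
      using bound [OF that, of "Suc N"] by (simp add: lessThan_Suc_atMost)
  qed simp
  obtain M1 where M1: "\<forall>m\<ge>M1. \<forall>k\<ge>M1. dist (X m) (X k) < 1"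
    using metric_CauchyD [OF \<open>Cauchy X\<close>, of 1] by auto
  have "summable (\<lambda>n. (f n - ell2_nth (X M1) n)\<^sup>2)"
    using summ [OF M1 order_refl] by (simp add: power2_commute)
  then have "summable (\<lambda>n. (f n - ell2_nth (X M1) n + ell2_nth (X M1) n)\<^sup>2)"
    by (rule summable_square_add) (rule summable_ell2_nth)
  then have nth_L: "ell2_nth (Abs_ell2 f) = f"
    by (simp add: Abs_ell2_inverse)
  have "X \<longlonglongrightarrow> Abs_ell2 f"
  proof (rule metric_LIMSEQ_I)
    fix r :: real assume "0 < r"
    then obtain M where M: "\<forall>m\<ge>M. \<forall>k\<ge>M. dist (X m) (X k) < r / 2"
      using metric_CauchyD [OF \<open>Cauchy X\<close>, of "r / 2"] by auto
    have "dist (X m) (Abs_ell2 f) < r" if "M \<le> m" for m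
    proof -
      have "(norm (X m - Abs_ell2 f))\<^sup>2 \<le> (r / 2)\<^sup>2"
        unfolding norm_ell2_power2 ell2_nth_diff nth_L
        using summ [OF M that] bound [OF M that] by (rule suminf_le_const)
      then have "norm (X m - Abs_ell2 f) \<le> r / 2"
        by (rule power2_le_imp_le) (use \<open>0 < r\<close> in simp)
      then show ?thesis using \<open>0 < r\<close> by (simp add: dist_norm)
    qed
    then show "\<exists>M. \<forall>m\<ge>M. dist (X m) (Abs_ell2 f) < r" by blast
  qed
  then show "convergent X" by (rule convergentI)
qed


section \<open>The Haagerup property\<close>

definition isometric_action ::
    "('a, 'c) monoid_scheme \<Rightarrow> 'v::metric_space set \<Rightarrow> ('a \<Rightarrow> 'v \<Rightarrow> 'v) \<Rightarrow> bool"
  where "isometric_action G S \<phi> \<longleftrightarrow>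
    group_action G S \<phi> \<and>
    (\<forall>g\<in>carrier G. \<forall>x\<in>S. \<forall>y\<in>S. dist (\<phi> g x) (\<phi> g y) = dist x y)"

text \<open>Groups are discrete: only finitely many elements fail to move a bounded set off itself.\<close>

definition metrically_proper ::
    "('a, 'c) monoid_scheme \<Rightarrow> 'v::metric_space set \<Rightarrow> ('a \<Rightarrow> 'v \<Rightarrow> 'v) \<Rightarrow> bool"
  where "metrically_proper G S \<phi> \<longleftrightarrow>
    (\<forall>B\<subseteq>S. bounded B \<longrightarrow> finite {g \<in> carrier G. \<phi> g ` B \<inter> B \<noteq> {}})"

text \<open>
  The Hilbert space is a closed linear subspace \<open>S\<close> of some complete inner product space
  (of arbitrary dimension), whose type \<open>'v\<close> is a parameter because HOL cannot quantify over
  types inside a formula. A hypothesis ``has the Haagerup property'' is \<open>haagerup TYPE('v) G\<close>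
  with \<open>'v\<close> a free type variable. In a conclusion a witness has to be named; for countable
  groups \<open>TYPE(ell2)\<close> is no restriction, since the closed affine span of an orbit of a
  countable group is invariant and separable, and every separable real Hilbert space is
  isometric to a closed subspace of \<open>ell2\<close>.

  The scalars are real and isometries are not required to be linear or affine. A complex
  Hilbert space is a real one for the real part of its inner product, with the same metric;
  conversely an isometric action on a real Hilbert space is affine and extends isometrically
  to the complexification. So real and complex Hilbert spaces yield the same property.
\<close>

definition haagerup ::
    "'v::{real_inner, complete_space} itself \<Rightarrow> ('a, 'c) monoid_scheme \<Rightarrow> bool"
  where "haagerup _ G \<longleftrightarrow>
    (\<exists>(S :: 'v set) \<phi>. subspace S \<and> closed S \<and>
      isometric_action G S \<phi> \<and> metrically_proper G S \<phi>)"


section \<open>Permutational wreath products\<close>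

text \<open>
  \<open>sum_group X (\<lambda>_. H)\<close> is the group of finitely supported functions \<open>X \<rightarrow> H\<close>
  (extensional outside \<open>X\<close>).
\<close>

definition coordinate_action ::
    "('a, 'c) monoid_scheme \<Rightarrow> 'x set \<Rightarrow> ('a \<Rightarrow> 'x \<Rightarrow> 'x) \<Rightarrow> 'a \<Rightarrow> ('x \<Rightarrow> 'b) \<Rightarrow> 'x \<Rightarrow> 'b"
  where "coordinate_action G X \<alpha> g w = (\<lambda>x\<in>X. w (\<alpha> (inv\<^bsub>G\<^esub> g) x))"

definition perm_wreath ::
    "('b, 'd) monoid_scheme \<Rightarrow> 'x set \<Rightarrow> ('a \<Rightarrow> 'x \<Rightarrow> 'x) \<Rightarrow> ('a, 'c) monoid_scheme
      \<Rightarrow> (('x \<Rightarrow> 'b) \<times> 'a) monoid"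
  where "perm_wreath H X \<alpha> G =
    \<lparr>carrier = carrier (sum_group X (\<lambda>_. H)) \<times> carrier G,
     monoid.mult = (\<lambda>(w, g) (w', g').
       (w \<otimes>\<^bsub>sum_group X (\<lambda>_. H)\<^esub> coordinate_action G X \<alpha> g w', g \<otimes>\<^bsub>G\<^esub> g')),
     one = (\<one>\<^bsub>sum_group X (\<lambda>_. H)\<^esub>, \<one>\<^bsub>G\<^esub>)\<rparr>"

text \<open>
  The elements of \<open>G Mod N\<close> are right cosets in HOL-Algebra; as \<open>N\<close> is normal, they are the
  left cosets, on which \<open>g\<close> acts by \<open>h <# N \<mapsto> (g \<otimes> h) <# N\<close>.
\<close>

definition quotient_translation ::
    "('a, 'c) monoid_scheme \<Rightarrow> 'a set \<Rightarrow> 'a \<Rightarrow> 'a set \<Rightarrow> 'a set"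
  where "quotient_translation G N g = (\<lambda>C\<in>carrier (G Mod N). g <#\<^bsub>G\<^esub> C)"

abbreviation quotient_wreath ::
    "('b, 'd) monoid_scheme \<Rightarrow> ('a, 'c) monoid_scheme \<Rightarrow> 'a set \<Rightarrow> (('a set \<Rightarrow> 'b) \<times> 'a) monoid"
  where "quotient_wreath H G N \<equiv>
    perm_wreath H (carrier (G Mod N)) (quotient_translation G N) G"

lemma (in normal) quotient_translation_r_coset:
  assumes "g \<in> carrier G" "h \<in> carrier G"
  shows "quotient_translation G H g (H #> h) = H #> (g \<otimes> h)"
proof -
  have "H #> h \<in> carrier (G Mod H)"
    using assms by (auto simp: carrier_FactGroup)
  moreover have "H #> h = h <# H" "H #> (g \<otimes> h) = (g \<otimes> h) <# H"
    using assms coset_eq by auto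
  ultimately show ?thesis
    using assms by (simp add: quotient_translation_def lcos_m_assoc subset)
qed

lemma (in normal) group_action_quotient_translation:
  "group_action G (carrier (G Mod H)) (quotient_translation G H)"
proof -
  let ?X = "carrier (G Mod H)" and ?t = "quotient_translation G H"
  have X: "?X = (\<lambda>h. H #> h) ` carrier G"
    by (rule carrier_FactGroup)
  have comp: "?t (g \<otimes> g') C = ?t g (?t g' C)" and maps: "?t g C \<in> ?X"
    and one: "?t \<one> C = C"
    if "g \<in> carrier G" "g' \<in> carrier G" "C \<in> ?X" for g g' C
    using that unfolding X by (auto simp: quotient_translation_r_coset m_assoc)
  have bij: "?t g \<in> Bij ?X" if g: "g \<in> carrier G" for g
  proof -
    have "bij_betw (?t g) ?X ?X"
      by (rule bij_betw_byWitness [where f' = "?t (inv g)"])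
        (use g in \<open>auto simp: maps one simp flip: comp\<close>)
    then show ?thesis
      by (simp add: Bij_def quotient_translation_def)
  qed
  show ?thesis
    unfolding group_action_def
  proof (intro group_hom.intro group_hom_axioms.intro group_axioms group_BijGroup homI)
    show "?t g \<in> carrier (BijGroup ?X)" if "g \<in> carrier G" for g
      using bij [OF that] by (simp add: BijGroup_def)
    show "?t (g \<otimes> g') = ?t g \<otimes>\<^bsub>BijGroup ?X\<^esub> ?t g'"
      if "g \<in> carrier G" "g' \<in> carrier G" for g g'
    proof -
      have "?t (g \<otimes> g') = compose ?X (?t g) (?t g')"
      proof (rule extensionalityI)
        show "?t (g \<otimes> g') \<in> extensional ?X" "compose ?X (?t g) (?t g') \<in> extensional ?X"
          by (simp_all add: quotient_translation_def)
        show "?t (g \<otimes> g') C = compose ?X (?t g) (?t g') C" if "C \<in> ?X" for C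
          using comp \<open>g \<in> carrier G\<close> \<open>g' \<in> carrier G\<close> that by (simp add: compose_eq)
      qed
      then show ?thesis using that bij by (simp add: BijGroup_def)
    qed
  qed
qed

lemma group_perm_wreath:
  assumes "group H" and act: "group_action G X \<alpha>"
  shows "group (perm_wreath H X \<alpha> G)"
proof -
  interpret H: group H by fact
  interpret A: group_action G X \<alpha> by fact
  interpret G: group G
    using A.group_hom by (rule group_hom.axioms)
  let ?S = "sum_group X (\<lambda>_. H)" and ?c = "coordinate_action G X \<alpha>"
  interpret S: group ?S
    by (rule sum_group) (rule H.is_group)
  have in_X: "\<alpha> g x \<in> X" if "g \<in> carrier G" "x \<in> X" for g x
    using A.element_image that by blast
  have S: "carrier ?S = {w \<in> X \<rightarrow>\<^sub>E carrier H. finite {x \<in> X. w x \<noteq> \<one>\<^bsub>H\<^esub>}}"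
    by (rule carrier_sum_group) (rule H.is_group)
  have comp: "\<alpha> (g \<otimes>\<^bsub>G\<^esub> g') x = \<alpha> g (\<alpha> g' x)"
    if "g \<in> carrier G" "g' \<in> carrier G" "x \<in> X" for g g' x
    using A.composition_rule that by blast
  have one: "\<alpha> \<one>\<^bsub>G\<^esub> x = x" if "x \<in> X" for x
    using A.id_eq_one that by (metis restrict_apply')
  have c_closed: "?c g w \<in> carrier ?S" if g: "g \<in> carrier G" and w: "w \<in> carrier ?S" for g w
  proof -
    have "{x \<in> X. w (\<alpha> (inv\<^bsub>G\<^esub> g) x) \<noteq> \<one>\<^bsub>H\<^esub>} \<subseteq> \<alpha> g ` {x \<in> X. w x \<noteq> \<one>\<^bsub>H\<^esub>}"
    proof
      fix x assume x: "x \<in> {x \<in> X. w (\<alpha> (inv\<^bsub>G\<^esub> g) x) \<noteq> \<one>\<^bsub>H\<^esub>}"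
      then have "x = \<alpha> g (\<alpha> (inv\<^bsub>G\<^esub> g) x)"
        using g by (simp add: one flip: comp)
      then show "x \<in> \<alpha> g ` {x \<in> X. w x \<noteq> \<one>\<^bsub>H\<^esub>}"
        using x g in_X by blast
    qed
    then have "finite {x \<in> X. w (\<alpha> (inv\<^bsub>G\<^esub> g) x) \<noteq> \<one>\<^bsub>H\<^esub>}"
      using w by (auto simp: S intro: finite_subset)
    moreover have "{x \<in> X. ?c g w x \<noteq> \<one>\<^bsub>H\<^esub>} = {x \<in> X. w (\<alpha> (inv\<^bsub>G\<^esub> g) x) \<noteq> \<one>\<^bsub>H\<^esub>}"
      by (auto simp: coordinate_action_def)
    ultimately show ?thesis
      using w g in_X by (auto simp: S coordinate_action_def PiE_iff)
  qed
  have c_mult: "?c g (w \<otimes>\<^bsub>?S\<^esub> w') = ?c g w \<otimes>\<^bsub>?S\<^esub> ?c g w'" if "g \<in> carrier G" for g w w'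
    using that in_X by (auto simp: coordinate_action_def fun_eq_iff)
  have c_comp: "?c (g \<otimes>\<^bsub>G\<^esub> g') w = ?c g (?c g' w)"
    if "g \<in> carrier G" "g' \<in> carrier G" for g g' w
    using that in_X by (auto simp: coordinate_action_def fun_eq_iff G.inv_mult_group comp)
  have c_one: "?c \<one>\<^bsub>G\<^esub> w = w" if "w \<in> carrier ?S" for w
    using that by (auto simp: coordinate_action_def fun_eq_iff one S PiE_iff extensional_def)
  have c_id: "?c g \<one>\<^bsub>?S\<^esub> = \<one>\<^bsub>?S\<^esub>" if "g \<in> carrier G" for g
    using that in_X by (auto simp: coordinate_action_def fun_eq_iff)
  note [simp del] = mult_sum_group one_sum_group inv_sum_group
  show ?thesis
  proof (rule groupI)
    fix p assume "p \<in> carrier (perm_wreath H X \<alpha> G)"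
    then obtain w g where p: "p = (w, g)" "w \<in> carrier ?S" "g \<in> carrier G"
      by (auto simp: perm_wreath_def)
    let ?q = "(?c (inv\<^bsub>G\<^esub> g) (inv\<^bsub>?S\<^esub> w), inv\<^bsub>G\<^esub> g)"
    have "?q \<in> carrier (perm_wreath H X \<alpha> G)"
      using p by (simp add: perm_wreath_def c_closed)
    moreover have "?q \<otimes>\<^bsub>perm_wreath H X \<alpha> G\<^esub> p = \<one>\<^bsub>perm_wreath H X \<alpha> G\<^esub>"
      using p by (simp add: perm_wreath_def c_id flip: c_mult)
    ultimately show "\<exists>q\<in>carrier (perm_wreath H X \<alpha> G).
        q \<otimes>\<^bsub>perm_wreath H X \<alpha> G\<^esub> p = \<one>\<^bsub>perm_wreath H X \<alpha> G\<^esub>"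
      by blast
  next
    fix p q assume "p \<in> carrier (perm_wreath H X \<alpha> G)" "q \<in> carrier (perm_wreath H X \<alpha> G)"
    then show "p \<otimes>\<^bsub>perm_wreath H X \<alpha> G\<^esub> q \<in> carrier (perm_wreath H X \<alpha> G)"
      by (cases p; cases q) (simp add: perm_wreath_def c_closed)
  next
    fix p q r
    assume "p \<in> carrier (perm_wreath H X \<alpha> G)" "q \<in> carrier (perm_wreath H X \<alpha> G)"
      "r \<in> carrier (perm_wreath H X \<alpha> G)"
    then show "p \<otimes>\<^bsub>perm_wreath H X \<alpha> G\<^esub> q \<otimes>\<^bsub>perm_wreath H X \<alpha> G\<^esub> r =
        p \<otimes>\<^bsub>perm_wreath H X \<alpha> G\<^esub> (q \<otimes>\<^bsub>perm_wreath H X \<alpha> G\<^esub> r)"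
      by (cases p; cases q; cases r)
        (simp add: perm_wreath_def c_closed c_mult c_comp S.m_assoc G.m_assoc)
  next
    show "\<one>\<^bsub>perm_wreath H X \<alpha> G\<^esub> \<in> carrier (perm_wreath H X \<alpha> G)"
      by (simp add: perm_wreath_def)
  next
    fix p assume "p \<in> carrier (perm_wreath H X \<alpha> G)"
    then show "\<one>\<^bsub>perm_wreath H X \<alpha> G\<^esub> \<otimes>\<^bsub>perm_wreath H X \<alpha> G\<^esub> p = p"
      by (cases p) (simp add: perm_wreath_def c_one)
  qed
qed

end

theory Submission
  imports Defs "HOL-Probability.Probability"
begin

text \<open>
  An equivariant kernel of negative type on a countable group with finite balls yields a proper
  isometric action on the closed affine hull of the orbit of \<open>1\<close>, and conversely proper isometric
  actions of \<open>G\<close>, \<open>H\<close> and \<open>Q = G/N\<close> give such kernels. On the wreath product the kernel is a sum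
  of three. The kernel of \<open>G\<close>, and the sum over \<open>x \<in> Q\<close> of the kernel of \<open>H\<close> applied to the
  coordinates at \<open>x\<close>, control \<open>g\<close> and the values of \<open>w\<close>; the third one has to control the distance
  from \<open>gN\<close> to the support of \<open>w\<close>.

  For a random subset \<open>A\<close> of \<open>Q\<close> with invariant law, the indicator that \<open>g\<close> and \<open>g'\<close> lie in \<open>A\<close> and
  \<open>w = w'\<close> off \<open>A\<close> is positive definite, and its expectation depends only on \<open>g\<close>, \<open>g'\<close> and the set
  where \<open>w\<close> and \<open>w'\<close> differ. Half-spaces of a Gaussian process \<open>\<xi>\<close> on \<open>Q\<close> with covariance
  \<open>exp (- t \<psi>)\<close>, for \<open>\<psi>\<close> the kernel of \<open>Q\<close>, would do. They are replaced by soft ones given by powers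
  of \<open>cos (\<xi> x)\<close>, so that every expectation is a trigonometric moment, determined by the
  covariance through the product-to-sum formula; this makes invariance elementary. Letting \<open>t\<close>
  tend to 0 gives normalized kernels \<open>u\<close> that are close to 1 on a given finite set and at most 7/8
  as soon as the support is far from \<open>gN\<close>, and a series of \<open>1 - u\<close> over such scales is the third kernel.
\<close>

section \<open>Positive definite kernels and kernels of negative type\<close>

text \<open>Symmetry is a clause of its own: with real coefficients the quadratic form sees only the
  symmetric part of \<open>K\<close>.\<close>

definition psd_kernel :: "'i set \<Rightarrow> ('i \<Rightarrow> 'i \<Rightarrow> real) \<Rightarrow> bool"
  where "psd_kernel A K \<longleftrightarrow> (\<forall>x\<in>A. \<forall>y\<in>A. K x y = K y x) \<and>
    (\<forall>F c. finite F \<longrightarrow> F \<subseteq> A \<longrightarrow> 0 \<le> (\<Sum>x\<in>F. \<Sum>y\<in>F. c x * c y * K x y))"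

text \<open>Conditionally negative definite kernels that vanish on the diagonal: on a countable set,
  exactly the squared distances between points of a Hilbert space.\<close>

definition neg_type :: "'i set \<Rightarrow> ('i \<Rightarrow> 'i \<Rightarrow> real) \<Rightarrow> bool"
  where "neg_type A D \<longleftrightarrow> (\<forall>x\<in>A. \<forall>y\<in>A. D x y = D y x) \<and> (\<forall>x\<in>A. D x x = 0) \<and>
    (\<forall>F c. finite F \<longrightarrow> F \<subseteq> A \<longrightarrow> sum c F = 0 \<longrightarrow>
      (\<Sum>x\<in>F. \<Sum>y\<in>F. c x * c y * D x y) \<le> 0)"

lemma psd_kernelD:
  assumes "psd_kernel A K"
  shows psd_kernel_sym: "x \<in> A \<Longrightarrow> y \<in> A \<Longrightarrow> K x y = K y x"
    and psd_kernel_nonneg: "finite F \<Longrightarrow> F \<subseteq> A \<Longrightarrow> 0 \<le> (\<Sum>x\<in>F. \<Sum>y\<in>F. c x * c y * K x y)"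
  using assms unfolding psd_kernel_def by blast+

lemma neg_typeD:
  assumes "neg_type A D"
  shows neg_type_sym: "x \<in> A \<Longrightarrow> y \<in> A \<Longrightarrow> D x y = D y x"
    and neg_type_diag: "x \<in> A \<Longrightarrow> D x x = 0"
    and neg_type_nonpos: "finite F \<Longrightarrow> F \<subseteq> A \<Longrightarrow> sum c F = 0 \<Longrightarrow>
      (\<Sum>x\<in>F. \<Sum>y\<in>F. c x * c y * D x y) \<le> 0"
  using assms unfolding neg_type_def by blast+

lemma psd_kernel_diag_nonneg:
  assumes "psd_kernel A K" "x \<in> A"
  shows "0 \<le> K x x"
  using psd_kernel_nonneg [OF assms(1), of "{x}" "\<lambda>_. 1"] assms(2) by simp

text \<open>Subtracting \<open>s\<close> from the coefficient at \<open>o'\<close> serves twice: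
  with \<open>s\<close> the total mass it makes the coefficients sum to 0, and with \<open>s\<close>
  found by completing the square it produces the Schur complement.\<close>

lemma quadratic_form_shift:
  fixes K :: "'i \<Rightarrow> 'i \<Rightarrow> real"
  assumes F: "finite F" "o' \<in> F" and sym: "\<And>x. x \<in> F \<Longrightarrow> K o' x = K x o'"
  shows "(\<Sum>x\<in>F. \<Sum>y\<in>F. (e x - (if x = o' then s else 0)) * (e y - (if y = o' then s else 0)) * K x y)
    = (\<Sum>x\<in>F. \<Sum>y\<in>F. e x * e y * K x y) - 2 * s * (\<Sum>x\<in>F. e x * K x o') + s\<^sup>2 * K o' o'"
proof -
  have "(\<Sum>y\<in>F. (e x - (if x = o' then s else 0)) * (e y - (if y = o' then s else 0)) * K x y)
      = (\<Sum>y\<in>F. e x * e y * K x y) - (if x = o' then s * (\<Sum>y\<in>F. e y * K o' y) else 0)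
        - s * (e x * K x o') + (if x = o' then s\<^sup>2 * K o' o' else 0)" for x
  proof -
    have "(e x - (if x = o' then s else 0)) * (e y - (if y = o' then s else 0)) * K x y
      = e x * e y * K x y - (if x = o' then s * (e y * K o' y) else 0)
        - (if y = o' then s * (e x * K x o') else 0)
        + (if y = o' then (if x = o' then s\<^sup>2 * K o' o' else 0) else 0)" for y
      by (simp add: algebra_simps power2_eq_square)
    then show ?thesis
      using F by (simp add: sum.distrib sum_subtractf sum.delta sum_distrib_left)
  qed
  moreover have "(\<Sum>y\<in>F. e y * K o' y) = (\<Sum>y\<in>F. e y * K y o')"
    using sym by (intro sum.cong) auto
  ultimately show ?thesis
    using F by (simp add: sum.distrib sum_subtractf sum.delta sum_distrib_left [symmetric])
qed

lemma sum_extend_zero: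
  fixes f :: "'i \<Rightarrow> real"
  assumes "finite F" "F \<subseteq> F'" "finite F'"
  shows "(\<Sum>x\<in>F'. (if x \<in> F then c x else 0) * f x) = (\<Sum>x\<in>F. c x * f x)"
  using assms by (intro sum.mono_neutral_cong_right) auto

lemma quadratic_form_extend_zero:
  fixes K :: "'i \<Rightarrow> 'i \<Rightarrow> real"
  assumes "finite F" "F \<subseteq> F'" "finite F'"
  shows "(\<Sum>x\<in>F'. \<Sum>y\<in>F'. (if x \<in> F then c x else 0) * (if y \<in> F then c y else 0) * K x y)
    = (\<Sum>x\<in>F. \<Sum>y\<in>F. c x * c y * K x y)"
  using sum_extend_zero [OF assms]
  by (simp add: mult.assoc sum_distrib_left [symmetric])

section \<open>Schur complements and Cholesky factorization\<close>

lemma psd_kernel_zero_diag: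
  assumes K: "psd_kernel A K" and A: "m \<in> A" "i \<in> A" and "K m m = 0"
  shows "K i m = 0"
proof (rule ccontr)
  assume ne: "K i m \<noteq> 0"
  then have "i \<noteq> m" using assms by auto
  \<comment> \<open>This value makes the quadratic form with coefficients 1 at \<open>i\<close> and
    \<open>- s\<close> at \<open>m\<close> equal to -1.\<close>
  define s where "s = (K i i + 1) / (2 * K i m)"
  have "0 \<le> (\<Sum>x\<in>{i, m}. \<Sum>y\<in>{i, m}.
      ((if x = i then 1 else 0) - (if x = m then s else 0)) *
      ((if y = i then 1 else 0) - (if y = m then s else 0)) * K x y)"
    using A by (intro psd_kernel_nonneg [OF K]) auto
  also have "\<dots> = K i i - 2 * s * K i m"
    using \<open>i \<noteq> m\<close> A \<open>K m m = 0\<close> psd_kernel_sym [OF K, of m i]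
    by (simp add: algebra_simps)
  finally show False using ne by (simp add: s_def)
qed

text \<open>If \<open>K m m = 0\<close> then \<open>K i m = 0\<close> for all \<open>i\<close>, so the division by zero is harmless.\<close>

definition schur_complement :: "'i \<Rightarrow> ('i \<Rightarrow> 'i \<Rightarrow> real) \<Rightarrow> 'i \<Rightarrow> 'i \<Rightarrow> real"
  where "schur_complement m K = (\<lambda>i j. K i j - K i m * K m j / K m m)"

text \<open>The form of the Schur complement at \<open>c\<close> is the form of \<open>K\<close>
  after the coefficient at \<open>m\<close> is lowered by the optimal amount \<open>s\<close>, hence
  nonnegative. If the pivot \<open>K m m\<close> vanishes, the complement is \<open>K\<close>
  itself.\<close>

lemma psd_kernel_schur_complement:
  assumes K: "psd_kernel A K" and m: "m \<in> A"
  shows "psd_kernel A (schur_complement m K)"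
proof (cases "K m m = 0")
  case False
  then have pos: "0 < K m m"
    using psd_kernel_diag_nonneg [OF K m] by simp
  have "0 \<le> (\<Sum>x\<in>F. \<Sum>y\<in>F. c x * c y * (K x y - K x m * K m y / K m m))"
    if F: "finite F" "F \<subseteq> A" for F c
  proof -
    let ?F = "insert m F"
    let ?e = "\<lambda>x. if x \<in> F then c x else 0"
    define s where "s = (\<Sum>x\<in>F. c x * K x m) / K m m"
    have S: "(\<Sum>x\<in>F. c x * K x m) = s * K m m"
      using pos by (simp add: s_def)
    have "0 \<le> (\<Sum>x\<in>?F. \<Sum>y\<in>?F. (?e x - (if x = m then s else 0)) * (?e y - (if y = m then s else 0)) * K x y)"
      using F m by (intro psd_kernel_nonneg [OF K]) auto
    also have "\<dots> = (\<Sum>x\<in>?F. \<Sum>y\<in>?F. ?e x * ?e y * K x y) - 2 * s * (\<Sum>x\<in>?F. ?e x * K x m) + s\<^sup>2 * K m m"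
      using F m psd_kernel_sym [OF K] by (intro quadratic_form_shift) auto
    also have "\<dots> = (\<Sum>x\<in>F. \<Sum>y\<in>F. c x * c y * K x y) - 2 * s * (\<Sum>x\<in>F. c x * K x m) + s\<^sup>2 * K m m"
      using F quadratic_form_extend_zero [OF F(1) subset_insertI, of m c K]
        sum_extend_zero [OF F(1) subset_insertI, of m c "\<lambda>x. K x m"] by simp
    also have "\<dots> = (\<Sum>x\<in>F. \<Sum>y\<in>F. c x * c y * K x y) - s\<^sup>2 * K m m"
      unfolding S by (simp add: power2_eq_square algebra_simps)
    finally have "s\<^sup>2 * K m m \<le> (\<Sum>x\<in>F. \<Sum>y\<in>F. c x * c y * K x y)"
      by simp
    moreover have "(\<Sum>x\<in>F. \<Sum>y\<in>F. c x * c y * (K x m * K m y / K m m)) = s\<^sup>2 * K m m"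
    proof -
      have "(\<Sum>x\<in>F. \<Sum>y\<in>F. c x * c y * (K x m * K m y / K m m))
          = (\<Sum>x\<in>F. \<Sum>y\<in>F. (c x * K x m) * (c y * K y m)) / K m m"
      proof -
        have "K m y = K y m" if "y \<in> F" for y
          using psd_kernel_sym [OF K m] F that by blast
        then show ?thesis
          unfolding sum_divide_distrib by (intro sum.cong) (simp_all add: field_simps)
      qed
      also have "\<dots> = (s * K m m) * (s * K m m) / K m m"
        by (simp add: S [symmetric] sum_product)
      finally show ?thesis using pos by (simp add: power2_eq_square)
    qed
    ultimately show ?thesis
      by (simp add: right_diff_distrib sum_subtractf)
  qed
  then show ?thesis
    using psd_kernel_sym [OF K] m unfolding psd_kernel_def schur_complement_def by (auto simp: mult.commute)
qed (use K in \<open>simp add: schur_complement_def\<close>)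

text \<open>Gaussian elimination with the pivots 0, 1, 2, ... in this order.\<close>

primrec schur_iter :: "(nat \<Rightarrow> nat \<Rightarrow> real) \<Rightarrow> nat \<Rightarrow> nat \<Rightarrow> nat \<Rightarrow> real" where
  "schur_iter K 0 = K"
| "schur_iter K (Suc m) = schur_complement m (schur_iter K m)"

lemma psd_kernel_schur_iter: "psd_kernel UNIV K \<Longrightarrow> psd_kernel UNIV (schur_iter K n)"
  by (induction n) (auto intro: psd_kernel_schur_complement)

text \<open>Step \<open>n\<close> clears row \<open>n\<close>: a nonzero pivot cancels it, and under
  a zero pivot it is zero already. Rows that are zero stay zero.\<close>

lemma schur_iter_eq_0:
  assumes K: "psd_kernel UNIV K"
  shows "i < n \<Longrightarrow> schur_iter K n i j = 0"
proof (induction n arbitrary: i j)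
  case (Suc n)
  note psd = psd_kernel_schur_iter [OF K, of n]
  show ?case
  proof (cases "i = n")
    case True
    have "schur_iter K n j n = 0" if "schur_iter K n n n = 0"
      using psd_kernel_zero_diag [OF psd] that by simp
    then show ?thesis
      using True psd_kernel_sym [OF psd, of j n] by (simp add: schur_complement_def)
  next
    case False
    then show ?thesis using Suc by (simp add: schur_complement_def)
  qed
qed simp

text \<open>Cholesky factorization; the factor is lower triangular, so no convergence question arises.\<close>

lemma psd_kernel_nat_factorization:
  assumes K: "psd_kernel UNIV (K :: nat \<Rightarrow> nat \<Rightarrow> real)"
  obtains b where "\<And>i m. i < m \<Longrightarrow> b i m = 0"
    and "\<And>i j n. i < n \<Longrightarrow> K i j = (\<Sum>m<n. b i m * b j m)"
proof
  let ?S = "schur_iter K"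
  let ?b = "\<lambda>i m. ?S m i m / sqrt (?S m m m)"
  show "?b i m = 0" if "i < m" for i m
    using schur_iter_eq_0 [OF K that] by simp
  have step: "?b i m * ?b j m = ?S m i m * ?S m m j / ?S m m m" for i j m
    using psd_kernel_diag_nonneg [OF psd_kernel_schur_iter [OF K], of m m]
      psd_kernel_sym [OF psd_kernel_schur_iter [OF K], of j m m]
    by simp
  \<comment> \<open>Each elimination step splits off one rank-one term; the remainder vanishes in
    row \<open>i\<close> as soon as \<open>i < n\<close>.\<close>
  have telescope: "K i j = ?S n i j + (\<Sum>m<n. ?b i m * ?b j m)" for i j n
  proof (induction n)
    case (Suc n)
    then show ?case by (simp only: sum.lessThan_Suc step schur_iter.simps schur_complement_def)
  qed simp
  show "K i j = (\<Sum>m<n. ?b i m * ?b j m)" if "i < n" for i j n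
    using telescope [of i j n] schur_iter_eq_0 [OF K that, of j] by linarith
qed

text \<open>As \<open>f\<close> need not be injective, the coefficients are summed over its fibres;
  this turns the form into one of \<open>K\<close> on the image of \<open>F\<close>.\<close>

lemma psd_kernel_pullback:
  assumes K: "psd_kernel A K" and f: "\<And>i. i \<in> B \<Longrightarrow> f i \<in> A"
  shows "psd_kernel B (\<lambda>i j. K (f i) (f j))"
proof -
  have "0 \<le> (\<Sum>x\<in>F. \<Sum>y\<in>F. c x * c y * K (f x) (f y))" if F: "finite F" "F \<subseteq> B" for F c
  proof -
    define C where "C x = (\<Sum>i\<in>{i \<in> F. f i = x}. c i)" for x
    have gather: "(\<Sum>i\<in>F. c i * h (f i)) = (\<Sum>x\<in>f ` F. C x * h x)" for h :: "'a \<Rightarrow> real"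
    proof -
      have "(\<Sum>i\<in>F. c i * h (f i)) = (\<Sum>x\<in>f ` F. \<Sum>i\<in>{i \<in> F. f i = x}. c i * h (f i))"
        by (rule sum.image_gen [OF F(1)])
      also have "\<dots> = (\<Sum>x\<in>f ` F. C x * h x)"
        by (intro sum.cong refl) (simp add: C_def sum_distrib_right)
      finally show ?thesis .
    qed
    have "0 \<le> (\<Sum>x\<in>f ` F. \<Sum>y\<in>f ` F. C x * C y * K x y)"
      using F f by (intro psd_kernel_nonneg [OF K]) auto
    also have "\<dots> = (\<Sum>x\<in>f ` F. C x * (\<Sum>y\<in>f ` F. C y * K x y))"
      by (simp add: sum_distrib_left mult.assoc)
    also have "\<dots> = (\<Sum>i\<in>F. c i * (\<Sum>y\<in>f ` F. C y * K (f i) y))"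
      by (rule gather [symmetric])
    also have "\<dots> = (\<Sum>i\<in>F. c i * (\<Sum>j\<in>F. c j * K (f i) (f j)))"
      by (subst gather) (rule refl)
    also have "\<dots> = (\<Sum>x\<in>F. \<Sum>y\<in>F. c x * c y * K (f x) (f y))"
      by (simp add: sum_distrib_left mult.assoc)
    finally show ?thesis .
  qed
  then show ?thesis
    using psd_kernel_sym [OF K] f unfolding psd_kernel_def by blast
qed

text \<open>An enumeration of \<open>A\<close> reduces this to kernels on the natural numbers. The
  vectors are finitely supported, which later puts them into \<open>ell2\<close> and makes Gaussian
  variables finite sums.\<close>

lemma psd_kernel_factorization:
  assumes K: "psd_kernel A K" and "countable A"
  shows "\<exists>(b :: _ \<Rightarrow> nat \<Rightarrow> real) N. (\<forall>i. \<forall>m\<ge>N i. b i m = 0) \<and>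
    (\<forall>i\<in>A. \<forall>j\<in>A. \<forall>n\<ge>N i. K i j = (\<Sum>m<n. b i m * b j m))"
proof (cases "A = {}")
  case True
  show ?thesis
    using True by auto
next
  case False
  let ?f = "from_nat_into A"
  have "psd_kernel UNIV (\<lambda>i j. K (?f i) (?f j))"
    using False by (intro psd_kernel_pullback [OF K]) (auto intro: from_nat_into)
  then obtain b where b: "\<And>i m. i < m \<Longrightarrow> b i m = 0"
      "\<And>i j n. i < n \<Longrightarrow> K (?f i) (?f j) = (\<Sum>m<n. b i m * b j m)"
    by (rule psd_kernel_nat_factorization) (rule that)
  show ?thesis
  \<comment> \<open>Row \<open>k\<close> of the triangular factor lives in the columns 0 to
    \<open>k\<close>, hence the bound \<open>Suc\<close>.\<close>
  proof (rule exI [of _ "\<lambda>i. b (to_nat_on A i)"], rule exI [of _ "\<lambda>i. Suc (to_nat_on A i)"], intro conjI allI ballI impI)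
    show "b (to_nat_on A i) m = 0" if "Suc (to_nat_on A i) \<le> m" for i m
      using that b(1) by simp
    show "K i j = (\<Sum>m<n. b (to_nat_on A i) m * b (to_nat_on A j) m)"
      if "i \<in> A" "j \<in> A" "Suc (to_nat_on A i) \<le> n" for i j n
      using that b(2) [of "to_nat_on A i" n "to_nat_on A j"] \<open>countable A\<close> by simp
  qed
qed

text \<open>The Gromov product at \<open>o'\<close>: for a squared distance \<open>D\<close> this is
  the inner product with origin \<open>o'\<close>. Its form at \<open>c\<close> is minus half the
  form of \<open>D\<close> at \<open>c\<close> with the total mass subtracted at
  \<open>o'\<close>.\<close>

lemma neg_type_imp_psd_kernel:
  assumes D: "neg_type A D" and o': "o' \<in> A"
  shows "psd_kernel A (\<lambda>x y. (D x o' + D y o' - D x y) / 2)"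
proof -
  have "0 \<le> (\<Sum>x\<in>F. \<Sum>y\<in>F. c x * c y * ((D x o' + D y o' - D x y) / 2))"
    if F: "finite F" "F \<subseteq> A" for F c
  proof -
    let ?F = "insert o' F"
    let ?e = "\<lambda>x. if x \<in> F then c x else 0"
    define s where "s = sum c F"
    have "(\<Sum>x\<in>?F. ?e x - (if x = o' then s else 0)) = 0"
      using F sum_extend_zero [of F ?F c "\<lambda>_. 1"] by (auto simp: sum_subtractf s_def)
    then have "(\<Sum>x\<in>?F. \<Sum>y\<in>?F. (?e x - (if x = o' then s else 0)) * (?e y - (if y = o' then s else 0)) * D x y) \<le> 0"
      using F o' by (intro neg_type_nonpos [OF D]) auto
    also have "(\<Sum>x\<in>?F. \<Sum>y\<in>?F. (?e x - (if x = o' then s else 0)) * (?e y - (if y = o' then s else 0)) * D x y)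
        = (\<Sum>x\<in>?F. \<Sum>y\<in>?F. ?e x * ?e y * D x y) - 2 * s * (\<Sum>x\<in>?F. ?e x * D x o') + s\<^sup>2 * D o' o'"
      using F o' neg_type_sym [OF D] by (intro quadratic_form_shift) auto
    also have "\<dots> = (\<Sum>x\<in>F. \<Sum>y\<in>F. c x * c y * D x y) - 2 * s * (\<Sum>x\<in>F. c x * D x o')"
      using F neg_type_diag [OF D o'] quadratic_form_extend_zero [OF F(1) subset_insertI, of o' c D]
        sum_extend_zero [OF F(1) subset_insertI, of o' c "\<lambda>x. D x o'"] by simp
    finally have "(\<Sum>x\<in>F. \<Sum>y\<in>F. c x * c y * D x y) - 2 * s * (\<Sum>x\<in>F. c x * D x o') \<le> 0" .
    moreover have "(\<Sum>x\<in>F. \<Sum>y\<in>F. c x * c y * ((D x o' + D y o' - D x y) / 2))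
        = (\<Sum>x\<in>F. \<Sum>y\<in>F. (c x * D x o') * c y) / 2 + (\<Sum>x\<in>F. \<Sum>y\<in>F. c x * (c y * D y o')) / 2
          - (\<Sum>x\<in>F. \<Sum>y\<in>F. c x * c y * D x y) / 2"
      by (simp add: sum_divide_distrib algebra_simps add_divide_distrib diff_divide_distrib sum.distrib sum_subtractf)
    moreover have "(\<Sum>x\<in>F. \<Sum>y\<in>F. (c x * D x o') * c y) = s * (\<Sum>x\<in>F. c x * D x o')"
      "(\<Sum>x\<in>F. \<Sum>y\<in>F. c x * (c y * D y o')) = s * (\<Sum>x\<in>F. c x * D x o')"
      unfolding sum_product [symmetric] s_def by (rule mult.commute) (rule refl)
    ultimately show ?thesis by simp
  qed
  then show ?thesis
    using neg_type_sym [OF D] o' unfolding psd_kernel_def by (simp add: add.commute)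
qed

text \<open>When the coefficients sum to 0 the terms with \<open>norm (v x)\<close> cancel, and what
  remains is -2 times the squared norm of \<open>\<Sum>x\<in>F. c x *\<^sub>R v x\<close>.\<close>

lemma neg_type_dist_squared:
  fixes v :: "'i \<Rightarrow> 'v::real_inner"
  shows "neg_type A (\<lambda>x y. (dist (v x) (v y))\<^sup>2)"
proof -
  have "(\<Sum>x\<in>F. \<Sum>y\<in>F. c x * c y * (dist (v x) (v y))\<^sup>2) \<le> 0" if "sum c F = 0" for F and c :: "'i \<Rightarrow> real"
  proof -
    have "c x * c y * (dist (v x) (v y))\<^sup>2 =
        (c x * (norm (v x))\<^sup>2) * c y + c x * (c y * (norm (v y))\<^sup>2) - 2 * inner (c x *\<^sub>R v x) (c y *\<^sub>R v y)" for x y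
      by (simp add: dist_norm power2_norm_eq_inner inner_diff_left inner_diff_right inner_commute algebra_simps)
    moreover have "(\<Sum>x\<in>F. \<Sum>y\<in>F. (c x * (norm (v x))\<^sup>2) * c y + c x * (c y * (norm (v y))\<^sup>2)
          - 2 * inner (c x *\<^sub>R v x) (c y *\<^sub>R v y)) =
        (\<Sum>x\<in>F. c x * (norm (v x))\<^sup>2) * sum c F + sum c F * (\<Sum>x\<in>F. c x * (norm (v x))\<^sup>2)
        - 2 * inner (\<Sum>x\<in>F. c x *\<^sub>R v x) (\<Sum>x\<in>F. c x *\<^sub>R v x)"
      unfolding sum.distrib sum_subtractf sum_product inner_sum_left
      unfolding inner_sum_right sum_distrib_left by (rule refl)
    ultimately have "(\<Sum>x\<in>F. \<Sum>y\<in>F. c x * c y * (dist (v x) (v y))\<^sup>2) =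
        - 2 * inner (\<Sum>x\<in>F. c x *\<^sub>R v x) (\<Sum>x\<in>F. c x *\<^sub>R v x)"
      by (simp only: that)
    then show ?thesis by simp
  qed
  then show ?thesis by (simp add: neg_type_def dist_commute)
qed

section \<open>Closure properties of kernels of negative type\<close>

lemma neg_type_add: "neg_type A D \<Longrightarrow> neg_type A E \<Longrightarrow> neg_type A (\<lambda>x y. D x y + E x y)"
  unfolding neg_type_def by (simp add: distrib_left sum.distrib add_nonpos_nonpos)

lemma neg_type_sum:
  "(\<And>i. i \<in> I \<Longrightarrow> neg_type A (D i)) \<Longrightarrow> neg_type A (\<lambda>x y. \<Sum>i\<in>I. D i x y)"
proof (induction I rule: infinite_finite_induct)
  case (insert i I)
  then show ?case by (simp add: neg_type_add)
qed (simp_all add: neg_type_def)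

lemma neg_type_scale: "neg_type A D \<Longrightarrow> 0 \<le> t \<Longrightarrow> neg_type A (\<lambda>x y. t * D x y)"
  unfolding neg_type_def
  by (simp add: mult.left_commute [of _ t] sum_distrib_left [symmetric] mult_nonneg_nonpos)

lemma neg_type_one_minus:
  assumes "psd_kernel A K" and "\<And>x. x \<in> A \<Longrightarrow> K x x = 1"
  shows "neg_type A (\<lambda>x y. 1 - K x y)"
proof -
  have "(\<Sum>x\<in>F. \<Sum>y\<in>F. c x * c y * (1 - K x y)) \<le> 0"
    if "finite F" "F \<subseteq> A" "sum c F = 0" for F c
  proof -
    have "(\<Sum>x\<in>F. \<Sum>y\<in>F. c x * c y * (1 - K x y))
        = sum c F * sum c F - (\<Sum>x\<in>F. \<Sum>y\<in>F. c x * c y * K x y)"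
      by (simp add: sum_product right_diff_distrib sum_subtractf)
    then show ?thesis using psd_kernel_nonneg [OF assms(1) that(1,2), of c] that(3) by simp
  qed
  then show ?thesis
    using assms psd_kernel_sym [OF assms(1)] by (simp add: neg_type_def)
qed

lemma neg_type_tendsto:
  assumes "\<And>n. neg_type A (D n)"
    and lim: "\<And>x y. x \<in> A \<Longrightarrow> y \<in> A \<Longrightarrow> (\<lambda>n. D n x y) \<longlonglongrightarrow> E x y"
  shows "neg_type A E"
  unfolding neg_type_def
proof (intro conjI ballI allI impI)
  show "E x y = E y x" if "x \<in> A" "y \<in> A" for x y
    using LIMSEQ_unique [OF lim [OF that]] lim [OF that(2,1)] neg_type_sym [OF assms(1) that] by simp
  show "E x x = 0" if "x \<in> A" for x
    using lim [OF that that] neg_type_diag [OF assms(1) that] by (simp add: LIMSEQ_const_iff)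
  show "(\<Sum>x\<in>F. \<Sum>y\<in>F. c x * c y * E x y) \<le> 0" if "finite F" "F \<subseteq> A" "sum c F = 0" for F c
  proof (rule LIMSEQ_le_const2)
    show "(\<lambda>n. \<Sum>x\<in>F. \<Sum>y\<in>F. c x * c y * D n x y) \<longlonglongrightarrow> (\<Sum>x\<in>F. \<Sum>y\<in>F. c x * c y * E x y)"
      using that by (intro tendsto_intros lim) auto
    show "\<exists>N. \<forall>n\<ge>N. (\<Sum>x\<in>F. \<Sum>y\<in>F. c x * c y * D n x y) \<le> 0"
      using neg_type_nonpos [OF assms(1) that] by blast
  qed
qed

lemma neg_type_suminf:
  assumes "\<And>k. neg_type A (D k)"
    and "\<And>x y. x \<in> A \<Longrightarrow> y \<in> A \<Longrightarrow> summable (\<lambda>k. D k x y)"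
  shows "neg_type A (\<lambda>x y. \<Sum>k. D k x y)"
  by (rule neg_type_tendsto [of _ "\<lambda>n x y. \<Sum>k<n. D k x y"])
    (use assms in \<open>auto intro: neg_type_sum summable_LIMSEQ\<close>)

lemma neg_type_nonneg:
  assumes D: "neg_type A D" and "x \<in> A" "y \<in> A"
  shows "0 \<le> D x y"
proof (cases "x = y")
  case False
  then show ?thesis
    using neg_type_nonpos [OF D, of "{x, y}" "\<lambda>z. if z = x then 1 else -1"]
      neg_type_sym [OF assms] neg_type_diag [OF D] assms(2,3) by simp
qed (use assms neg_type_diag in force)

section \<open>Equivariant kernels and the Haagerup property\<close>

text \<open>The map is the orbit map of the origin. All that the construction keeps of a given
  action are the squared distances between orbit points, which form a kernel of negative
  type.\<close>

lemma haagerup_imp_orbit_map: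
  fixes G :: "('a, 'c) monoid_scheme"
  assumes "group G" and "haagerup TYPE('v::{real_inner, complete_space}) G"
  obtains v :: "'a \<Rightarrow> 'v::{real_inner, complete_space}" where "\<And>g x y. g \<in> carrier G \<Longrightarrow> x \<in> carrier G \<Longrightarrow> y \<in> carrier G \<Longrightarrow>
      dist (v (g \<otimes>\<^bsub>G\<^esub> x)) (v (g \<otimes>\<^bsub>G\<^esub> y)) = dist (v x) (v y)"
    and "\<And>R. finite {g \<in> carrier G. (dist (v g) (v \<one>\<^bsub>G\<^esub>))\<^sup>2 \<le> R}"
proof -
  interpret G: group G by fact
  from assms(2) obtain S :: "'v set" and \<phi> where S: "subspace S"
    and act: "isometric_action G S \<phi>" and proper: "metrically_proper G S \<phi>"
    unfolding haagerup_def by blast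
  interpret A: group_action G S \<phi>
    using act unfolding isometric_action_def by blast
  have iso: "dist (\<phi> g x) (\<phi> g y) = dist x y" if "g \<in> carrier G" "x \<in> S" "y \<in> S" for g x y
    using act that unfolding isometric_action_def by blast
  have 0: "0 \<in> S" using S by (rule subspace_0)
  have one: "\<phi> \<one>\<^bsub>G\<^esub> 0 = 0"
    using A.id_eq_one 0 by (metis restrict_apply')
  show ?thesis
  proof (rule that)
    show "dist (\<phi> (g \<otimes>\<^bsub>G\<^esub> x) 0) (\<phi> (g \<otimes>\<^bsub>G\<^esub> y) 0) = dist (\<phi> x 0) (\<phi> y 0)"
      if "g \<in> carrier G" "x \<in> carrier G" "y \<in> carrier G" for g x y
    proof -
      have "\<phi> x 0 \<in> S" "\<phi> y 0 \<in> S"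
        using A.element_image 0 that by blast+
      then show ?thesis
        unfolding A.composition_rule [OF 0 that(1,2)] A.composition_rule [OF 0 that(1,3)]
        using iso that(1) by simp
    qed
    show "finite {g \<in> carrier G. (dist (\<phi> g 0) (\<phi> \<one>\<^bsub>G\<^esub> 0))\<^sup>2 \<le> R}" for R
    proof -
      \<comment> \<open>If \<open>\<phi> g 0\<close> lies in this ball, it is a common point of the
        ball and its translate, because the origin lies in the ball too.\<close>
      let ?B = "S \<inter> cball 0 (sqrt R)"
      have "bounded ?B" by (intro bounded_Int) simp
      then have "finite {g \<in> carrier G. \<phi> g ` ?B \<inter> ?B \<noteq> {}}"
        by (intro proper [unfolded metrically_proper_def, rule_format]) simp_all
      moreover have "\<phi> g 0 \<in> \<phi> g ` ?B \<inter> ?B"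
        if "g \<in> carrier G" "(dist (\<phi> g 0) (\<phi> \<one>\<^bsub>G\<^esub> 0))\<^sup>2 \<le> R" for g
      proof -
        have "norm (\<phi> g 0) \<le> sqrt R"
          using that one by (intro real_le_rsqrt) simp
        \<comment> \<open>The origin belongs to the ball only if \<open>sqrt R\<close> is
          nonnegative; for negative \<open>R\<close> no \<open>g\<close> meets the
          assumption.\<close>
        moreover from this have "0 \<le> sqrt R"
          by (rule order_trans [OF norm_ge_zero])
        ultimately show ?thesis
          using 0 A.element_image [OF that(1) 0 refl] by (intro IntI imageI) auto
      qed
      then have "{g \<in> carrier G. (dist (\<phi> g 0) (\<phi> \<one>\<^bsub>G\<^esub> 0))\<^sup>2 \<le> R} \<subseteq>
          {g \<in> carrier G. \<phi> g ` ?B \<inter> ?B \<noteq> {}}"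
        by blast
      ultimately show ?thesis by (rule rev_finite_subset)
    qed
  qed
qed

section \<open>From an orbit to an isometric action\<close>

lemma group_actionI:
  assumes "group G"
    and ext: "\<And>g. g \<in> carrier G \<Longrightarrow> \<phi> g \<in> extensional E"
    and maps: "\<And>g x. g \<in> carrier G \<Longrightarrow> x \<in> E \<Longrightarrow> \<phi> g x \<in> E"
    and comp: "\<And>g h x. g \<in> carrier G \<Longrightarrow> h \<in> carrier G \<Longrightarrow> x \<in> E \<Longrightarrow>
      \<phi> (g \<otimes>\<^bsub>G\<^esub> h) x = \<phi> g (\<phi> h x)"
    and one: "\<And>x. x \<in> E \<Longrightarrow> \<phi> \<one>\<^bsub>G\<^esub> x = x"
  shows "group_action G E \<phi>"
proof -
  interpret group G by fact
  have bij: "\<phi> g \<in> Bij E" if g: "g \<in> carrier G" for g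
  proof -
    have "bij_betw (\<phi> g) E E"
      by (rule bij_betw_byWitness [where f' = "\<phi> (inv\<^bsub>G\<^esub> g)"])
        (use g in \<open>auto simp: maps one simp flip: comp\<close>)
    then show ?thesis by (simp add: Bij_def ext g)
  qed
  have hom: "\<phi> (g \<otimes>\<^bsub>G\<^esub> h) = compose E (\<phi> g) (\<phi> h)" if "g \<in> carrier G" "h \<in> carrier G" for g h
    using that by (intro extensionalityI [of _ E]) (auto simp: ext comp compose_eq)
  show ?thesis
    unfolding group_action_def
  proof (intro group_hom.intro group_hom_axioms.intro group_axioms group_BijGroup homI)
    show "\<phi> g \<in> carrier (BijGroup E)" if "g \<in> carrier G" for g
      using bij [OF that] by (simp add: BijGroup_def)
    show "\<phi> (g \<otimes>\<^bsub>G\<^esub> h) = \<phi> g \<otimes>\<^bsub>BijGroup E\<^esub> \<phi> h"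
      if "g \<in> carrier G" "h \<in> carrier G" for g h
      using that bij hom [OF that] by (simp add: BijGroup_def)
  qed
qed

lemma subspace_closure:
  fixes A :: "'v::real_normed_vector set"
  assumes A: "subspace A"
  shows "subspace (closure A)"
proof (rule subspaceI)
  show "0 \<in> closure A"
    using subspace_0 [OF A] closure_subset by blast
  show "x + y \<in> closure A" if "x \<in> closure A" "y \<in> closure A" for x y
  proof -
    obtain f where "\<forall>n. f n \<in> A" "f \<longlonglongrightarrow> x"
      using \<open>x \<in> closure A\<close> unfolding closure_sequential by blast
    moreover obtain g where "\<forall>n. g n \<in> A" "g \<longlonglongrightarrow> y"
      using \<open>y \<in> closure A\<close> unfolding closure_sequential by blast
    ultimately show ?thesis
      unfolding closure_sequential
      by (intro exI [of _ "\<lambda>n. f n + g n"]) (auto intro: subspace_add [OF A] tendsto_add)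
  qed
  show "c *\<^sub>R x \<in> closure A" if "x \<in> closure A" for c x
  proof -
    obtain f where "\<forall>n. f n \<in> A" "f \<longlonglongrightarrow> x"
      using \<open>x \<in> closure A\<close> unfolding closure_sequential by blast
    then show ?thesis
      unfolding closure_sequential
      by (intro exI [of _ "\<lambda>n. c *\<^sub>R f n"]) (auto intro: subspace_scale [OF A] tendsto_scaleR)
  qed
qed

text \<open>The weights sum to 1, so \<open>u\<close> can be moved inside the combination;
  polarization then leaves only distances. Hence the distance to an affine combination is a function
  of the distances to and between the points combined.\<close>

lemma dist_affine_combination:
  fixes v :: "'i \<Rightarrow> 'v::real_inner"
  assumes "sum c F = 1"
  shows "(dist u (\<Sum>x\<in>F. c x *\<^sub>R v x))\<^sup>2 =
    (\<Sum>x\<in>F. c x * (dist u (v x))\<^sup>2) - (\<Sum>x\<in>F. \<Sum>y\<in>F. c x * c y * (dist (v x) (v y))\<^sup>2) / 2"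
proof -
  have "u - (\<Sum>x\<in>F. c x *\<^sub>R v x) = (\<Sum>x\<in>F. c x *\<^sub>R (u - v x))"
    by (simp add: scaleR_diff_right sum_subtractf assms flip: scaleR_sum_left)
  then have "(dist u (\<Sum>x\<in>F. c x *\<^sub>R v x))\<^sup>2 =
      inner (\<Sum>x\<in>F. c x *\<^sub>R (u - v x)) (\<Sum>x\<in>F. c x *\<^sub>R (u - v x))"
    by (simp add: dist_norm power2_norm_eq_inner)
  also have "\<dots> = (\<Sum>x\<in>F. \<Sum>y\<in>F. inner (c x *\<^sub>R (u - v x)) (c y *\<^sub>R (u - v y)))"
    unfolding inner_sum_left unfolding inner_sum_right by (rule refl)
  also have "\<dots> = (\<Sum>x\<in>F. \<Sum>y\<in>F. (c x * (dist u (v x))\<^sup>2) * c y / 2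
      + c x * (c y * (dist u (v y))\<^sup>2) / 2 - c x * c y * (dist (v x) (v y))\<^sup>2 / 2)"
    by (intro sum.cong refl)
      (simp add: dist_norm power2_norm_eq_inner inner_diff_left inner_diff_right inner_commute field_simps)
  also have "\<dots> = (\<Sum>x\<in>F. c x * (dist u (v x))\<^sup>2) * sum c F / 2
      + sum c F * (\<Sum>x\<in>F. c x * (dist u (v x))\<^sup>2) / 2
      - (\<Sum>x\<in>F. \<Sum>y\<in>F. c x * c y * (dist (v x) (v y))\<^sup>2) / 2"
    unfolding sum.distrib sum_subtractf sum_product sum_divide_distrib by (rule refl)
  finally show ?thesis by (simp add: assms)
qed

lemma dist_affine_combination_cong:
  fixes v :: "'i \<Rightarrow> 'v::real_inner" and v' :: "'i \<Rightarrow> 'w::real_inner"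
  assumes "sum c F = 1"
    and "\<And>x. x \<in> F \<Longrightarrow> dist u (v x) = dist u' (v' x)"
    and "\<And>x y. x \<in> F \<Longrightarrow> y \<in> F \<Longrightarrow> dist (v x) (v y) = dist (v' x) (v' y)"
  shows "dist u (\<Sum>x\<in>F. c x *\<^sub>R v x) = dist u' (\<Sum>x\<in>F. c x *\<^sub>R v' x)"
proof -
  have "(dist u (\<Sum>x\<in>F. c x *\<^sub>R v x))\<^sup>2 = (dist u' (\<Sum>x\<in>F. c x *\<^sub>R v' x))\<^sup>2"
    unfolding dist_affine_combination [OF assms(1)] using assms by simp
  then show ?thesis by simp
qed

text \<open>
  A point of the closed affine hull of the orbit is determined by its distances to the orbit,
  so \<open>g\<close> acts by sending \<open>y\<close> to the point \<open>z\<close> with \<open>dist z (v (g x)) = dist y (v x)\<close> for all \<open>x\<close>.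
\<close>

lemma haagerup_of_orbit:
  fixes G :: "('a, 'c) monoid_scheme" and v :: "'a \<Rightarrow> 'v::{real_inner, complete_space}"
  assumes "group G" and v_one: "v \<one>\<^bsub>G\<^esub> = 0"
    and inv: "\<And>g x y. g \<in> carrier G \<Longrightarrow> x \<in> carrier G \<Longrightarrow> y \<in> carrier G \<Longrightarrow>
      dist (v (g \<otimes>\<^bsub>G\<^esub> x)) (v (g \<otimes>\<^bsub>G\<^esub> y)) = dist (v x) (v y)"
    and fin: "\<And>R. finite {g \<in> carrier G. norm (v g) \<le> R}"
  shows "haagerup TYPE('v) G"
proof -
  interpret group G by fact
  define A where "A = affine hull (v ` carrier G)"
  define S where "S = closure A"
  have vA: "v x \<in> A" if "x \<in> carrier G" for x
    using that unfolding A_def by (simp add: hull_inc)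
  have vS: "v x \<in> S" if "x \<in> carrier G" for x
    using vA [OF that] closure_subset unfolding S_def by blast
  \<comment> \<open>The orbit contains the origin, so its affine hull is its linear span.\<close>
  have "0 \<in> A" using vA [of "\<one>\<^bsub>G\<^esub>"] v_one by simp
  then have "subspace A"
    unfolding A_def using affine_hull_span_0 [of "v ` carrier G"] by (simp add: subspace_span)
  then have "subspace S" unfolding S_def by (rule subspace_closure)
  define P where "P g y z \<longleftrightarrow> (\<forall>x\<in>carrier G. dist z (v (g \<otimes>\<^bsub>G\<^esub> x)) = dist y (v x))" for g y z
  \<comment> \<open>The image of an affine combination is the same combination of the translated
    orbit points. The second conclusion compares distances with any further pair related by
    \<open>P g\<close>; it is what yields isometry.\<close>
  have affine: "\<exists>z'\<in>A. P g a z' \<and> (\<forall>y z. P g y z \<longrightarrow> dist z z' = dist y a)"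
    if g: "g \<in> carrier G" and a: "a \<in> A" for g a
  proof -
    from a obtain T c where T: "finite T" "T \<subseteq> v ` carrier G" "sum c T = 1"
      and a: "(\<Sum>p\<in>T. c p *\<^sub>R p) = a"
      unfolding A_def affine_hull_explicit by blast
    \<comment> \<open>A choice of group elements over the orbit points; the orbit map need not be
      injective.\<close>
    define i where "i = inv_into (carrier G) v"
    have i: "i p \<in> carrier G" "v (i p) = p" if "p \<in> T" for p
      using that T unfolding i_def by (auto intro: inv_into_into f_inv_into_f)
    let ?z = "\<Sum>p\<in>T. c p *\<^sub>R v (g \<otimes>\<^bsub>G\<^esub> i p)"
    have *: "dist z ?z = dist y a" if "P g y z" for y z
      unfolding a [symmetric]
    proof (rule dist_affine_combination_cong [OF T(3)])
      show "dist z (v (g \<otimes>\<^bsub>G\<^esub> i p)) = dist y p" if "p \<in> T" for p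
        using \<open>P g y z\<close> i [OF that] unfolding P_def by metis
      show "dist (v (g \<otimes>\<^bsub>G\<^esub> i p)) (v (g \<otimes>\<^bsub>G\<^esub> i q)) = dist p q" if "p \<in> T" "q \<in> T" for p q
        using inv [OF g i(1) i(1), OF that] i(2) that by simp
    qed
    have "P g a ?z"
      unfolding P_def
    proof
      fix x assume x: "x \<in> carrier G"
      then have "P g (v x) (v (g \<otimes>\<^bsub>G\<^esub> x))"
        unfolding P_def using g inv by blast
      from * [OF this] show "dist ?z (v (g \<otimes>\<^bsub>G\<^esub> x)) = dist a (v x)"
        by (simp add: dist_commute)
    qed
    moreover have "?z \<in> A"
    proof -
      have "affine A" unfolding A_def by (rule affine_affine_hull)
      then show ?thesis
        using \<open>subspace A\<close> g i by (auto intro!: subspace_sum subspace_scale vA)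
    qed
    ultimately show ?thesis using * by blast
  qed
  have iso: "dist z z' = dist y y'"
    if g: "g \<in> carrier G" and "y' \<in> S" and P: "P g y z" "P g y' z'" for g y y' z z'
  proof -
    \<comment> \<open>A point \<open>a\<close> of the hull near \<open>y'\<close> has an image
      \<open>b\<close> with \<open>dist z' b = dist y' a\<close> and
      \<open>dist z b = dist y a\<close>; each of the two triangle inequalities costs
      \<open>e / 2\<close>.\<close>
    have "\<bar>dist z z' - dist y y'\<bar> \<le> 0 + e" if "0 < e" for e :: real
    proof -
      obtain a where a: "a \<in> A" "dist a y' < e / 2"
        using \<open>y' \<in> S\<close> \<open>0 < e\<close> unfolding S_def closure_approachable by (meson half_gt_zero)
      obtain b where b: "\<And>y z. P g y z \<Longrightarrow> dist z b = dist y a"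
        using affine [OF g a(1)] by blast
      have "\<bar>dist z z' - dist z b\<bar> \<le> dist z' b" "\<bar>dist y y' - dist y a\<bar> \<le> dist y' a"
        using dist_triangle [of z z' b] dist_triangle [of z b z'] dist_commute [of b z']
          dist_triangle [of y y' a] dist_triangle [of y a y'] dist_commute [of a y'] by linarith+
      then show ?thesis
        using b [OF P(1)] b [OF P(2)] a(2) dist_commute [of a y'] by linarith
    qed
    then have "\<bar>dist z z' - dist y y'\<bar> \<le> 0" by (rule field_le_epsilon)
    then show ?thesis by simp
  qed
  have ex: "\<exists>z\<in>S. P g y z" if g: "g \<in> carrier G" and y: "y \<in> S" for g y
  proof -
    obtain a where a: "\<And>n. a n \<in> A" "a \<longlonglongrightarrow> y"
      using y unfolding S_def closure_sequential by blast
    have "\<forall>n. \<exists>b. b \<in> A \<and> P g (a n) b"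
      using affine [OF g a(1)] by blast
    then obtain b where b: "\<And>n. b n \<in> A" "\<And>n. P g (a n) (b n)"
      by metis
    \<comment> \<open>The images of points of the hull are as far apart as the points themselves, so
      the image sequence converges by completeness.\<close>
    have "dist (b m) (b n) = dist (a m) (a n)" for m n
      using a(1) closure_subset b unfolding S_def [symmetric] by (intro iso [OF g]) (auto simp: S_def)
    moreover have "Cauchy a" using a(2) by (rule LIMSEQ_imp_Cauchy)
    ultimately have "Cauchy b" by (simp add: Cauchy_def)
    then obtain z where z: "b \<longlonglongrightarrow> z"
      using Cauchy_convergent_iff convergent_def by blast
    have "z \<in> S" unfolding S_def closure_sequential using b(1) z by blast
    moreover have "P g y z"
      unfolding P_def
    proof
      fix x assume x: "x \<in> carrier G"
      have "(\<lambda>n. dist (b n) (v (g \<otimes>\<^bsub>G\<^esub> x))) \<longlonglongrightarrow> dist z (v (g \<otimes>\<^bsub>G\<^esub> x))"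
        by (intro tendsto_intros z)
      moreover have "(\<lambda>n. dist (b n) (v (g \<otimes>\<^bsub>G\<^esub> x))) = (\<lambda>n. dist (a n) (v x))"
        using b(2) x unfolding P_def by blast
      moreover have "(\<lambda>n. dist (a n) (v x)) \<longlonglongrightarrow> dist y (v x)"
        by (intro tendsto_intros a)
      ultimately show "dist z (v (g \<otimes>\<^bsub>G\<^esub> x)) = dist y (v x)"
        using LIMSEQ_unique by metis
    qed
    ultimately show ?thesis by blast
  qed
  define \<phi> where "\<phi> g = (\<lambda>y\<in>S. SOME z. z \<in> S \<and> P g y z)" for g
  have \<phi>: "\<phi> g y \<in> S" "P g y (\<phi> g y)" if "g \<in> carrier G" "y \<in> S" for g y
    using someI_ex [of "\<lambda>z. z \<in> S \<and> P g y z"] ex [OF that] that(2) unfolding \<phi>_def by auto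
  \<comment> \<open>Two images of the same point are at distance 0 by \<open>iso\<close>.\<close>
  have unique: "\<phi> g y = z" if "g \<in> carrier G" "y \<in> S" "P g y z" for g y z
    using iso [OF that(1,2) \<phi>(2) [OF that(1,2)] that(3)] by simp
  have act: "group_action G S \<phi>"
  proof (rule group_actionI [OF \<open>group G\<close>])
    show "\<phi> g \<in> extensional S" for g unfolding \<phi>_def by simp
    show "\<phi> g y \<in> S" if "g \<in> carrier G" "y \<in> S" for g y using that by (rule \<phi>)
    show "\<phi> (g \<otimes>\<^bsub>G\<^esub> h) y = \<phi> g (\<phi> h y)"
      if "g \<in> carrier G" "h \<in> carrier G" "y \<in> S" for g h y
    proof (rule unique)
      show "P (g \<otimes>\<^bsub>G\<^esub> h) y (\<phi> g (\<phi> h y))"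
        using \<phi>(2) [OF that(1) \<phi>(1) [OF that(2,3)]] \<phi>(2) [OF that(2,3)] that
        unfolding P_def by (simp add: m_assoc)
    qed (use that in auto)
    show "\<phi> \<one>\<^bsub>G\<^esub> y = y" if "y \<in> S" for y
      using that by (intro unique) (auto simp: P_def)
  qed
  have proper: "metrically_proper G S \<phi>"
    unfolding metrically_proper_def
  proof (intro allI impI)
    fix B assume B: "B \<subseteq> S" "bounded B"
    then obtain R where R: "\<And>y. y \<in> B \<Longrightarrow> norm y \<le> R"
      unfolding bounded_iff by blast
    \<comment> \<open>\<open>v g\<close> is the image of the origin, hence as far from
      \<open>\<phi> g y\<close> as the origin is from \<open>y\<close>.\<close>
    have "norm (v g) \<le> 2 * R" if g: "g \<in> carrier G" "y \<in> B" "\<phi> g y \<in> B" for g y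
    proof -
      have "dist (\<phi> g y) (v (g \<otimes>\<^bsub>G\<^esub> \<one>\<^bsub>G\<^esub>)) = dist y (v \<one>\<^bsub>G\<^esub>)"
        using \<phi>(2) [OF g(1)] g(2) B(1) unfolding P_def by blast
      then have "dist (\<phi> g y) (v g) = norm y"
        using g(1) v_one by simp
      then have "norm (v g) \<le> norm (\<phi> g y) + norm y"
        using norm_triangle_sub [of "v g" "\<phi> g y"] by (simp add: dist_norm norm_minus_commute)
      then show ?thesis using R [OF g(2)] R [OF g(3)] by simp
    qed
    then have "{g \<in> carrier G. \<phi> g ` B \<inter> B \<noteq> {}} \<subseteq> {g \<in> carrier G. norm (v g) \<le> 2 * R}"
      by blast
    then show "finite {g \<in> carrier G. \<phi> g ` B \<inter> B \<noteq> {}}"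
      using fin finite_subset by blast
  qed
  have "isometric_action G S \<phi>"
    unfolding isometric_action_def using act iso \<phi> by blast
  then show ?thesis
    unfolding haagerup_def using \<open>subspace S\<close> proper S_def by blast
qed

text \<open>The GNS construction based at the identity: factoring the Gromov product gives vectors
  with \<open>(dist (v g) (v h))\<^sup>2 = D g h\<close>, and the base point becomes the
  origin.\<close>

lemma haagerup_ell2I:
  fixes G :: "('a, 'c) monoid_scheme"
  assumes "group G" and "countable (carrier G)"
    and D: "neg_type (carrier G) D"
    and inv: "\<And>g x y. g \<in> carrier G \<Longrightarrow> x \<in> carrier G \<Longrightarrow> y \<in> carrier G \<Longrightarrow>
      D (g \<otimes>\<^bsub>G\<^esub> x) (g \<otimes>\<^bsub>G\<^esub> y) = D x y"
    and fin: "\<And>R. finite {g \<in> carrier G. D g \<one>\<^bsub>G\<^esub> \<le> R}"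
  shows "haagerup TYPE(ell2) G"
proof -
  interpret group G by fact
  define K where "K x y = (D x \<one>\<^bsub>G\<^esub> + D y \<one>\<^bsub>G\<^esub> - D x y) / 2" for x y
  have "psd_kernel (carrier G) K"
    unfolding K_def by (rule neg_type_imp_psd_kernel [OF D]) simp
  from psd_kernel_factorization [OF this \<open>countable (carrier G)\<close>]
  obtain b :: "'a \<Rightarrow> nat \<Rightarrow> real" and N where b0: "\<And>g m. N g \<le> m \<Longrightarrow> b g m = 0"
    and b: "\<And>g h n. g \<in> carrier G \<Longrightarrow> h \<in> carrier G \<Longrightarrow> N g \<le> n \<Longrightarrow>
      K g h = (\<Sum>m<n. b g m * b h m)"
    by blast
  define v where "v g = Abs_ell2 (b g)" for g
  have nth: "ell2_nth (v g) = b g" for g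
  proof -
    have "summable (\<lambda>n. (b g n)\<^sup>2)"
      by (rule summable_finite [of "{..<N g}"]) (auto simp: b0)
    then show ?thesis by (simp add: v_def Abs_ell2_inverse)
  qed
  have inner: "inner (v g) (v h) = K g h" if "g \<in> carrier G" "h \<in> carrier G" for g h
    unfolding inner_ell2.rep_eq nth b [OF that order_refl]
    by (rule suminf_finite) (auto simp: b0)
  have dist: "(dist (v g) (v h))\<^sup>2 = D g h" if "g \<in> carrier G" "h \<in> carrier G" for g h
    using that neg_type_diag [OF D] neg_type_sym [OF D that]
    by (simp add: dist_norm power2_norm_eq_inner inner_diff_left inner_diff_right inner K_def field_simps)
  have "inner (v \<one>\<^bsub>G\<^esub>) (v \<one>\<^bsub>G\<^esub>) = 0"
    using neg_type_diag [OF D, of "\<one>\<^bsub>G\<^esub>"] by (simp add: inner K_def)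
  then have v_one: "v \<one>\<^bsub>G\<^esub> = 0" by simp
  show ?thesis
  proof (rule haagerup_of_orbit [of G v, OF \<open>group G\<close> v_one])
    show "dist (v (g \<otimes>\<^bsub>G\<^esub> x)) (v (g \<otimes>\<^bsub>G\<^esub> y)) = dist (v x) (v y)"
      if "g \<in> carrier G" "x \<in> carrier G" "y \<in> carrier G" for g x y
    proof -
      have "(dist (v (g \<otimes>\<^bsub>G\<^esub> x)) (v (g \<otimes>\<^bsub>G\<^esub> y)))\<^sup>2 = (dist (v x) (v y))\<^sup>2"
        using that inv by (simp add: dist)
      then show ?thesis by simp
    qed
    show "finite {g \<in> carrier G. norm (v g) \<le> R}" for R
    proof (rule finite_subset [OF _ fin])
      show "{g \<in> carrier G. norm (v g) \<le> R} \<subseteq> {g \<in> carrier G. D g \<one>\<^bsub>G\<^esub> \<le> R\<^sup>2}"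
        by (auto simp: v_one intro!: power_mono simp flip: dist)
    qed
  qed
qed

section \<open>Gaussian processes\<close>

text \<open>
  Of the joint law of the family \<open>\<xi>\<close> only the characteristic function is recorded: this is all
  that the expectation of a trigonometric polynomial depends on.
\<close>

locale gaussian_process = prob_space M for M :: "'m measure" +
  fixes I :: "'i set" and K :: "'i \<Rightarrow> 'i \<Rightarrow> real" and \<xi> :: "'i \<Rightarrow> 'm \<Rightarrow> real"
  assumes rv [measurable]: "\<And>i. \<xi> i \<in> borel_measurable M"
    and expectation_cos: "\<And>A \<theta>. finite A \<Longrightarrow> A \<subseteq> I \<Longrightarrow>
      expectation (\<lambda>\<omega>. cos (\<Sum>i\<in>A. \<theta> i * \<xi> i \<omega>)) = exp (- (\<Sum>i\<in>A. \<Sum>j\<in>A. \<theta> i * \<theta> j * K i j) / 2)"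

section \<open>Construction from independent standard normals\<close>

abbreviation gaussian_space :: "(nat \<Rightarrow> real) measure"
  where "gaussian_space \<equiv> Pi\<^sub>M UNIV (\<lambda>_. std_normal_distribution)"

lemma prob_space_std_normal: "prob_space std_normal_distribution"
  by (rule prob_space_normal_density) simp

lemma prob_space_gaussian_space: "prob_space gaussian_space"
  by (rule prob_space_PiM) (rule prob_space_std_normal)

lemma measurable_gaussian_space_component [measurable]:
  "(\<lambda>\<omega>. \<omega> m) \<in> borel_measurable gaussian_space"
  using measurable_component_singleton [of m UNIV "\<lambda>_. std_normal_distribution"] by simp

text \<open>The coordinates are independent, so the characteristic function of the sum is a product
  of Gaussian ones; the expected cosine is the real part of its value at 1.\<close>

lemma expectation_cos_gaussian_space:
  fixes a :: "nat \<Rightarrow> real"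
  shows "integral\<^sup>L gaussian_space (\<lambda>\<omega>. cos (\<Sum>m<n. a m * \<omega> m)) = exp (- (\<Sum>m<n. (a m)\<^sup>2) / 2)"
proof -
  interpret prob_space gaussian_space by (rule prob_space_gaussian_space)
  have distr: "distr gaussian_space borel (\<lambda>\<omega>. \<omega> m) = std_normal_distribution" for m
    using distr_PiM_component [of UNIV "\<lambda>_. std_normal_distribution" m]
    by (simp add: prob_space_std_normal cong: distr_cong)
  have "distr gaussian_space (Pi\<^sub>M UNIV (\<lambda>_. borel)) (\<lambda>\<omega>. \<lambda>m\<in>UNIV. \<omega> m) = gaussian_space"
    unfolding restrict_UNIV by (intro distr_id2 sets_PiM_cong) simp_all
  then have "indep_vars (\<lambda>_. borel) (\<lambda>m \<omega>. \<omega> m) (UNIV :: nat set)"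
    by (intro indep_vars_iff_distr_eq_PiM [THEN iffD2]) (simp_all only: distr measurable_gaussian_space_component UNIV_not_empty not_False_eq_True)
  from indep_vars_compose2 [OF this, of "\<lambda>m x. a m * x" "\<lambda>_. borel"]
  have "indep_vars (\<lambda>_. borel) (\<lambda>m \<omega>. a m * \<omega> m) (UNIV :: nat set)"
    by simp
  then have "indep_vars (\<lambda>_. borel) (\<lambda>m \<omega>. a m * \<omega> m) {..<n}"
    using subset_UNIV by (rule indep_vars_subset)
  then have "char (distr gaussian_space borel (\<lambda>\<omega>. \<Sum>m<n. a m * \<omega> m)) 1
      = (\<Prod>m<n. char (distr gaussian_space borel (\<lambda>\<omega>. a m * \<omega> m)) 1)"
    by (rule char_distr_sum)
  also have "\<dots> = (\<Prod>m<n. char (distr gaussian_space borel (\<lambda>\<omega>. \<omega> m)) (a m))"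
    by (simp add: char_def integral_distr)
  also have "\<dots> = of_real (exp (- (\<Sum>m<n. (a m)\<^sup>2) / 2))"
    by (simp add: distr char_std_normal_distribution sum_negf [symmetric] sum_divide_distrib
        exp_sum flip: of_real_prod)
  finally have "Re (char (distr gaussian_space borel (\<lambda>\<omega>. \<Sum>m<n. a m * \<omega> m)) 1)
      = exp (- (\<Sum>m<n. (a m)\<^sup>2) / 2)"
    by simp
  moreover have "char (distr gaussian_space borel (\<lambda>\<omega>. \<Sum>m<n. a m * \<omega> m)) 1
      = expectation (\<lambda>\<omega>. iexp (\<Sum>m<n. a m * \<omega> m))"
    by (simp add: char_def integral_distr)
  moreover have "Re (expectation (\<lambda>\<omega>. iexp (\<Sum>m<n. a m * \<omega> m)))
      = expectation (\<lambda>\<omega>. Re (iexp (\<Sum>m<n. a m * \<omega> m)))"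
    by (intro integral_Re [symmetric] integrable_iexp) measurable
  moreover have "Re (iexp x) = cos x" for x
    by (simp add: Re_exp)
  ultimately show ?thesis by (simp only:)
qed

text \<open>The rows of the triangular factor of \<open>K\<close>, paired with independent standard
  normals, give variables with covariance \<open>K\<close> as finite sums.\<close>

lemma gaussian_process_exists:
  assumes "psd_kernel I K" and "countable I"
  shows "\<exists>\<xi>. gaussian_process gaussian_space I K \<xi>"
proof -
  from psd_kernel_factorization [OF assms]
  obtain b :: "'a \<Rightarrow> nat \<Rightarrow> real" and N where b0: "\<And>i m. N i \<le> m \<Longrightarrow> b i m = 0"
    and b: "\<And>i j n. i \<in> I \<Longrightarrow> j \<in> I \<Longrightarrow> N i \<le> n \<Longrightarrow> K i j = (\<Sum>m<n. b i m * b j m)"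
    by blast
  interpret prob_space gaussian_space by (rule prob_space_gaussian_space)
  define \<xi> where "\<xi> i \<omega> = (\<Sum>m<N i. b i m * \<omega> m)" for i and \<omega> :: "nat \<Rightarrow> real"
  have E: "expectation (\<lambda>\<omega>. cos (\<Sum>i\<in>A. \<theta> i * \<xi> i \<omega>)) = exp (- (\<Sum>i\<in>A. \<Sum>j\<in>A. \<theta> i * \<theta> j * K i j) / 2)"
    if A: "finite A" "A \<subseteq> I" for A \<theta>
  proof -
    \<comment> \<open>A common length for all rows in \<open>A\<close>, so that the sums can be
      interchanged.\<close>
    define n where "n = Max (insert 0 (N ` A))"
    have n: "N i \<le> n" if "i \<in> A" for i
      unfolding n_def using A that by (intro Max_ge) auto
    define a where "a m = (\<Sum>i\<in>A. \<theta> i * b i m)" for m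
    have "(\<Sum>i\<in>A. \<theta> i * \<xi> i \<omega>) = (\<Sum>m<n. a m * \<omega> m)" for \<omega>
    proof -
      have "\<xi> i \<omega> = (\<Sum>m<n. b i m * \<omega> m)" if "i \<in> A" for i
        unfolding \<xi>_def using n [OF that] b0 by (intro sum.mono_neutral_left) auto
      then have "(\<Sum>i\<in>A. \<theta> i * \<xi> i \<omega>) = (\<Sum>i\<in>A. \<Sum>m<n. \<theta> i * b i m * \<omega> m)"
        by (simp add: sum_distrib_left mult.assoc)
      also have "\<dots> = (\<Sum>m<n. \<Sum>i\<in>A. \<theta> i * b i m * \<omega> m)"
        by (rule sum.swap)
      finally show ?thesis by (simp add: a_def sum_distrib_right)
    qed
    moreover have "(\<Sum>m<n. (a m)\<^sup>2) = (\<Sum>i\<in>A. \<Sum>j\<in>A. \<theta> i * \<theta> j * K i j)"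
    proof -
      have "(\<Sum>m<n. (a m)\<^sup>2) = (\<Sum>m<n. \<Sum>i\<in>A. \<Sum>j\<in>A. \<theta> i * \<theta> j * (b i m * b j m))"
        unfolding a_def power2_eq_square sum_product by (simp add: mult.assoc mult.left_commute)
      also have "\<dots> = (\<Sum>i\<in>A. \<Sum>m<n. \<Sum>j\<in>A. \<theta> i * \<theta> j * (b i m * b j m))"
        by (rule sum.swap)
      also have "\<dots> = (\<Sum>i\<in>A. \<Sum>j\<in>A. \<Sum>m<n. \<theta> i * \<theta> j * (b i m * b j m))"
        by (intro sum.cong refl sum.swap)
      also have "\<dots> = (\<Sum>i\<in>A. \<Sum>j\<in>A. \<theta> i * \<theta> j * K i j)"
        using A n by (intro sum.cong refl) (auto simp: b [of _ _ n] sum_distrib_left [symmetric] subset_iff)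
      finally show ?thesis .
    qed
    ultimately show ?thesis
      by (simp only: expectation_cos_gaussian_space)
  qed
  have "gaussian_process gaussian_space I K \<xi>"
  proof (intro gaussian_process.intro gaussian_process_axioms.intro prob_space_gaussian_space)
    show "\<xi> i \<in> borel_measurable gaussian_space" for i
      unfolding \<xi>_def by measurable
  qed (rule E)
  then show ?thesis by blast
qed

section \<open>Trigonometric moments and the covariance\<close>

context gaussian_process
begin

lemma integrable_bounded:
  assumes [measurable]: "f \<in> borel_measurable M" and "\<And>\<omega>. \<bar>f \<omega>\<bar> \<le> (1 :: real)"
  shows "integrable M f"
  by (rule integrable_const_bound [where B = 1]) (use assms in auto)

lemma prod_list_cos_le_1: "\<bar>\<Prod>i\<leftarrow>is. cos (\<xi> i \<omega>)\<bar> \<le> 1"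
proof (induction "is")
  case (Cons i "is")
  have "\<bar>cos (\<xi> i \<omega>)\<bar> * \<bar>\<Prod>j\<leftarrow>is. cos (\<xi> j \<omega>)\<bar> \<le> 1"
    by (rule mult_le_one) (use Cons.IH in auto)
  then show ?case by (simp add: abs_mult)
qed simp

lemma measurable_prod_list_cos [measurable]: "(\<lambda>\<omega>. \<Prod>i\<leftarrow>is. cos (\<xi> i \<omega>)) \<in> borel_measurable M"
proof (induction "is")
  case (Cons i "is")
  have "(\<lambda>\<omega>. cos (\<xi> i \<omega>) * (\<Prod>j\<leftarrow>is. cos (\<xi> j \<omega>))) \<in> borel_measurable M"
    by (intro borel_measurable_times Cons.IH) measurable
  then show ?case by (simp only: list.map prod_list.Cons)
qed simp

text \<open>Absorbing the factor \<open>cos (\<xi> i \<omega>)\<close> by the product-to-sum formula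
  moves the frequency at \<open>i\<close> up and down by 1.\<close>

lemma expectation_cos_prod_Cons:
  assumes A: "finite A" "i \<in> A"
  shows "expectation (\<lambda>\<omega>. (\<Prod>j\<leftarrow>i # is. cos (\<xi> j \<omega>)) * cos (\<Sum>j\<in>A. \<theta> j * \<xi> j \<omega>)) =
    (expectation (\<lambda>\<omega>. (\<Prod>j\<leftarrow>is. cos (\<xi> j \<omega>)) * cos (\<Sum>j\<in>A. (\<theta>(i := \<theta> i + 1)) j * \<xi> j \<omega>))
     + expectation (\<lambda>\<omega>. (\<Prod>j\<leftarrow>is. cos (\<xi> j \<omega>)) * cos (\<Sum>j\<in>A. (\<theta>(i := \<theta> i - 1)) j * \<xi> j \<omega>))) / 2"
proof -
  have shift: "(\<Sum>j\<in>A. (\<theta>(i := t)) j * \<xi> j \<omega>) = (\<Sum>j\<in>A. \<theta> j * \<xi> j \<omega>) + (t - \<theta> i) * \<xi> i \<omega>" for t \<omega>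
    unfolding sum.remove [OF A] by (simp add: algebra_simps)
  have int: "integrable M (\<lambda>\<omega>. (\<Prod>j\<leftarrow>is. cos (\<xi> j \<omega>)) * cos (\<Sum>j\<in>A. \<theta> j * \<xi> j \<omega>))" for \<theta>
    by (rule integrable_bounded) (auto simp: abs_mult intro: mult_le_one prod_list_cos_le_1)
  have "(\<Prod>j\<leftarrow>i # is. cos (\<xi> j \<omega>)) * cos (\<Sum>j\<in>A. \<theta> j * \<xi> j \<omega>) =
      ((\<Prod>j\<leftarrow>is. cos (\<xi> j \<omega>)) * cos (\<Sum>j\<in>A. (\<theta>(i := \<theta> i + 1)) j * \<xi> j \<omega>)
       + (\<Prod>j\<leftarrow>is. cos (\<xi> j \<omega>)) * cos (\<Sum>j\<in>A. (\<theta>(i := \<theta> i - 1)) j * \<xi> j \<omega>)) / 2" for \<omega>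
    unfolding shift by (simp add: cos_add cos_diff algebra_simps)
  then show ?thesis
    by (simp only: integral_divide_zero Bochner_Integration.integral_add [OF int int])
qed

end

text \<open>By the product-to-sum formula; the cosine of a linear combination makes the induction work.\<close>

lemma gaussian_process_expectation_cong:
  assumes "gaussian_process M I K \<xi>" and "gaussian_process M' I K \<xi>'"
    and A: "finite A" "A \<subseteq> I" and "set is \<subseteq> A"
  shows "integral\<^sup>L M (\<lambda>\<omega>. (\<Prod>j\<leftarrow>is. cos (\<xi> j \<omega>)) * cos (\<Sum>j\<in>A. \<theta> j * \<xi> j \<omega>)) =
    integral\<^sup>L M' (\<lambda>\<omega>. (\<Prod>j\<leftarrow>is. cos (\<xi>' j \<omega>)) * cos (\<Sum>j\<in>A. \<theta> j * \<xi>' j \<omega>))"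
  using \<open>set is \<subseteq> A\<close>
proof (induction "is" arbitrary: \<theta>)
  case Nil
  then show ?case
    using gaussian_process.expectation_cos [OF assms(1) A] gaussian_process.expectation_cos [OF assms(2) A]
    by simp
next
  case (Cons i "is")
  then have "i \<in> A" by simp
  show ?case
    unfolding gaussian_process.expectation_cos_prod_Cons [OF assms(1) A(1) \<open>i \<in> A\<close>]
      gaussian_process.expectation_cos_prod_Cons [OF assms(2) A(1) \<open>i \<in> A\<close>]
    using Cons by simp
qed

text \<open>Serves both to translate the index set by a group element and to isolate a single
  variable. Injectivity of \<open>s\<close> lets the frequencies be carried over along its
  inverse.\<close>

lemma gaussian_process_reindex:
  assumes "gaussian_process M I K \<xi>" and s: "inj_on s J" "s ` J \<subseteq> I"
    and K: "\<And>i j. i \<in> J \<Longrightarrow> j \<in> J \<Longrightarrow> K (s i) (s j) = K' i j"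
  shows "gaussian_process M J K' (\<lambda>i. \<xi> (s i))"
proof -
  interpret gaussian_process M I K \<xi> by fact
  show ?thesis
  proof (intro gaussian_process.intro gaussian_process_axioms.intro prob_space_axioms rv)
    fix A and \<theta> :: "'c \<Rightarrow> real" assume A: "finite A" "A \<subseteq> J"
    then have inj: "inj_on s A" using s(1) inj_on_subset by blast
    let ?\<theta> = "\<lambda>i. \<theta> (the_inv_into A s i)"
    have "(\<Sum>i\<in>A. \<theta> i * \<xi> (s i) \<omega>) = (\<Sum>i\<in>s ` A. ?\<theta> i * \<xi> i \<omega>)" for \<omega>
      using inj by (simp add: sum.reindex the_inv_into_f_f)
    moreover have "(\<Sum>i\<in>A. \<Sum>j\<in>A. \<theta> i * \<theta> j * K' i j) = (\<Sum>i\<in>s ` A. \<Sum>j\<in>s ` A. ?\<theta> i * ?\<theta> j * K i j)"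
      using inj A(2) by (auto simp: sum.reindex the_inv_into_f_f K subset_iff intro!: sum.cong)
    moreover have "finite (s ` A)" "s ` A \<subseteq> I" using A s by auto
    ultimately show "expectation (\<lambda>\<omega>. cos (\<Sum>i\<in>A. \<theta> i * \<xi> (s i) \<omega>)) =
        exp (- (\<Sum>i\<in>A. \<Sum>j\<in>A. \<theta> i * \<theta> j * K' i j) / 2)"
      using expectation_cos [of "s ` A" ?\<theta>] by simp
  qed
qed

text \<open>Schoenberg's theorem: the kernel is \<open>E (cos (\<xi> x - \<xi> y))\<close> for a Gaussian process with
  \<open>E (\<xi> x - \<xi> y)\<^sup>2 = 2 t D x y\<close>.\<close>

lemma psd_kernel_exp_neg_type:
  assumes D: "neg_type A D" and "countable A" and "0 \<le> t"
  shows "psd_kernel A (\<lambda>x y. exp (- t * D x y))"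
proof (cases "A = {}")
  case False
  then obtain o' where o': "o' \<in> A" by blast
  let ?D = "\<lambda>x y. 2 * t * D x y"
  define K where "K x y = (?D x o' + ?D y o' - ?D x y) / 2" for x y
  have "neg_type A ?D"
    using neg_type_scale [OF D, of "2 * t"] \<open>0 \<le> t\<close> by simp
  then have "psd_kernel A K"
    unfolding K_def using o' by (rule neg_type_imp_psd_kernel)
  then obtain \<xi> where "gaussian_process gaussian_space A K \<xi>"
    using gaussian_process_exists \<open>countable A\<close> by blast
  then interpret gaussian_process gaussian_space A K \<xi> .
  have E: "exp (- t * D x y) = expectation (\<lambda>\<omega>. cos (\<xi> x \<omega> - \<xi> y \<omega>))" if "x \<in> A" "y \<in> A" for x y
  proof (cases "x = y")
    case True
    then show ?thesis using neg_type_diag [OF D] that prob_space by simp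
  next
    case False
    then show ?thesis
      using expectation_cos [of "{x, y}" "\<lambda>z. if z = x then 1 else -1"] that
        neg_type_sym [OF D that] neg_type_diag [OF D]
      by (simp add: K_def field_simps)
  qed
  have "0 \<le> (\<Sum>x\<in>F. \<Sum>y\<in>F. c x * c y * exp (- t * D x y))" if F: "finite F" "F \<subseteq> A" for F c
  proof -
    have int: "integrable gaussian_space (\<lambda>\<omega>. cos (\<xi> x \<omega> - \<xi> y \<omega>))" for x y
      by (rule integrable_bounded) auto
    have "(\<Sum>x\<in>F. \<Sum>y\<in>F. c x * c y * exp (- t * D x y))
        = (\<Sum>x\<in>F. \<Sum>y\<in>F. c x * c y * expectation (\<lambda>\<omega>. cos (\<xi> x \<omega> - \<xi> y \<omega>)))"
      using F by (intro sum.cong refl arg_cong2 [where f = "(*)"] E) auto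
    also have "\<dots> = expectation (\<lambda>\<omega>. \<Sum>x\<in>F. \<Sum>y\<in>F. c x * c y * cos (\<xi> x \<omega> - \<xi> y \<omega>))"
      using int by simp
    \<comment> \<open>By the addition theorem
      \<open>cos (\<xi> x \<omega> - \<xi> y \<omega>)\<close> is a sum of two rank-one
      kernels.\<close>
    also have "(\<lambda>\<omega>. \<Sum>x\<in>F. \<Sum>y\<in>F. c x * c y * cos (\<xi> x \<omega> - \<xi> y \<omega>))
        = (\<lambda>\<omega>. (\<Sum>x\<in>F. c x * cos (\<xi> x \<omega>))\<^sup>2 + (\<Sum>x\<in>F. c x * sin (\<xi> x \<omega>))\<^sup>2)"
      unfolding power2_eq_square sum_product cos_diff
      by (simp add: distrib_left sum.distrib mult.assoc mult.left_commute)
    also have "0 \<le> expectation \<dots>"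
      by (intro Bochner_Integration.integral_nonneg) simp
    finally show ?thesis .
  qed
  then show ?thesis
    using neg_type_sym [OF D] unfolding psd_kernel_def by simp
qed (simp add: psd_kernel_def)

section \<open>Random soft walls\<close>

definition cos_moment :: "nat \<Rightarrow> real"
  where "cos_moment n = integral\<^sup>L std_normal_distribution (\<lambda>z. cos z ^ n)"

text \<open>The model with a single variable, to which any \<open>\<xi> i\<close> of variance 1 is
  compared.\<close>

lemma gaussian_process_std_normal:
  "gaussian_process std_normal_distribution UNIV (\<lambda>_ _. 1) (\<lambda>_ :: unit. \<lambda>z. z)"
proof (intro gaussian_process.intro gaussian_process_axioms.intro prob_space_std_normal)
  interpret prob_space std_normal_distribution by (rule prob_space_std_normal)
  fix A :: "unit set" and \<theta> :: "unit \<Rightarrow> real"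
  have *: "expectation (\<lambda>z. cos (t * z)) = exp (- t\<^sup>2 / 2)" for t
  proof -
    have "expectation (\<lambda>z. Re (iexp (t * z))) = Re (expectation (\<lambda>z. iexp (t * z)))"
      by (intro integral_Re integrable_iexp) simp_all
    also have "expectation (\<lambda>z. iexp (t * z)) = char std_normal_distribution t"
      by (simp add: char_def)
    finally show ?thesis by (simp add: Re_exp char_std_normal_distribution)
  qed
  have "A = {} \<or> A = {()}" by auto
  then show "expectation (\<lambda>z. cos (\<Sum>i\<in>A. \<theta> i * z)) = exp (- (\<Sum>i\<in>A. \<Sum>j\<in>A. \<theta> i * \<theta> j * 1) / 2)"
    using * [of "\<theta> ()"] using prob_space by (auto simp: power2_eq_square)
qed simp

text \<open>For \<open>r < 1\<close> the squared cosine is at least \<open>r\<close> on an interval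
  about 0 of positive mass \<open>p\<close>, so the even moments are at least
  \<open>p * r ^ m\<close>. If every ratio of consecutive even moments were below
  \<open>1 - e\<close>, they would decay geometrically at a rate faster than some such
  \<open>r\<close>.\<close>

lemma cos_moment_pos: "0 < cos_moment (2 * m)"
  and cos_moment_ratio: "0 < e \<Longrightarrow> \<exists>m. cos_moment (2 * m) - cos_moment (2 * Suc m) \<le> e * cos_moment (2 * m)"
proof -
  interpret prob_space std_normal_distribution by (rule prob_space_std_normal)
  have int: "integrable std_normal_distribution (\<lambda>z. cos z ^ n)" for n
    by (rule integrable_const_bound [where B = 1]) (auto simp: power_abs power_le_one)
  have lower: "\<exists>p>0. \<forall>m. p * r ^ m \<le> cos_moment (2 * m)" if r: "0 \<le> r" "r < 1" for r
  proof -
    have "isCont (\<lambda>z::real. (cos z)\<^sup>2) 0" by (intro continuous_intros)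
    then have "((\<lambda>z::real. (cos z)\<^sup>2) \<longlongrightarrow> 1) (at 0)"
      by (simp add: isCont_def)
    then have "eventually (\<lambda>z::real. r < (cos z)\<^sup>2) (at 0)"
      using r(2) by (rule order_tendstoD)
    then obtain d where d: "0 < d" "\<And>z::real. z \<noteq> 0 \<Longrightarrow> \<bar>z\<bar> < d \<Longrightarrow> r < (cos z)\<^sup>2"
      by (auto simp: eventually_at)
    then have d': "r \<le> (cos z)\<^sup>2" if "\<bar>z\<bar> < d" for z :: real
      using that r by (cases "z = 0") (auto intro: less_imp_le)
    let ?p = "measure std_normal_distribution {-d<..<d}"
    have "?p \<noteq> 0"
    proof
      assume "?p = 0"
      then have "AE z in std_normal_distribution. z \<notin> {-d<..<d}"
        by (intro AE_not_in) (simp add: null_sets_def emeasure_eq_measure)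
      then have "AE z in lborel. z \<notin> {-d<..<d}"
        by (subst (asm) AE_density) (auto simp: normal_density_pos)
      then have "emeasure lborel {-d<..<d} = 0"
        using AE_iff_null_sets [of "{-d<..<d}" lborel] by (simp add: null_sets_def)
      then show False using d(1) by simp
    qed
    then have "0 < ?p" using measure_nonneg [of std_normal_distribution "{-d<..<d}"] by linarith
    moreover have "?p * r ^ m \<le> cos_moment (2 * m)" for m
    proof -
      have "?p * r ^ m = expectation (\<lambda>z. indicator {-d<..<d} z * r ^ m)"
        by simp
      also have "\<dots> \<le> cos_moment (2 * m)"
        unfolding cos_moment_def
      proof (intro integral_mono int)
        show "integrable std_normal_distribution (\<lambda>z. indicator {-d<..<d} z * r ^ m)"
          by (intro integrable_mult_left integrable_real_indicator) (auto simp: emeasure_eq_measure)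
        show "indicator {-d<..<d} z * r ^ m \<le> cos z ^ (2 * m)" for z
          using d' [of z] r by (auto simp: indicator_def power_mult intro!: power_mono)
      qed
      finally show ?thesis .
    qed
    ultimately show ?thesis by blast
  qed
  show "0 < cos_moment (2 * m)" for m
  proof -
    obtain p where p: "0 < p" "\<And>m. p * (1 / 2) ^ m \<le> cos_moment (2 * m)"
      using lower [of "1 / 2"] by auto
    have "0 < p * (1 / 2) ^ m" using p(1) by simp
    then show ?thesis using p(2) [of m] by linarith
  qed
  note pos = this
  show "\<exists>m. cos_moment (2 * m) - cos_moment (2 * Suc m) \<le> e * cos_moment (2 * m)" if e: "0 < e"
  proof (rule ccontr)
    \<comment> \<open>The maximum covers \<open>e > 1\<close>, where \<open>1 - e\<close> is
      negative; \<open>r\<close> only has to lie strictly between \<open>s\<close> and 1.\<close>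
    define s where "s = max (1 - e) 0"
    define r where "r = (s + 1) / 2"
    have s: "0 \<le> s" "s < 1" "s < r" "r < 1" "0 < r" using e by (auto simp: s_def r_def)
    assume "\<not> ?thesis"
    then have step: "cos_moment (2 * Suc m) < (1 - e) * cos_moment (2 * m)" for m
      by (auto simp: not_le algebra_simps)
    have "cos_moment (2 * m) \<le> s ^ m" for m
    proof (induction m)
      case 0
      then show ?case by (simp add: cos_moment_def prob_space)
    next
      case (Suc m)
      have "cos_moment (2 * Suc m) \<le> (1 - e) * cos_moment (2 * m)"
        using step by (rule less_imp_le)
      also have "\<dots> \<le> s * s ^ m"
        using Suc pos [of m] s by (intro mult_mono) (auto simp: s_def)
      finally show ?case by simp
    qed
    moreover obtain p where p: "0 < p" "\<And>m. p * r ^ m \<le> cos_moment (2 * m)"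
      using lower [of r] s by auto
    ultimately have "p * r ^ m \<le> s ^ m" for m
      using order_trans by blast
    then have "p \<le> (s / r) ^ m" for m
      using s by (simp add: power_divide field_simps)
    moreover have "(\<lambda>m. (s / r) ^ m) \<longlonglongrightarrow> 0"
      using s by (intro LIMSEQ_realpow_zero) auto
    ultimately have "p \<le> 0"
      by (intro LIMSEQ_le_const) auto
    then show False using p(1) by simp
  qed
qed

lemma gaussian_process_expectation_cos_power:
  assumes "gaussian_process M I K \<xi>" and "i \<in> I" "K i i = 1"
  shows "integral\<^sup>L M (\<lambda>\<omega>. cos (\<xi> i \<omega>) ^ n) = cos_moment n"
proof -
  have "gaussian_process M UNIV (\<lambda>_ _. 1) (\<lambda>_ :: unit. \<xi> i)"
    by (rule gaussian_process_reindex [OF assms(1)]) (use assms in \<open>auto simp: inj_on_def\<close>)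
  \<comment> \<open>The power is a product over a constant list, and zero frequencies turn the
    remaining cosine into 1.\<close>
  from gaussian_process_expectation_cong [OF this gaussian_process_std_normal, of UNIV "replicate n ()" "\<lambda>_. 0"]
  show ?thesis by (simp add: cos_moment_def map_replicate_const)
qed

text \<open>
  For \<open>p = (w, y)\<close> and \<open>p' = (w', y')\<close> with \<open>F = {x. w x \<noteq> w' x}\<close> this kernel is an average of
  \<open>\<beta> y * \<beta> y' * P (F \<subseteq> A)\<close>, where \<open>\<beta> = cos\<^sup>m\<close> concentrates the base point near the
  maximum of \<open>cos\<^sup>2\<close>, and each \<open>x\<close> is put into the random half-space \<open>A\<close> independently
  with probability \<open>cos\<^sup>2\<close>.
\<close>

definition wall_kernel :: "'m measure \<Rightarrow> ('i \<Rightarrow> 'm \<Rightarrow> real) \<Rightarrow> nat \<Rightarrow> 'i \<Rightarrow> 'i \<Rightarrow> 'i set \<Rightarrow> real"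
  where "wall_kernel M \<xi> m y y' F = integral\<^sup>L M (\<lambda>\<omega>. cos (\<xi> y \<omega>) ^ m * cos (\<xi> y' \<omega>) ^ m *
    (\<Prod>x\<in>F. (cos (\<xi> x \<omega>))\<^sup>2)) / cos_moment (2 * m)"

text \<open>The family \<open>\<lambda>i. \<xi> (s i)\<close> has the same covariance on
  \<open>I\<close>, and the integrand is a product of cosines, so its expectation depends on the
  covariance alone.\<close>

lemma wall_kernel_invariant:
  assumes G: "gaussian_process M I K \<xi>" and s: "inj_on s I" "s ` I \<subseteq> I"
    and K: "\<And>i j. i \<in> I \<Longrightarrow> j \<in> I \<Longrightarrow> K (s i) (s j) = K i j"
    and yF: "y \<in> I" "y' \<in> I" "finite F" "F \<subseteq> I"
  shows "wall_kernel M \<xi> m (s y) (s y') (s ` F) = wall_kernel M \<xi> m y y' F"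
proof -
  obtain xs where xs: "set xs = F" "distinct xs"
    using finite_distinct_list [OF yF(3)] by blast
  \<comment> \<open>The list \<open>xs\<close> occurs twice because of the squares.\<close>
  let ?is = "replicate m y @ replicate m y' @ xs @ xs"
  have list: "cos (\<xi>' y \<omega>) ^ m * cos (\<xi>' y' \<omega>) ^ m * (\<Prod>x\<in>F. (cos (\<xi>' x \<omega>))\<^sup>2)
      = (\<Prod>j\<leftarrow>?is. cos (\<xi>' j \<omega>)) * cos (\<Sum>j\<in>insert y (insert y' F). 0 * \<xi>' j \<omega>)"
    for \<xi>' :: "'b \<Rightarrow> 'a \<Rightarrow> real" and \<omega>
  proof -
    have "(\<Prod>x\<in>F. cos (\<xi>' x \<omega>)) = (\<Prod>j\<leftarrow>xs. cos (\<xi>' j \<omega>))"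
      using prod.distinct_set_conv_list [OF xs(2)] xs(1) by simp
    then show ?thesis
      by (simp add: map_replicate_const power2_eq_square prod.distrib mult.assoc)
  qed
  have image: "(\<Prod>x\<in>s ` F. (cos (\<xi> x \<omega>))\<^sup>2) = (\<Prod>x\<in>F. (cos (\<xi> (s x) \<omega>))\<^sup>2)" for \<omega>
    using s(1) yF(4) by (subst prod.reindex) (auto intro: inj_on_subset)
  show ?thesis
    unfolding wall_kernel_def image list [of \<xi>] list [of "\<lambda>i. \<xi> (s i)"]
    by (subst gaussian_process_expectation_cong [OF gaussian_process_reindex [OF G s K] G])
      (use xs yF in auto)
qed

text \<open>The factor is \<open>a\<close> plus \<open>1 - a\<close> times the indicator of
  \<open>f p = f p'\<close>, and the indicator splits the form into forms of \<open>K\<close> on the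
  fibres of \<open>f\<close>.\<close>

lemma psd_kernel_mult_eq:
  assumes K: "psd_kernel A K" and a: "0 \<le> a" "a \<le> 1"
  shows "psd_kernel A (\<lambda>p p'. K p p' * (if f p = f p' then 1 else a))"
proof -
  have "0 \<le> (\<Sum>p\<in>F. \<Sum>p'\<in>F. c p * c p' * (K p p' * (if f p = f p' then 1 else a)))"
    if F: "finite F" "F \<subseteq> A" for F c
  proof -
    have "(\<Sum>p\<in>F. \<Sum>p'\<in>F. c p * c p' * (K p p' * (if f p = f p' then 1 else a)))
        = a * (\<Sum>p\<in>F. \<Sum>p'\<in>F. c p * c p' * K p p')
          + (1 - a) * (\<Sum>p\<in>F. \<Sum>p'\<in>F. if f p' = f p then c p * c p' * K p p' else 0)"
      unfolding sum_distrib_left sum.distrib [symmetric]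
      by (intro sum.cong refl) (auto simp: algebra_simps)
    moreover have "(\<Sum>p\<in>F. \<Sum>p'\<in>F. if f p' = f p then c p * c p' * K p p' else 0)
        = (\<Sum>h\<in>f ` F. \<Sum>p\<in>{p \<in> F. f p = h}. \<Sum>p'\<in>{p' \<in> F. f p' = h}. c p * c p' * K p p')"
    proof -
      have "(\<Sum>p\<in>F. \<Sum>p'\<in>F. if f p' = f p then c p * c p' * K p p' else 0) =
          (\<Sum>h\<in>f ` F. \<Sum>p\<in>{p \<in> F. f p = h}. \<Sum>p'\<in>F. if f p' = f p then c p * c p' * K p p' else 0)"
        by (rule sum.image_gen [OF F(1)])
      also have "\<dots> = (\<Sum>h\<in>f ` F. \<Sum>p\<in>{p \<in> F. f p = h}. \<Sum>p'\<in>{p' \<in> F. f p' = h}. c p * c p' * K p p')"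
        by (rule sum.cong [OF refl], rule sum.cong [OF refl]) (auto simp: sum.inter_filter F(1))
      finally show ?thesis .
    qed
    moreover have "0 \<le> (\<Sum>h\<in>f ` F. \<Sum>p\<in>{p \<in> F. f p = h}. \<Sum>p'\<in>{p' \<in> F. f p' = h}. c p * c p' * K p p')"
      using F by (intro sum_nonneg psd_kernel_nonneg [OF K]) auto
    ultimately show ?thesis
      using a psd_kernel_nonneg [OF K F, of c] by simp
  qed
  then show ?thesis
    using psd_kernel_sym [OF K] unfolding psd_kernel_def by auto
qed

lemma psd_kernel_prod_mult_eq:
  assumes "psd_kernel A K" and "finite Y" and "\<And>x. x \<in> Y \<Longrightarrow> 0 \<le> a x \<and> a x \<le> 1"
  shows "psd_kernel A (\<lambda>p p'. K p p' * (\<Prod>x\<in>Y. if w p x = w p' x then 1 else a x))"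
  using assms(2,3)
proof (induction Y)
  case (insert x Y)
  then have "psd_kernel A (\<lambda>p p'. K p p' * (\<Prod>x\<in>Y. if w p x = w p' x then 1 else a x) *
      (if w p x = w p' x then 1 else a x))"
    by (intro psd_kernel_mult_eq) auto
  then show ?case using insert(1,2) by (simp add: mult.assoc mult.left_commute mult.commute)
qed (use assms(1) in simp)

lemma prod_cos2_unit_interval: "(\<Prod>x\<in>F. (cos (g x :: real))\<^sup>2) \<in> {0..1}"
  by (auto intro!: prod_nonneg prod_le_1 simp: abs_square_le_1)

section \<open>Positive definiteness of the wall kernels\<close>

context gaussian_process
begin

lemma integrable_wall:
  "integrable M (\<lambda>\<omega>. cos (\<xi> y \<omega>) ^ m * cos (\<xi> y' \<omega>) ^ m * (\<Prod>x\<in>F. (cos (\<xi> x \<omega>))\<^sup>2))"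
proof (rule integrable_bounded)
  have *: "\<bar>cos (\<xi> y \<omega>) ^ m\<bar> \<le> 1" for y \<omega>
    by (simp add: power_abs power_le_one)
  show "\<bar>cos (\<xi> y \<omega>) ^ m * cos (\<xi> y' \<omega>) ^ m * (\<Prod>x\<in>F. (cos (\<xi> x \<omega>))\<^sup>2)\<bar> \<le> 1" for \<omega>
    unfolding abs_mult using prod_cos2_unit_interval [of "\<lambda>x. \<xi> x \<omega>" F]
    by (intro mult_le_one *) (auto simp: abs_mult)
qed measurable

text \<open>The integrand is positive definite for each outcome already: a rank-one kernel times,
  for each coordinate, a factor that depends only on whether the values there agree. Integration and
  normalization preserve this.\<close>

lemma psd_wall_kernel:
  fixes w :: "'p \<Rightarrow> 'i \<Rightarrow> 'b"
  assumes fin: "\<And>p p'. p \<in> P \<Longrightarrow> p' \<in> P \<Longrightarrow> finite {x \<in> I. w p x \<noteq> w p' x}"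
  shows "psd_kernel P (\<lambda>p p'. wall_kernel M \<xi> m (\<pi> p) (\<pi> p') {x \<in> I. w p x \<noteq> w p' x})"
proof -
  have "0 \<le> (\<Sum>p\<in>F. \<Sum>p'\<in>F. c p * c p' * wall_kernel M \<xi> m (\<pi> p) (\<pi> p') {x \<in> I. w p x \<noteq> w p' x})"
    if F: "finite F" "F \<subseteq> P" for F c
  proof -
    \<comment> \<open>One finite set of coordinates for all pairs from \<open>F\<close>, so that the
      products run over a common range.\<close>
    define Y where "Y = (\<Union>p\<in>F. \<Union>p'\<in>F. {x \<in> I. w p x \<noteq> w p' x})"
    have Y: "finite Y" unfolding Y_def using F fin by blast
    let ?g = "\<lambda>p p' \<omega>. cos (\<xi> (\<pi> p) \<omega>) ^ m * cos (\<xi> (\<pi> p') \<omega>) ^ m *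
      (\<Prod>x\<in>{x \<in> I. w p x \<noteq> w p' x}. (cos (\<xi> x \<omega>))\<^sup>2)"
    have pos: "0 \<le> (\<Sum>p\<in>F. \<Sum>p'\<in>F. c p * c p' * ?g p p' \<omega>)" for \<omega>
    proof -
      have "(\<Prod>x\<in>{x \<in> I. w p x \<noteq> w p' x}. (cos (\<xi> x \<omega>))\<^sup>2) =
          (\<Prod>x\<in>Y. if w p x = w p' x then 1 else (cos (\<xi> x \<omega>))\<^sup>2)" if "p \<in> F" "p' \<in> F" for p p'
        using Y that by (intro prod.mono_neutral_cong_left) (auto simp: Y_def)
      then have "(\<Sum>p\<in>F. \<Sum>p'\<in>F. c p * c p' * ?g p p' \<omega>) = (\<Sum>p\<in>F. \<Sum>p'\<in>F. c p * c p' *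
          (cos (\<xi> (\<pi> p) \<omega>) ^ m * cos (\<xi> (\<pi> p') \<omega>) ^ m *
            (\<Prod>x\<in>Y. if w p x = w p' x then 1 else (cos (\<xi> x \<omega>))\<^sup>2)))"
        by simp
      moreover have "psd_kernel UNIV (\<lambda>p p'. cos (\<xi> (\<pi> p) \<omega>) ^ m * cos (\<xi> (\<pi> p') \<omega>) ^ m)"
      proof -
        have "(\<Sum>p\<in>F. \<Sum>p'\<in>F. c p * c p' * (cos (\<xi> (\<pi> p) \<omega>) ^ m * cos (\<xi> (\<pi> p') \<omega>) ^ m))
          = (\<Sum>p\<in>F. c p * cos (\<xi> (\<pi> p) \<omega>) ^ m)\<^sup>2" for F c
          unfolding power2_eq_square [of "sum _ _"] sum_product by (intro sum.cong refl) simp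
        then show ?thesis by (simp add: psd_kernel_def mult.commute)
      qed
      then have "psd_kernel UNIV (\<lambda>p p'. cos (\<xi> (\<pi> p) \<omega>) ^ m * cos (\<xi> (\<pi> p') \<omega>) ^ m *
            (\<Prod>x\<in>Y. if w p x = w p' x then 1 else (cos (\<xi> x \<omega>))\<^sup>2))"
        using Y by (rule psd_kernel_prod_mult_eq) (simp add: abs_square_le_1)
      ultimately show ?thesis
        using psd_kernel_nonneg [OF _ F(1) subset_UNIV] by simp
    qed
    have "(\<Sum>p\<in>F. \<Sum>p'\<in>F. c p * c p' * wall_kernel M \<xi> m (\<pi> p) (\<pi> p') {x \<in> I. w p x \<noteq> w p' x})
        = expectation (\<lambda>\<omega>. \<Sum>p\<in>F. \<Sum>p'\<in>F. c p * c p' * ?g p p' \<omega>) / cos_moment (2 * m)"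
      unfolding wall_kernel_def by (simp add: integrable_wall sum_divide_distrib)
    moreover have "0 \<le> expectation (\<lambda>\<omega>. \<Sum>p\<in>F. \<Sum>p'\<in>F. c p * c p' * ?g p p' \<omega>)"
      by (intro Bochner_Integration.integral_nonneg pos)
    ultimately show ?thesis using cos_moment_pos [of m] by simp
  qed
  moreover have "wall_kernel M \<xi> m (\<pi> p) (\<pi> p') {x \<in> I. w p x \<noteq> w p' x} =
      wall_kernel M \<xi> m (\<pi> p') (\<pi> p) {x \<in> I. w p' x \<noteq> w p x}" for p p'
  proof -
    have "{x \<in> I. w p x \<noteq> w p' x} = {x \<in> I. w p' x \<noteq> w p x}" by auto
    then show ?thesis by (simp add: wall_kernel_def mult.commute)
  qed
  ultimately show ?thesis unfolding psd_kernel_def by blast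
qed

end

text \<open>Bounds the weight with which the soft half-space misses a point of value
  \<open>x\<close> while the base point has value \<open>a\<close>. With \<open>d = x - a\<close>,
  the squared sine of \<open>x\<close> is at most twice the sum of those of \<open>d\<close> and
  \<open>a\<close>; the latter becomes the difference of two even powers.\<close>

lemma cos_power_mult_sin2_le:
  fixes a x :: real
  shows "cos a ^ (2 * m) * (sin x)\<^sup>2 \<le>
    2 * (cos a ^ (2 * m) - cos a ^ (2 * Suc m)) + 4 * (1 - cos (x - a))"
proof -
  define d where "d = x - a"
  have "sin x = sin d * cos a + cos d * sin a"
    using sin_add [of d a] by (simp add: d_def)
  then have "(sin x)\<^sup>2 = (sin d * cos a)\<^sup>2 + (cos d * sin a)\<^sup>2 + 2 * (sin d * cos a) * (cos d * sin a)"
    by (simp only: power2_sum)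
  then have "(sin x)\<^sup>2 \<le> 2 * (sin d * cos a)\<^sup>2 + 2 * (cos d * sin a)\<^sup>2"
    using zero_le_power2 [of "sin d * cos a - cos d * sin a"]
    unfolding power2_diff by linarith
  also have "\<dots> \<le> 2 * (sin d)\<^sup>2 + 2 * (sin a)\<^sup>2"
    by (intro add_mono mult_left_mono) (simp_all add: power_mult_distrib mult_left_le mult_left_le_one_le abs_square_le_1)
  also have "(sin d)\<^sup>2 \<le> 2 * (1 - cos d)"
  proof -
    have "(1 - cos d) * (1 + cos d) \<le> (1 - cos d) * 2"
      by (intro mult_left_mono) simp_all
    then show ?thesis
      unfolding sin_squared_eq by (simp add: power2_eq_square algebra_simps)
  qed
  finally have "(sin x)\<^sup>2 \<le> 4 * (1 - cos d) + 2 * (sin a)\<^sup>2" by simp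
  moreover have c: "0 \<le> cos a ^ (2 * m)" "cos a ^ (2 * m) \<le> 1"
    by (simp_all add: power_mult power_le_one abs_square_le_1)
  ultimately have "cos a ^ (2 * m) * (sin x)\<^sup>2 \<le> cos a ^ (2 * m) * (4 * (1 - cos d) + 2 * (sin a)\<^sup>2)"
    by (intro mult_left_mono)
  also have "\<dots> = cos a ^ (2 * m) * (4 * (1 - cos d)) + 2 * (cos a ^ (2 * m) - cos a ^ (2 * Suc m))"
    unfolding sin_squared_eq by (simp add: power2_eq_square algebra_simps)
  also have "cos a ^ (2 * m) * (4 * (1 - cos d)) \<le> 4 * (1 - cos d)"
    using c by (intro mult_left_le_one_le) simp_all
  finally show ?thesis by (simp add: d_def)
qed

text \<open>The \<open>m\<close>-th power is Lipschitz with constant \<open>m\<close> on [-1, 1],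
  and \<open>2 * (1 - cos (a - b))\<close> is the squared chord between the points of angles
  \<open>a\<close> and \<open>b\<close> on the unit circle.\<close>

lemma cos_power_diff_squared_le:
  fixes a b :: real
  shows "(cos a ^ m - cos b ^ m)\<^sup>2 \<le> 2 * (real m)\<^sup>2 * (1 - cos (a - b))"
proof -
  have "norm (cos a ^ m - cos b ^ m) \<le> real m * norm (cos a - cos b)"
    by (rule norm_power_diff) simp_all
  then have "\<bar>cos a ^ m - cos b ^ m\<bar>\<^sup>2 \<le> (real m * \<bar>cos a - cos b\<bar>)\<^sup>2"
    by (intro power_mono) simp_all
  then have 1: "(cos a ^ m - cos b ^ m)\<^sup>2 \<le> (real m)\<^sup>2 * (cos a - cos b)\<^sup>2"
    by (simp add: power_mult_distrib)
  have "(cos a - cos b)\<^sup>2 \<le> (cos a - cos b)\<^sup>2 + (sin a - sin b)\<^sup>2" by simp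
  also have "\<dots> = 2 * (1 - cos (a - b))"
    using sin_cos_squared_add [of a] sin_cos_squared_add [of b]
    unfolding power2_diff cos_diff by (simp add: algebra_simps)
  finally have "(real m)\<^sup>2 * (cos a - cos b)\<^sup>2 \<le> (real m)\<^sup>2 * (2 * (1 - cos (a - b)))"
    by (intro mult_left_mono) simp_all
  from order_trans [OF 1 this] show ?thesis by (simp only: ac_simps)
qed

text \<open>With \<open>u\<close>, \<open>v\<close> the two powers and \<open>p\<close> the product,
  the left-hand side is \<open>(u\<^sup>2 + v\<^sup>2) / 2 * (1 - p) + (u - v)\<^sup>2 * p /
  2\<close>. A union bound on \<open>1 - p\<close> handles the first term, the Lipschitz bound the
  second.\<close>

lemma wall_integrand_close:
  fixes a b :: real and g :: "'i \<Rightarrow> real"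
  assumes "finite F"
  shows "(cos a ^ (2 * m) + cos b ^ (2 * m)) / 2 - cos a ^ m * cos b ^ m * (\<Prod>x\<in>F. (cos (g x))\<^sup>2) \<le>
    (real m)\<^sup>2 * (1 - cos (a - b)) + (\<Sum>x\<in>F.
      (cos a ^ (2 * m) - cos a ^ (2 * Suc m)) + 2 * (1 - cos (g x - a)) +
      ((cos b ^ (2 * m) - cos b ^ (2 * Suc m)) + 2 * (1 - cos (g x - b))))"
proof -
  define p where "p = (\<Prod>x\<in>F. (cos (g x))\<^sup>2)"
  define u where "u = cos a ^ m"
  define v where "v = cos b ^ m"
  have uv: "cos a ^ (2 * m) = u\<^sup>2" "cos b ^ (2 * m) = v\<^sup>2"
    by (simp_all add: u_def v_def power_mult [symmetric] mult.commute)
  have p: "0 \<le> p" "p \<le> 1" using prod_cos2_unit_interval [of g F] by (simp_all add: p_def)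
  have "1 - p \<le> (\<Sum>x\<in>F. (sin (g x))\<^sup>2)"
    using Weierstrass_prod_ineq [of F "\<lambda>x. (sin (g x))\<^sup>2"]
    by (simp add: p_def cos_squared_eq abs_square_le_1)
  then have "(u\<^sup>2 + v\<^sup>2) / 2 * (1 - p) \<le> (u\<^sup>2 + v\<^sup>2) / 2 * (\<Sum>x\<in>F. (sin (g x))\<^sup>2)"
    by (intro mult_left_mono) simp_all
  also have "\<dots> = (\<Sum>x\<in>F. (u\<^sup>2 * (sin (g x))\<^sup>2 + v\<^sup>2 * (sin (g x))\<^sup>2) / 2)"
    unfolding sum_distrib_left by (intro sum.cong refl) (simp add: field_simps)
  also have "\<dots> \<le> (\<Sum>x\<in>F.
      (cos a ^ (2 * m) - cos a ^ (2 * Suc m)) + 2 * (1 - cos (g x - a)) +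
      ((cos b ^ (2 * m) - cos b ^ (2 * Suc m)) + 2 * (1 - cos (g x - b))))"
  proof (rule sum_mono)
    fix x
    have "(p + q) / 2 \<le> s + 2 * t + (s' + 2 * t')"
      if "p \<le> 2 * s + 4 * t" "q \<le> 2 * s' + 4 * t'" for p q s t s' t' :: real
      using that by (simp add: field_simps)
    from this [OF cos_power_mult_sin2_le [of a m "g x"] cos_power_mult_sin2_le [of b m "g x"]]
    show "(u\<^sup>2 * (sin (g x))\<^sup>2 + v\<^sup>2 * (sin (g x))\<^sup>2) / 2 \<le>
      (cos a ^ (2 * m) - cos a ^ (2 * Suc m)) + 2 * (1 - cos (g x - a)) +
      ((cos b ^ (2 * m) - cos b ^ (2 * Suc m)) + 2 * (1 - cos (g x - b)))"
      unfolding uv .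
  qed
  finally have 1: "(u\<^sup>2 + v\<^sup>2) / 2 * (1 - p) \<le> (\<Sum>x\<in>F.
      (cos a ^ (2 * m) - cos a ^ (2 * Suc m)) + 2 * (1 - cos (g x - a)) +
      ((cos b ^ (2 * m) - cos b ^ (2 * Suc m)) + 2 * (1 - cos (g x - b))))" .
  have "(u - v)\<^sup>2 * p \<le> (u - v)\<^sup>2"
    using p by (intro mult_left_le) simp_all
  also have "\<dots> \<le> 2 * (real m)\<^sup>2 * (1 - cos (a - b))"
    unfolding u_def v_def by (rule cos_power_diff_squared_le)
  finally have 2: "(u - v)\<^sup>2 * p / 2 \<le> (real m)\<^sup>2 * (1 - cos (a - b))" by simp
  have "(u\<^sup>2 + v\<^sup>2) / 2 - u * v * p = (u\<^sup>2 + v\<^sup>2) / 2 * (1 - p) + (u - v)\<^sup>2 * p / 2"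
    by (simp add: field_simps power2_eq_square)
  then show ?thesis
    using 1 2 unfolding uv [symmetric] unfolding p_def [symmetric] u_def [symmetric] v_def [symmetric]
    by linarith
qed

section \<open>Estimates for near and far supports\<close>

context gaussian_process
begin

lemma expectation_cos_power:
  assumes "i \<in> I" "K i i = 1"
  shows "expectation (\<lambda>\<omega>. cos (\<xi> i \<omega>) ^ n) = cos_moment n"
  using gaussian_process_expectation_cos_power [of M I K \<xi> i n] gaussian_process_axioms assms by blast

lemma integrable_cos_power_mult_cos [simp]:
  assumes [measurable]: "f \<in> borel_measurable M"
  shows "integrable M (\<lambda>\<omega>. cos (\<xi> y \<omega>) ^ n * cos (f \<omega>))"
  by (rule integrable_bounded) (auto simp: abs_mult power_abs intro!: mult_le_one power_le_one)

lemma integrable_cos_power [simp]: "integrable M (\<lambda>\<omega>. cos (\<xi> y \<omega>) ^ n)"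
  using integrable_cos_power_mult_cos [of "\<lambda>_. 0" y n] by simp

lemma integrable_cos [simp]:
  fixes f :: "'m \<Rightarrow> real"
  shows "f \<in> borel_measurable M \<Longrightarrow> integrable M (\<lambda>\<omega>. cos (f \<omega>))"
  using integrable_cos_power_mult_cos [of f undefined 0] by simp

lemma expectation_cos_power_Suc:
  assumes [measurable]: "f \<in> borel_measurable M"
  shows "expectation (\<lambda>\<omega>. cos (\<xi> y \<omega>) ^ Suc n * cos (f \<omega>)) =
    (expectation (\<lambda>\<omega>. cos (\<xi> y \<omega>) ^ n * cos (f \<omega> + \<xi> y \<omega>))
     + expectation (\<lambda>\<omega>. cos (\<xi> y \<omega>) ^ n * cos (f \<omega> - \<xi> y \<omega>))) / 2"
proof -
  have "(\<lambda>\<omega>. cos (\<xi> y \<omega>) ^ Suc n * cos (f \<omega>)) =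
      (\<lambda>\<omega>. (cos (\<xi> y \<omega>) ^ n * cos (f \<omega> + \<xi> y \<omega>) + cos (\<xi> y \<omega>) ^ n * cos (f \<omega> - \<xi> y \<omega>)) / 2)"
    by (simp add: fun_eq_iff cos_add cos_diff algebra_simps)
  then show ?thesis by simp
qed

text \<open>The constant \<open>exp (- 2)\<close> is \<open>E (cos (2 * \<xi> x))\<close>: the two factors decorrelate as \<open>r\<close> tends to 0.\<close>

lemma decorrelation:
  assumes xy: "x \<in> I" "y \<in> I" "x \<noteq> y" and K: "K x x = 1" "K y y = 1" "K x y = r" "K y x = r" "0 \<le> r"
  shows "0 \<le> expectation (\<lambda>\<omega>. cos (\<xi> y \<omega>) ^ n * cos (l * \<xi> y \<omega>)) \<and>
    expectation (\<lambda>\<omega>. cos (\<xi> y \<omega>) ^ n * cos (2 * \<xi> x \<omega> + l * \<xi> y \<omega>)) \<le>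
    exp (- 2 + 2 * (\<bar>l\<bar> + n) * r) * expectation (\<lambda>\<omega>. cos (\<xi> y \<omega>) ^ n * cos (l * \<xi> y \<omega>))"
proof (induction n arbitrary: l)
  case 0
  have 1: "expectation (\<lambda>\<omega>. cos (l * \<xi> y \<omega>)) = exp (- l\<^sup>2 / 2)"
    using expectation_cos [of "{y}" "\<lambda>_. l"] xy K by (simp add: power2_eq_square)
  have "expectation (\<lambda>\<omega>. cos (2 * \<xi> x \<omega> + l * \<xi> y \<omega>)) = exp (- (4 + l * l + 4 * l * r) / 2)"
    using expectation_cos [of "{x, y}" "\<lambda>z. if z = x then 2 else l"] xy K
    by (simp add: algebra_simps)
  also have "\<dots> \<le> exp (- 2 + 2 * \<bar>l\<bar> * r + - l\<^sup>2 / 2)"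
  proof -
    have "- (l * r) \<le> \<bar>l\<bar> * r"
      using mult_right_mono [of "- l" "\<bar>l\<bar>" r] K(5) by simp
    then show ?thesis by (simp add: power2_eq_square field_simps)
  qed
  also have "\<dots> = exp (- 2 + 2 * \<bar>l\<bar> * r) * exp (- l\<^sup>2 / 2)"
    by (rule exp_add)
  finally show ?case by (simp add: 1)
next
  case (Suc n)
  let ?R = "\<lambda>n l. expectation (\<lambda>\<omega>. cos (\<xi> y \<omega>) ^ n * cos (l * \<xi> y \<omega>))"
  let ?S = "\<lambda>n l. expectation (\<lambda>\<omega>. cos (\<xi> y \<omega>) ^ n * cos (2 * \<xi> x \<omega> + l * \<xi> y \<omega>))"
  let ?e = "exp (- 2 + 2 * (\<bar>l\<bar> + Suc n) * r)"
  have R: "?R (Suc n) l = (?R n (l + 1) + ?R n (l - 1)) / 2"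
    by (subst expectation_cos_power_Suc) (simp_all add: algebra_simps)
  have S: "?S (Suc n) l = (?S n (l + 1) + ?S n (l - 1)) / 2"
    by (subst expectation_cos_power_Suc) (simp_all add: algebra_simps)
  \<comment> \<open>The product-to-sum formula lowers \<open>n\<close> by 1 and changes
    \<open>\<bar>l\<bar>\<close> by at most 1, so \<open>\<bar>l\<bar> + n\<close> does not grow.
    Nonnegativity of \<open>?R\<close> allows the exponential factor to be enlarged.\<close>
  have *: "?S n (l + d) \<le> ?e * ?R n (l + d)" if "\<bar>d\<bar> = 1" for d
  proof -
    have "?S n (l + d) \<le> exp (- 2 + 2 * (\<bar>l + d\<bar> + n) * r) * ?R n (l + d)"
      using Suc.IH by blast
    also have "\<dots> \<le> ?e * ?R n (l + d)"
    proof (rule mult_right_mono)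
      show "0 \<le> ?R n (l + d)" using Suc.IH by blast
      have "(\<bar>l + d\<bar> + n) * r \<le> (\<bar>l\<bar> + Suc n) * r"
        using that K(5) by (intro mult_right_mono) auto
      then have "- 2 + 2 * ((\<bar>l + d\<bar> + n) * r) \<le> - 2 + 2 * ((\<bar>l\<bar> + Suc n) * r)" by linarith
      then show "exp (- 2 + 2 * (\<bar>l + d\<bar> + n) * r) \<le> ?e" unfolding exp_le_cancel_iff mult.assoc .
    qed
    finally show ?thesis .
  qed
  have "?S (Suc n) l \<le> ?e * ?R (Suc n) l"
    unfolding R S using * [of 1] * [of "- 1"] by (simp add: distrib_left)
  moreover have "0 \<le> ?R (Suc n) l"
    unfolding R using Suc.IH [of "l + 1"] Suc.IH [of "l - 1"] by simp
  ultimately show ?case by blast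
qed

text \<open>The squared cosine is \<open>(1 + cos (2 * \<xi> x \<omega>)) / 2\<close>. Under
  \<open>small\<close>, decorrelation bounds the contribution of the cosine by
  \<open>exp (- 1) \<le> 1 / 2\<close> times the moment, and
  \<open>(1 + 1 / 2) / 2 = 3 / 4\<close>.\<close>

lemma expectation_cos_power_mult_cos2:
  assumes xy: "x \<in> I" "y \<in> I" and K: "K x x = 1" "K y y = 1" "K x y = r" "K y x = r" "0 \<le> r"
    and small: "4 * real (Suc m) * r \<le> 1"
  shows "expectation (\<lambda>\<omega>. cos (\<xi> y \<omega>) ^ (2 * m) * (cos (\<xi> x \<omega>))\<^sup>2) \<le> 3 / 4 * cos_moment (2 * m)"
proof -
  \<comment> \<open>For \<open>x = y\<close> the covariance would be 1, against
    \<open>small\<close>; the \<open>Suc\<close> there makes this work for \<open>m = 0\<close> as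
    well.\<close>
  have "x \<noteq> y" using K small by auto
  have c: "expectation (\<lambda>\<omega>. cos (\<xi> y \<omega>) ^ n) = cos_moment n" for n
    by (rule expectation_cos_power [OF xy(2) K(2)])
  have "(\<lambda>\<omega>. cos (\<xi> y \<omega>) ^ (2 * m) * (cos (\<xi> x \<omega>))\<^sup>2) =
      (\<lambda>\<omega>. (cos (\<xi> y \<omega>) ^ (2 * m) + cos (\<xi> y \<omega>) ^ (2 * m) * cos (2 * \<xi> x \<omega>)) / 2)"
    by (simp add: fun_eq_iff cos_double_cos field_simps)
  then have "expectation (\<lambda>\<omega>. cos (\<xi> y \<omega>) ^ (2 * m) * (cos (\<xi> x \<omega>))\<^sup>2) =
      (cos_moment (2 * m) + expectation (\<lambda>\<omega>. cos (\<xi> y \<omega>) ^ (2 * m) * cos (2 * \<xi> x \<omega>))) / 2"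
    by (simp add: c)
  moreover have "expectation (\<lambda>\<omega>. cos (\<xi> y \<omega>) ^ (2 * m) * cos (2 * \<xi> x \<omega>)) \<le>
      exp (- 2 + 4 * m * r) * cos_moment (2 * m)"
    using decorrelation [OF xy \<open>x \<noteq> y\<close> K, of "2 * m" 0] by (simp add: c)
  moreover have "exp (- 2 + 4 * m * r) \<le> 1 / 2"
  proof -
    have "4 * m * r \<le> 1" using small K(5) by (simp add: algebra_simps)
    then have "exp (- 2 + 4 * m * r) \<le> exp (- 1)" by simp
    also have "\<dots> \<le> 1 / 2"
      using exp_ge_add_one_self [of 1] by (simp add: exp_minus field_simps)
    finally show ?thesis .
  qed
  then have "exp (- 2 + 4 * m * r) * cos_moment (2 * m) \<le> 1 / 2 * cos_moment (2 * m)"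
    using cos_moment_pos [of m] by (intro mult_right_mono) auto
  ultimately show ?thesis by simp
qed

text \<open>With \<open>u\<close>, \<open>v\<close> the powers at \<open>y\<close>,
  \<open>y'\<close> and \<open>p\<close> the product, the integrand is at most
  \<open>(u\<^sup>2 * p + v\<^sup>2 * p) / 2\<close>. Keeping only the factor at \<open>x\<close> in
  the first term and none in the second gives \<open>(3 / 4 + 1) / 2 = 7 / 8\<close>.\<close>

lemma wall_kernel_far:
  assumes F: "finite F" "F \<subseteq> I" "x \<in> F" and y: "y \<in> I" "y' \<in> I"
    and K: "\<And>x. x \<in> I \<Longrightarrow> K x x = 1" "K x y = K y x" "0 \<le> K x y" "4 * real (Suc m) * K x y \<le> 1"
  shows "wall_kernel M \<xi> m y y' F \<le> 7 / 8"
proof -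
  have x: "x \<in> I" using F by blast
  have c: "expectation (\<lambda>\<omega>. cos (\<xi> y' \<omega>) ^ n) = cos_moment n" for n
    by (rule expectation_cos_power [OF y(2) K(1) [OF y(2)]])
  have int: "integrable M (\<lambda>\<omega>. cos (\<xi> y \<omega>) ^ (2 * m) * (cos (\<xi> x \<omega>))\<^sup>2)"
  proof (rule integrable_bounded)
    have "cos (\<xi> y \<omega>) ^ (2 * m) \<le> 1" for \<omega>
      by (simp add: power_mult power_le_one abs_square_le_1)
    then show "\<bar>cos (\<xi> y \<omega>) ^ (2 * m) * (cos (\<xi> x \<omega>))\<^sup>2\<bar> \<le> 1" for \<omega>
      by (simp add: abs_mult mult_le_one abs_square_le_1)
  qed measurable
  have "expectation (\<lambda>\<omega>. cos (\<xi> y \<omega>) ^ m * cos (\<xi> y' \<omega>) ^ m * (\<Prod>x\<in>F. (cos (\<xi> x \<omega>))\<^sup>2)) \<le>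
      expectation (\<lambda>\<omega>. (cos (\<xi> y \<omega>) ^ (2 * m) * (cos (\<xi> x \<omega>))\<^sup>2 + cos (\<xi> y' \<omega>) ^ (2 * m)) / 2)"
  proof (intro integral_mono integrable_wall)
    show "integrable M (\<lambda>\<omega>. (cos (\<xi> y \<omega>) ^ (2 * m) * (cos (\<xi> x \<omega>))\<^sup>2 + cos (\<xi> y' \<omega>) ^ (2 * m)) / 2)"
      using int by simp
    fix \<omega>
    define p where "p = (\<Prod>x\<in>F. (cos (\<xi> x \<omega>))\<^sup>2)"
    define q where "q = (\<Prod>x\<in>F - {x}. (cos (\<xi> x \<omega>))\<^sup>2)"
    define u where "u = cos (\<xi> y \<omega>) ^ m"
    define v where "v = cos (\<xi> y' \<omega>) ^ m"
    have q: "0 \<le> q" "q \<le> 1"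
      using prod_cos2_unit_interval [of "\<lambda>x. \<xi> x \<omega>" "F - {x}"] by (simp_all add: q_def)
    have p: "0 \<le> p" "p \<le> 1"
      using prod_cos2_unit_interval [of "\<lambda>x. \<xi> x \<omega>" F] by (simp_all add: p_def)
    have "p = (cos (\<xi> x \<omega>))\<^sup>2 * q"
      unfolding p_def q_def using F by (intro prod.remove) auto
    then have p': "p \<le> (cos (\<xi> x \<omega>))\<^sup>2"
      using q by (simp add: mult_left_le)
    have "0 \<le> (u - v)\<^sup>2 * p" using p by simp
    then have "u * v * p \<le> (u\<^sup>2 * p + v\<^sup>2 * p) / 2"
      by (simp add: power2_diff algebra_simps)
    also have "\<dots> \<le> (u\<^sup>2 * (cos (\<xi> x \<omega>))\<^sup>2 + v\<^sup>2) / 2"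
      using mult_left_mono [OF p', of "u\<^sup>2"] mult_left_le [of p "v\<^sup>2"] p by simp
    finally show "cos (\<xi> y \<omega>) ^ m * cos (\<xi> y' \<omega>) ^ m * (\<Prod>x\<in>F. (cos (\<xi> x \<omega>))\<^sup>2) \<le>
        (cos (\<xi> y \<omega>) ^ (2 * m) * (cos (\<xi> x \<omega>))\<^sup>2 + cos (\<xi> y' \<omega>) ^ (2 * m)) / 2"
      by (simp add: u_def v_def p_def power_even_eq)
  qed
  also have "\<dots> = (expectation (\<lambda>\<omega>. cos (\<xi> y \<omega>) ^ (2 * m) * (cos (\<xi> x \<omega>))\<^sup>2) + cos_moment (2 * m)) / 2"
    using int by (simp add: c)
  also have "\<dots> \<le> (3 / 4 * cos_moment (2 * m) + cos_moment (2 * m)) / 2"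
    using expectation_cos_power_mult_cos2 [OF x y(1) K(1) [OF x] K(1) [OF y(1)] refl K(2) [symmetric] K(3,4)]
    by simp
  finally show ?thesis
    using cos_moment_pos [of m] by (simp add: wall_kernel_def field_simps)
qed

text \<open>The difference has variance \<open>2 - 2 * K x y\<close>, so for distinct points the
  expectation is \<open>1 - exp (- (1 - K x y))\<close>.\<close>

lemma expectation_one_minus_cos_diff_le:
  assumes xy: "x \<in> I" "y \<in> I" and K: "K x x = 1" "K y y = 1" "K x y = K y x"
  shows "expectation (\<lambda>\<omega>. 1 - cos (\<xi> x \<omega> - \<xi> y \<omega>)) \<le> 1 - K x y"
proof (cases "x = y")
  case False
  then have "expectation (\<lambda>\<omega>. cos (\<xi> x \<omega> - \<xi> y \<omega>)) = exp (- (1 - K x y))"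
    using expectation_cos [of "{x, y}" "\<lambda>z. if z = x then 1 else - 1"] xy K by (simp add: field_simps)
  then have "expectation (\<lambda>\<omega>. 1 - cos (\<xi> x \<omega> - \<xi> y \<omega>)) = 1 - exp (- (1 - K x y))"
    by (simp add: prob_space)
  then show ?thesis using exp_ge_add_one_self [of "- (1 - K x y)"] by simp
qed (use K in simp)

text \<open>The pointwise estimate is integrated: even powers become moments, and each
  \<open>1 - cos\<close> is controlled by the defect \<open>1 - K\<close> of the covariance.\<close>

lemma wall_kernel_close:
  assumes F: "finite F" "F \<subseteq> I" and y: "y \<in> I" "y' \<in> I"
    and K: "\<And>x. x \<in> I \<Longrightarrow> K x x = 1" "\<And>x y. x \<in> I \<Longrightarrow> y \<in> I \<Longrightarrow> K x y = K y x"
  shows "cos_moment (2 * m) * (1 - wall_kernel M \<xi> m y y' F) \<le> (real m)\<^sup>2 * (1 - K y y') +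
    (\<Sum>x\<in>F. 2 * (cos_moment (2 * m) - cos_moment (2 * Suc m)) + 2 * (1 - K x y) + 2 * (1 - K x y'))"
proof -
  have c: "expectation (\<lambda>\<omega>. cos (\<xi> z \<omega>) ^ n) = cos_moment n" if "z \<in> I" for n z
    by (rule expectation_cos_power [OF that K(1) [OF that]])
  let ?d = "\<lambda>x y \<omega>. 1 - cos (\<xi> x \<omega> - \<xi> y \<omega>)"
  let ?e = "\<lambda>y \<omega>. cos (\<xi> y \<omega>) ^ (2 * m) - cos (\<xi> y \<omega>) ^ (2 * Suc m)"
  let ?w = "\<lambda>\<omega>. cos (\<xi> y \<omega>) ^ m * cos (\<xi> y' \<omega>) ^ m * (\<Prod>x\<in>F. (cos (\<xi> x \<omega>))\<^sup>2)"
  have int_d: "integrable M (?d x z)" for x z by simp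
  have int_e: "integrable M (?e z)" for z by (intro Bochner_Integration.integrable_diff integrable_cos_power)
  have E_e: "expectation (?e z) = cos_moment (2 * m) - cos_moment (2 * Suc m)" if "z \<in> I" for z
    using c [OF that] by (subst Bochner_Integration.integral_diff) (auto intro: integrable_cos_power simp del: power_Suc mult_Suc_right)
  have "cos_moment (2 * m) * (1 - wall_kernel M \<xi> m y y' F) = cos_moment (2 * m) - expectation ?w"
    using cos_moment_pos [of m] by (simp add: wall_kernel_def field_simps)
  also have "\<dots> = expectation (\<lambda>\<omega>. (cos (\<xi> y \<omega>) ^ (2 * m) + cos (\<xi> y' \<omega>) ^ (2 * m)) / 2 - ?w \<omega>)"
    using integrable_wall [of y m y' F] by (simp add: c y)
  also have "\<dots> \<le> expectation (\<lambda>\<omega>. (real m)\<^sup>2 * ?d y y' \<omega> +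
      (\<Sum>x\<in>F. ?e y \<omega> + 2 * ?d x y \<omega> + (?e y' \<omega> + 2 * ?d x y' \<omega>)))"
  proof (rule integral_mono)
    show "integrable M (\<lambda>\<omega>. (cos (\<xi> y \<omega>) ^ (2 * m) + cos (\<xi> y' \<omega>) ^ (2 * m)) / 2 - ?w \<omega>)"
      using integrable_wall [of y m y' F] by simp
    show "integrable M (\<lambda>\<omega>. (real m)\<^sup>2 * ?d y y' \<omega> +
        (\<Sum>x\<in>F. ?e y \<omega> + 2 * ?d x y \<omega> + (?e y' \<omega> + 2 * ?d x y' \<omega>)))"
      by (intro Bochner_Integration.integrable_add Bochner_Integration.integrable_sum
          integrable_mult_right int_d int_e)
  qed (rule wall_integrand_close [OF F(1)])
  also have "\<dots> = (real m)\<^sup>2 * expectation (?d y y') + (\<Sum>x\<in>F.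
      expectation (?e y) + 2 * expectation (?d x y) + (expectation (?e y') + 2 * expectation (?d x y')))"
    by (simp only: Bochner_Integration.integral_add Bochner_Integration.integral_sum integral_mult_right_zero
        Bochner_Integration.integrable_add Bochner_Integration.integrable_sum integrable_mult_right int_d int_e)
  also have "\<dots> \<le> (real m)\<^sup>2 * (1 - K y y') +
    (\<Sum>x\<in>F. 2 * (cos_moment (2 * m) - cos_moment (2 * Suc m)) + 2 * (1 - K x y) + 2 * (1 - K x y'))"
  proof (rule add_mono [OF mult_left_mono sum_mono])
    have d: "expectation (?d x z) \<le> 1 - K x z" if "x \<in> I" "z \<in> I" for x z
      using that K by (intro expectation_one_minus_cos_diff_le) auto
    show "expectation (?d y y') \<le> 1 - K y y'" using y by (rule d)
    show "expectation (?e y) + 2 * expectation (?d x y) + (expectation (?e y') + 2 * expectation (?d x y')) \<le>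
        2 * (cos_moment (2 * m) - cos_moment (2 * Suc m)) + 2 * (1 - K x y) + 2 * (1 - K x y')"
      if "x \<in> F" for x
    proof -
      have x: "x \<in> I" using F that by blast
      have "c + 2 * p + (c + 2 * q) \<le> 2 * c + 2 * s + 2 * t" if "p \<le> s" "q \<le> t" for c p q s t :: real
        using that by linarith
      from this [OF d [OF x y(1)] d [OF x y(2)]] show ?thesis
        unfolding E_e [OF y(1)] E_e [OF y(2)] .
    qed
  qed simp
  finally show ?thesis .
qed

lemma wall_kernel_diag:
  assumes "y \<in> I" "K y y = 1"
  shows "wall_kernel M \<xi> m y y {} = 1"
proof -
  have "expectation (\<lambda>\<omega>. cos (\<xi> y \<omega>) ^ (2 * m)) = cos_moment (2 * m)"
    by (rule expectation_cos_power [OF assms])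
  then show ?thesis
    using cos_moment_pos [of m] by (simp add: wall_kernel_def power_add [symmetric] mult_2)
qed

lemma wall_kernel_le_1:
  assumes y: "y \<in> I" "y' \<in> I" and K: "\<And>x. x \<in> I \<Longrightarrow> K x x = 1"
  shows "wall_kernel M \<xi> m y y' F \<le> 1"
proof -
  have c: "expectation (\<lambda>\<omega>. cos (\<xi> z \<omega>) ^ n) = cos_moment n" if "z \<in> I" for n z
    by (rule expectation_cos_power [OF that K [OF that]])
  have "expectation (\<lambda>\<omega>. cos (\<xi> y \<omega>) ^ m * cos (\<xi> y' \<omega>) ^ m * (\<Prod>x\<in>F. (cos (\<xi> x \<omega>))\<^sup>2)) \<le>
      expectation (\<lambda>\<omega>. (cos (\<xi> y \<omega>) ^ (2 * m) + cos (\<xi> y' \<omega>) ^ (2 * m)) / 2)"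
  proof (intro integral_mono integrable_wall)
    fix \<omega>
    define p where "p = (\<Prod>x\<in>F. (cos (\<xi> x \<omega>))\<^sup>2)"
    define u where "u = cos (\<xi> y \<omega>) ^ m"
    define v where "v = cos (\<xi> y' \<omega>) ^ m"
    have p: "0 \<le> p" "p \<le> 1"
      using prod_cos2_unit_interval [of "\<lambda>x. \<xi> x \<omega>" F] by (simp_all add: p_def)
    have "0 \<le> (u - v)\<^sup>2 * p" using p by simp
    then have "u * v * p \<le> (u\<^sup>2 * p + v\<^sup>2 * p) / 2"
      by (simp add: power2_diff algebra_simps)
    also have "\<dots> \<le> (u\<^sup>2 + v\<^sup>2) / 2"
      using mult_left_le [of p "u\<^sup>2"] mult_left_le [of p "v\<^sup>2"] p by simp
    finally show "cos (\<xi> y \<omega>) ^ m * cos (\<xi> y' \<omega>) ^ m * (\<Prod>x\<in>F. (cos (\<xi> x \<omega>))\<^sup>2) \<le>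
        (cos (\<xi> y \<omega>) ^ (2 * m) + cos (\<xi> y' \<omega>) ^ (2 * m)) / 2"
      by (simp add: u_def v_def p_def power_even_eq)
  qed simp
  then show ?thesis
    using cos_moment_pos [of m] by (simp add: wall_kernel_def c y)
qed

end

section \<open>Summation over scales\<close>

definition wall_data :: "'i set \<Rightarrow> ('i \<times> 'i \<times> 'i set) set"
  where "wall_data X = {(y, y', F). y \<in> X \<and> y' \<in> X \<and> finite F \<and> F \<subseteq> X}"

lemma countable_wall_data:
  assumes "countable X"
  shows "countable (wall_data X)"
proof -
  have "wall_data X = X \<times> X \<times> {F. F \<subseteq> X \<and> finite F}"
    by (auto simp: wall_data_def)
  moreover have "countable {F. F \<subseteq> X \<and> finite F}"
    using countable_Collect_finite_subset [OF assms] by (simp add: conj_commute)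
  ultimately show ?thesis using assms by simp
qed

text \<open>Two errors are made small in turn. First \<open>m\<close> is chosen so that the base
  point is concentrated, with a tolerance scaled by the sizes of the sets in \<open>E\<close>; then
  \<open>t\<close> is chosen, depending on \<open>m\<close>, to bring the covariances close to
  1.\<close>

lemma wall_kernel_one_scale:
  assumes \<psi>: "neg_type X \<psi>" and X: "countable X"
    and E: "finite E" "E \<subseteq> wall_data X" and "0 < \<epsilon>"
  shows "\<exists>m t \<xi>. 0 < t \<and> gaussian_process gaussian_space X (\<lambda>x y. exp (- t * \<psi> x y)) \<xi> \<and>
    (\<forall>(y, y', F)\<in>E. 1 - wall_kernel gaussian_space \<xi> m y y' F \<le> \<epsilon>)"
proof -
  define N where "N = 1 + (\<Sum>(y, y', F)\<in>E. real (card F))"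
  have N: "0 < N" unfolding N_def by (intro add_pos_nonneg sum_nonneg) auto
  obtain m where m: "cos_moment (2 * m) - cos_moment (2 * Suc m) \<le> \<epsilon> / (4 * N) * cos_moment (2 * m)"
    using cos_moment_ratio [of "\<epsilon> / (4 * N)"] N \<open>0 < \<epsilon>\<close> by auto
  define c where "c = cos_moment (2 * m)"
  have c: "0 < c" unfolding c_def by (rule cos_moment_pos)
  define b where "b = (\<lambda>(y, y', F). (real m)\<^sup>2 * \<psi> y y' + (\<Sum>x\<in>F. 2 * \<psi> x y + 2 * \<psi> x y'))"
  have b: "0 \<le> b e" if "e \<in> E" for e
  proof -
    obtain y y' F where e: "e = (y, y', F)" by (cases e)
    then have "y \<in> X" "y' \<in> X" "F \<subseteq> X"
      using that E(2) by (auto simp: wall_data_def)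
    then show ?thesis
      using neg_type_nonneg [OF \<psi>]
      by (auto simp: b_def e subset_iff intro!: add_nonneg_nonneg sum_nonneg)
  qed
  define B where "B = sum b E"
  have B: "0 \<le> B" unfolding B_def using b by (rule sum_nonneg)
  \<comment> \<open>Makes \<open>t * B\<close> at most half of the permitted error
    \<open>\<epsilon> * c\<close>, the other half being spent by the choice of \<open>m\<close>; the
    summand 1 avoids division by zero.\<close>
  define t where "t = \<epsilon> * c / (2 * (B + 1))"
  have t: "0 < t" "t * B \<le> \<epsilon> * c / 2"
    using B c \<open>0 < \<epsilon>\<close> by (auto simp: t_def field_simps)
  let ?K = "\<lambda>x y. exp (- t * \<psi> x y)"
  have "psd_kernel X ?K"
    using t(1) by (intro psd_kernel_exp_neg_type \<psi> X) simp
  then obtain \<xi> where \<xi>: "gaussian_process gaussian_space X ?K \<xi>"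
    using gaussian_process_exists X by blast
  interpret gaussian_process gaussian_space X ?K \<xi> by fact
  have K: "?K x x = 1" "?K x y = ?K y x" if "x \<in> X" "y \<in> X" for x y
    using neg_type_diag [OF \<psi>] neg_type_sym [OF \<psi>] that by simp_all
  have exp_le: "1 - ?K x y \<le> t * \<psi> x y" for x y
    using exp_ge_add_one_self [of "- t * \<psi> x y"] by simp
  have "1 - wall_kernel gaussian_space \<xi> m y y' F \<le> \<epsilon>" if e: "(y, y', F) \<in> E" for y y' F
  proof -
    have F: "finite F" "F \<subseteq> X" "y \<in> X" "y' \<in> X"
      using e E(2) by (auto simp: wall_data_def)
    have "card F \<le> N"
      using member_le_sum [of "(y, y', F)" E "\<lambda>(y, y', F). real (card F)"] e E(1)
      by (auto simp: N_def)
    then have card: "real (card F) * (2 * (c - cos_moment (2 * Suc m))) \<le> \<epsilon> * c / 2"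
    proof -
      have "real (card F) * (2 * (c - cos_moment (2 * Suc m))) \<le> real (card F) * (2 * (\<epsilon> / (4 * N) * c))"
        using m by (intro mult_left_mono) (simp_all add: c_def)
      also have "\<dots> \<le> N * (2 * (\<epsilon> / (4 * N) * c))"
        using \<open>card F \<le> N\<close> N c \<open>0 < \<epsilon>\<close> by (intro mult_right_mono) simp_all
      also have "\<dots> = \<epsilon> * c / 2" using N by simp
      finally show ?thesis .
    qed
    have "c * (1 - wall_kernel gaussian_space \<xi> m y y' F) \<le> (real m)\<^sup>2 * (1 - ?K y y') +
        (\<Sum>x\<in>F. 2 * (c - cos_moment (2 * Suc m)) + 2 * (1 - ?K x y) + 2 * (1 - ?K x y'))"
      unfolding c_def by (rule wall_kernel_close) (use F K in auto)
    also have "\<dots> \<le> (real m)\<^sup>2 * (t * \<psi> y y') +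
        (\<Sum>x\<in>F. 2 * (c - cos_moment (2 * Suc m)) + 2 * (t * \<psi> x y) + 2 * (t * \<psi> x y'))"
      by (intro add_mono mult_left_mono sum_mono exp_le order_refl) simp_all
    also have "\<dots> = real (card F) * (2 * (c - cos_moment (2 * Suc m))) + t * b (y, y', F)"
      by (simp add: b_def sum.distrib distrib_left sum_distrib_left mult.left_commute)
    also have "\<dots> \<le> \<epsilon> * c / 2 + t * B"
      using e E(1) b t(1) unfolding B_def by (intro add_mono card mult_left_mono member_le_sum) auto
    also have "\<dots> \<le> c * \<epsilon>" using t(2) by (simp add: mult.commute)
    finally show ?thesis using c by simp
  qed
  then show ?thesis using t(1) \<xi> by blast
qed

text \<open>The finite sets \<open>E k\<close> exhaust \<open>wall_data X\<close>, and on
  \<open>E k\<close> the term \<open>1 - u k\<close> is at most \<open>(1 / 2) ^ k\<close>, so the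
  series converges everywhere. A point of \<open>F\<close> far enough from \<open>y\<close> makes
  each of the first \<open>n\<close> terms at least 1/8. Invariance holds termwise.\<close>

lemma wall_kernel_series:
  fixes w :: "'p \<Rightarrow> 'i \<Rightarrow> 'b"
  assumes \<psi>: "neg_type X \<psi>" and X: "countable X"
    and \<pi>: "\<And>p. p \<in> P \<Longrightarrow> \<pi> p \<in> X"
    and fin: "\<And>p p'. p \<in> P \<Longrightarrow> p' \<in> P \<Longrightarrow> finite {x \<in> X. w p x \<noteq> w p' x}"
  obtains \<Delta> where "neg_type P (\<lambda>p p'. \<Delta> (\<pi> p) (\<pi> p') {x \<in> X. w p x \<noteq> w p' x})"
    and "\<And>s y y' F. inj_on s X \<Longrightarrow> s ` X \<subseteq> X \<Longrightarrow>
      (\<And>x x'. x \<in> X \<Longrightarrow> x' \<in> X \<Longrightarrow> \<psi> (s x) (s x') = \<psi> x x') \<Longrightarrow> (y, y', F) \<in> wall_data X \<Longrightarrow>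
      \<Delta> (s y) (s y') (s ` F) = \<Delta> y y' F"
    and "\<And>R. \<exists>r. \<forall>(y, y', F)\<in>wall_data X. \<Delta> y y' F \<le> R \<longrightarrow> (\<forall>x\<in>F. \<psi> x y \<le> r)"
proof -
  \<comment> \<open>The intersection matters if \<open>wall_data X\<close> is empty, where
    \<open>from_nat_into\<close> returns an arbitrary value.\<close>
  define E where "E k = wall_data X \<inter> from_nat_into (wall_data X) ` {..k}" for k
  have E: "finite (E k)" "E k \<subseteq> wall_data X" for k by (auto simp: E_def)
  have "\<forall>k. \<exists>m t \<xi>. 0 < t \<and> gaussian_process gaussian_space X (\<lambda>x y. exp (- t * \<psi> x y)) \<xi> \<and>
      (\<forall>(y, y', F)\<in>E k. 1 - wall_kernel gaussian_space \<xi> m y y' F \<le> (1 / 2) ^ k)"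
    using wall_kernel_one_scale [OF \<psi> X E] by simp
  then obtain m t \<xi> where t: "\<And>k. 0 < t k"
    and \<xi>: "\<And>k. gaussian_process gaussian_space X (\<lambda>x y. exp (- t k * \<psi> x y)) (\<xi> k)"
    and close: "\<And>k. \<forall>(y, y', F)\<in>E k. 1 - wall_kernel gaussian_space (\<xi> k) (m k) y y' F \<le> (1 / 2) ^ k"
    by metis
  define u where "u k = wall_kernel gaussian_space (\<xi> k) (m k)" for k :: nat
  have K: "exp (- t k * \<psi> x x) = 1" if "x \<in> X" for k x
    using neg_type_diag [OF \<psi> that] by simp
  have nonneg: "0 \<le> 1 - u k y y' F" if "(y, y', F) \<in> wall_data X" for k y y' F
    using gaussian_process.wall_kernel_le_1 [OF \<xi>, of y y' k "m k" F] K that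
    by (simp add: u_def wall_data_def)
  have summ: "summable (\<lambda>k. 1 - u k y y' F)" if z: "(y, y', F) \<in> wall_data X" for y y' F
  proof (rule summable_comparison_test)
    have "norm (1 - u k y y' F) \<le> (1 / 2) ^ k" if "to_nat_on (wall_data X) (y, y', F) \<le> k" for k
    proof -
      have "(y, y', F) \<in> E k"
        unfolding E_def using z that countable_wall_data [OF X]
        by (auto intro!: image_eqI [of _ _ "to_nat_on (wall_data X) (y, y', F)"])
      then show ?thesis using close [of k] nonneg [OF z, of k] by (auto simp: u_def)
    qed
    then show "\<exists>N. \<forall>k\<ge>N. norm (1 - u k y y' F) \<le> (1 / 2) ^ k" by blast
  qed (simp add: summable_geometric)
  define \<Delta> where "\<Delta> y y' F = (\<Sum>k. 1 - u k y y' F)" for y y' F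
  show ?thesis
  proof (rule that)
    show "neg_type P (\<lambda>p p'. \<Delta> (\<pi> p) (\<pi> p') {x \<in> X. w p x \<noteq> w p' x})"
      unfolding \<Delta>_def
    proof (rule neg_type_suminf)
      show "neg_type P (\<lambda>p p'. 1 - u k (\<pi> p) (\<pi> p') {x \<in> X. w p x \<noteq> w p' x})" for k
        unfolding u_def
      proof (rule neg_type_one_minus)
        show "psd_kernel P (\<lambda>p p'. wall_kernel gaussian_space (\<xi> k) (m k) (\<pi> p) (\<pi> p') {x \<in> X. w p x \<noteq> w p' x})"
          by (rule gaussian_process.psd_wall_kernel [OF \<xi> fin])
        show "wall_kernel gaussian_space (\<xi> k) (m k) (\<pi> p) (\<pi> p) {x \<in> X. w p x \<noteq> w p x} = 1" if "p \<in> P" for p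
          using gaussian_process.wall_kernel_diag [OF \<xi> \<pi> K] that \<pi> by simp
      qed
      show "summable (\<lambda>k. 1 - u k (\<pi> p) (\<pi> p') {x \<in> X. w p x \<noteq> w p' x})" if "p \<in> P" "p' \<in> P" for p p'
        using \<pi> fin that by (intro summ) (auto simp: wall_data_def)
    qed
    show "\<Delta> (s y) (s y') (s ` F) = \<Delta> y y' F"
      if "inj_on s X" "s ` X \<subseteq> X" "\<And>x x'. x \<in> X \<Longrightarrow> x' \<in> X \<Longrightarrow> \<psi> (s x) (s x') = \<psi> x x'"
        "(y, y', F) \<in> wall_data X" for s y y' F
    proof -
      have "u k (s y) (s y') (s ` F) = u k y y' F" for k
        unfolding u_def
        by (rule wall_kernel_invariant [OF \<xi> that(1,2)]) (use that(3,4) in \<open>auto simp: wall_data_def\<close>)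
      then show ?thesis by (simp add: \<Delta>_def)
    qed
    show "\<exists>r. \<forall>(y, y', F)\<in>wall_data X. \<Delta> y y' F \<le> R \<longrightarrow> (\<forall>x\<in>F. \<psi> x y \<le> r)" for R
    proof -
      \<comment> \<open>Then \<open>n\<close> terms of size 1/8 exceed \<open>R\<close>.\<close>
      obtain n :: nat where n: "8 * R < real n" using reals_Archimedean2 by blast
      \<comment> \<open>Beyond \<open>r k\<close> the covariance
        \<open>exp (- t k * \<psi> x y)\<close> is below \<open>1 / (4 * Suc (m k))\<close>, as the
        estimate for far points demands.\<close>
      define r where "r k = ln (4 * real (Suc (m k))) / t k" for k
      have far: "1 / 8 \<le> 1 - u k y y' F"
        if "(y, y', F) \<in> wall_data X" "x \<in> F" "r k < \<psi> x y" for k x y y' F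
      proof -
        have X': "x \<in> X" "y \<in> X" "y' \<in> X" "finite F" "F \<subseteq> X"
          using that by (auto simp: wall_data_def)
        have "ln (4 * real (Suc (m k))) \<le> t k * \<psi> x y"
          using that(3) t [of k] by (simp add: r_def field_simps)
        then have "exp (ln (4 * real (Suc (m k)))) \<le> exp (t k * \<psi> x y)"
          by (simp only: exp_le_cancel_iff)
        moreover have "exp (ln (4 * real (Suc (m k)))) = 4 * real (Suc (m k))"
          by (rule exp_ln) simp
        ultimately have "4 * real (Suc (m k)) \<le> exp (t k * \<psi> x y)"
          by linarith
        then have "4 * real (Suc (m k)) * exp (- t k * \<psi> x y) \<le> 1"
          by (simp add: exp_minus field_simps)
        then have "u k y y' F \<le> 7 / 8"
          unfolding u_def using neg_type_sym [OF \<psi> X'(1,2)] K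
          by (intro gaussian_process.wall_kernel_far [OF \<xi> X'(4,5) that(2) X'(2,3)]) auto
        then show ?thesis by simp
      qed
      have "\<psi> x y \<le> (\<Sum>k<n. \<bar>r k\<bar>)" if z: "(y, y', F) \<in> wall_data X" and "\<Delta> y y' F \<le> R" "x \<in> F" for x y y' F
      proof (rule ccontr)
        assume "\<not> ?thesis"
        moreover have "r k \<le> (\<Sum>k<n. \<bar>r k\<bar>)" if "k < n" for k
          using member_le_sum [of k "{..<n}" "\<lambda>k. \<bar>r k\<bar>"] that by simp
        ultimately have "1 / 8 \<le> 1 - u k y y' F" if "k < n" for k
          using far [OF z \<open>x \<in> F\<close>, of k] that by force
        then have "(\<Sum>k<n. 1 / 8) \<le> (\<Sum>k<n. 1 - u k y y' F)"
          by (intro sum_mono) simp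
        also have "\<dots> \<le> \<Delta> y y' F"
          unfolding \<Delta>_def by (intro sum_le_suminf summ z nonneg) simp_all
        finally show False using n \<open>\<Delta> y y' F \<le> R\<close> by simp
      qed
      then show ?thesis by blast
    qed
  qed
qed

section \<open>The wreath product\<close>

text \<open>Among finitely many points all difference sets lie in one finite set \<open>Y\<close>,
  and a coordinate where two points agree contributes 0, so on these points the kernel is a fixed
  finite sum of squared distances.\<close>

lemma neg_type_finite_support:
  fixes v :: "'b \<Rightarrow> 'v::real_inner" and w :: "'p \<Rightarrow> 'x \<Rightarrow> 'b"
  assumes fin: "\<And>p p'. p \<in> P \<Longrightarrow> p' \<in> P \<Longrightarrow> finite {x \<in> X. w p x \<noteq> w p' x}"
  shows "neg_type P (\<lambda>p p'. \<Sum>x\<in>{x \<in> X. w p x \<noteq> w p' x}. (dist (v (w p x)) (v (w p' x)))\<^sup>2)"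
    (is "neg_type P ?D")
proof -
  have "(\<Sum>p\<in>F. \<Sum>p'\<in>F. c p * c p' * ?D p p') \<le> 0" if F: "finite F" "F \<subseteq> P" "sum c F = 0" for F c
  proof -
    define Y where "Y = (\<Union>p\<in>F. \<Union>p'\<in>F. {x \<in> X. w p x \<noteq> w p' x})"
    have Y: "finite Y" unfolding Y_def using F fin by blast
    have eq: "?D p p' = (\<Sum>x\<in>Y. (dist (v (w p x)) (v (w p' x)))\<^sup>2)" if "p \<in> F" "p' \<in> F" for p p'
      using Y that by (intro sum.mono_neutral_left) (auto simp: Y_def)
    have "neg_type F (\<lambda>p p'. \<Sum>x\<in>Y. (dist (v (w p x)) (v (w p' x)))\<^sup>2)"
      by (intro neg_type_sum neg_type_dist_squared)
    from neg_type_nonpos [OF this F(1) order_refl F(3)] show ?thesis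
      by (simp add: eq cong: sum.cong)
  qed
  moreover have "?D p p' = ?D p' p" for p p'
    by (simp add: dist_commute eq_commute [of "w p _"])
  ultimately show ?thesis unfolding neg_type_def by simp
qed

text \<open>An element is determined by its graph over the support, a finite subset of
  \<open>X \<times> carrier H\<close>.\<close>

lemma countable_sum_group:
  assumes H: "group H" "countable (carrier H)" and X: "countable X"
  shows "countable (carrier (sum_group X (\<lambda>_. H)))"
proof -
  let ?g = "\<lambda>w. {(x, w x) |x. x \<in> X \<and> w x \<noteq> \<one>\<^bsub>H\<^esub>}"
  let ?C = "carrier (sum_group X (\<lambda>_. H))"
  have C: "?C = {w \<in> X \<rightarrow>\<^sub>E carrier H. finite {x \<in> X. w x \<noteq> \<one>\<^bsub>H\<^esub>}}"
    by (rule carrier_sum_group) (rule H)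
  have "?g ` ?C \<subseteq> {A. A \<subseteq> X \<times> carrier H \<and> finite A}"
  proof (rule image_subsetI)
    fix w assume w: "w \<in> ?C"
    then have "finite ((\<lambda>x. (x, w x)) ` {x \<in> X. w x \<noteq> \<one>\<^bsub>H\<^esub>})" by (simp add: C)
    then show "?g w \<in> {A. A \<subseteq> X \<times> carrier H \<and> finite A}"
      using w by (auto simp: C PiE_iff setcompr_eq_image)
  qed
  moreover have "countable {A. A \<subseteq> X \<times> carrier H \<and> finite A}"
    using countable_Collect_finite_subset [of "X \<times> carrier H"] H X by (simp add: conj_commute)
  ultimately have "countable (?g ` ?C)" by (rule countable_subset)
  moreover have "inj_on ?g ?C"
  proof (rule inj_onI)
    fix w w' assume w: "w \<in> ?C" "w' \<in> ?C" and eq: "?g w = ?g w'"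
    show "w = w'"
    proof (rule extensionalityI)
      show "w \<in> extensional X" "w' \<in> extensional X" using w by (auto simp: C PiE_iff)
      fix x assume x: "x \<in> X"
      have "w x = h \<and> h \<noteq> \<one>\<^bsub>H\<^esub> \<longleftrightarrow> w' x = h \<and> h \<noteq> \<one>\<^bsub>H\<^esub>" for h
        using arg_cong [OF eq, of "\<lambda>A. (x, h) \<in> A"] x by auto
      from this [of "w x"] this [of "w' x"] show "w x = w' x" by auto
    qed
  qed
  ultimately show ?thesis by (rule countable_image_inj_on)
qed

text \<open>Such an element is determined by its values on \<open>T\<close>, each trivial or in
  \<open>A\<close>.\<close>

lemma finite_sum_group_subset:
  assumes "group H" and "finite T" and "finite A"
  shows "finite {w \<in> carrier (sum_group X (\<lambda>_. H)).
    {x \<in> X. w x \<noteq> \<one>\<^bsub>H\<^esub>} \<subseteq> T \<and> (\<forall>x\<in>X. w x \<noteq> \<one>\<^bsub>H\<^esub> \<longrightarrow> w x \<in> A)}" (is "finite ?W")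
proof -
  have "?W \<subseteq> (\<lambda>f. \<lambda>x\<in>X. if x \<in> T then f x else \<one>\<^bsub>H\<^esub>) ` (T \<rightarrow>\<^sub>E insert \<one>\<^bsub>H\<^esub> A)"
  proof
    fix w assume w: "w \<in> ?W"
    then have ext: "w \<in> extensional X"
      using carrier_sum_group [of X "\<lambda>_. H"] assms(1) by (auto simp: PiE_iff)
    let ?f = "\<lambda>x\<in>T. if x \<in> X then w x else \<one>\<^bsub>H\<^esub>"
    have "w = (\<lambda>x\<in>X. if x \<in> T then ?f x else \<one>\<^bsub>H\<^esub>)"
      by (rule extensionalityI [OF ext]) (use w in auto)
    moreover have "?f \<in> T \<rightarrow>\<^sub>E insert \<one>\<^bsub>H\<^esub> A" using w by (auto; blast)
    ultimately show "w \<in> (\<lambda>f. \<lambda>x\<in>X. if x \<in> T then f x else \<one>\<^bsub>H\<^esub>) ` (T \<rightarrow>\<^sub>E insert \<one>\<^bsub>H\<^esub> A)"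
      by blast
  qed
  moreover have "finite (T \<rightarrow>\<^sub>E insert \<one>\<^bsub>H\<^esub> A)"
    using assms by (intro finite_PiE) auto
  ultimately show ?thesis by (meson finite_imageI finite_subset)
qed

theorem theorem1p5:
  fixes G :: "('a, 'c) monoid_scheme" and H :: "('b, 'd) monoid_scheme" and N :: "'a set"
  assumes "group G" and "countable (carrier G)"
    and "group H" and "countable (carrier H)"
    and "N \<lhd> G"
    and "haagerup TYPE('u::{real_inner, complete_space}) G"
    and "haagerup TYPE('v::{real_inner, complete_space}) H"
    and "haagerup TYPE('w::{real_inner, complete_space}) (G Mod N)"
  shows "haagerup TYPE(ell2) (quotient_wreath H G N)"
proof -
  interpret normal N G by fact
  interpret H: group H by fact
  interpret Q: group "G Mod N" by (rule factorgroup_is_group)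
  define X where "X = carrier (G Mod N)"
  define \<alpha> where "\<alpha> = quotient_translation G N"
  define W where "W = perm_wreath H X \<alpha> G"
  let ?S = "sum_group X (\<lambda>_. H)"
  interpret A: group_action G X \<alpha>
    unfolding X_def \<alpha>_def by (rule group_action_quotient_translation)
  interpret W: group W
    unfolding W_def by (intro group_perm_wreath A.group_action_axioms) (rule H.is_group)

  \<comment> \<open>Orbit maps and kernels of the three groups\<close>
  obtain vG :: "'a \<Rightarrow> 'u" where vG: "\<And>g x y. g \<in> carrier G \<Longrightarrow> x \<in> carrier G \<Longrightarrow> y \<in> carrier G \<Longrightarrow>
      dist (vG (g \<otimes>\<^bsub>G\<^esub> x)) (vG (g \<otimes>\<^bsub>G\<^esub> y)) = dist (vG x) (vG y)"
    and vG_fin: "\<And>R. finite {g \<in> carrier G. (dist (vG g) (vG \<one>\<^bsub>G\<^esub>))\<^sup>2 \<le> R}"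
    using haagerup_imp_orbit_map [OF assms(1,6)] by blast
  obtain vH :: "'b \<Rightarrow> 'v" where vH: "\<And>g x y. g \<in> carrier H \<Longrightarrow> x \<in> carrier H \<Longrightarrow> y \<in> carrier H \<Longrightarrow>
      dist (vH (g \<otimes>\<^bsub>H\<^esub> x)) (vH (g \<otimes>\<^bsub>H\<^esub> y)) = dist (vH x) (vH y)"
    and vH_fin: "\<And>R. finite {g \<in> carrier H. (dist (vH g) (vH \<one>\<^bsub>H\<^esub>))\<^sup>2 \<le> R}"
    using haagerup_imp_orbit_map [OF assms(3,7)] by blast
  obtain vQ :: "'a set \<Rightarrow> 'w" where vQ: "\<And>g x y. g \<in> X \<Longrightarrow> x \<in> X \<Longrightarrow> y \<in> X \<Longrightarrow>
      dist (vQ (g \<otimes>\<^bsub>G Mod N\<^esub> x)) (vQ (g \<otimes>\<^bsub>G Mod N\<^esub> y)) = dist (vQ x) (vQ y)"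
    and vQ_fin: "\<And>R. finite {g \<in> X. (dist (vQ g) (vQ \<one>\<^bsub>G Mod N\<^esub>))\<^sup>2 \<le> R}"
    using haagerup_imp_orbit_map [OF Q.is_group assms(8)] unfolding X_def by blast
  define \<psi> where "\<psi> x y = (dist (vQ x) (vQ y))\<^sup>2" for x y

  have X_eq: "X = (\<lambda>g. N #>\<^bsub>G\<^esub> g) ` carrier G"
    unfolding X_def by (rule carrier_FactGroup)
  have countable_X: "countable X" unfolding X_eq using assms(2) by simp
  \<comment> \<open>The base point of \<open>(w, g)\<close> is the coset of \<open>g\<close>;
    \<open>d\<close> below collects the coordinates in which two elements differ.\<close>
  define \<pi> where "\<pi> p = N #>\<^bsub>G\<^esub> snd p" for p :: "('a set \<Rightarrow> 'b) \<times> 'a"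
  define d where "d p p' = {x \<in> X. fst p x \<noteq> fst p' x}" for p p' :: "('a set \<Rightarrow> 'b) \<times> 'a"
  have S: "carrier ?S = {w \<in> X \<rightarrow>\<^sub>E carrier H. finite {x \<in> X. w x \<noteq> \<one>\<^bsub>H\<^esub>}}"
    by (rule carrier_sum_group) (rule H.is_group)
  have carrier_W: "carrier W = carrier ?S \<times> carrier G" by (simp add: W_def perm_wreath_def)
  have \<pi>: "\<pi> p \<in> X" if "p \<in> carrier W" for p
    using that by (auto simp: \<pi>_def carrier_W X_eq)
  have closed: "fst p x \<in> carrier H" if "p \<in> carrier W" "x \<in> X" for p x
    using that by (auto simp: carrier_W S)
  have fin: "finite (d p p')" if "p \<in> carrier W" "p' \<in> carrier W" for p p'
  proof (rule finite_subset)
    show "d p p' \<subseteq> {x \<in> X. fst p x \<noteq> \<one>\<^bsub>H\<^esub>} \<union> {x \<in> X. fst p' x \<noteq> \<one>\<^bsub>H\<^esub>}"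
      by (auto simp: d_def)
    show "finite ({x \<in> X. fst p x \<noteq> \<one>\<^bsub>H\<^esub>} \<union> {x \<in> X. fst p' x \<noteq> \<one>\<^bsub>H\<^esub>})"
      using that by (auto simp: carrier_W S)
  qed
  have data: "(\<pi> p, \<pi> p', d p p') \<in> wall_data X" if "p \<in> carrier W" "p' \<in> carrier W" for p p'
    using \<pi> fin that by (auto simp: wall_data_def d_def)
  have "neg_type X \<psi>" unfolding \<psi>_def by (rule neg_type_dist_squared)
  from wall_kernel_series [OF this countable_X, of "carrier W" \<pi> fst, folded d_def, OF \<pi> fin]
  obtain \<Delta> where \<Delta>_neg: "neg_type (carrier W) (\<lambda>p p'. \<Delta> (\<pi> p) (\<pi> p') (d p p'))"
    and \<Delta>_inv: "\<And>s y y' F. inj_on s X \<Longrightarrow> s ` X \<subseteq> X \<Longrightarrow>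
      (\<And>x x'. x \<in> X \<Longrightarrow> x' \<in> X \<Longrightarrow> \<psi> (s x) (s x') = \<psi> x x') \<Longrightarrow> (y, y', F) \<in> wall_data X \<Longrightarrow>
      \<Delta> (s y) (s y') (s ` F) = \<Delta> y y' F"
    and \<Delta>_proper: "\<And>R. \<exists>r. \<forall>(y, y', F)\<in>wall_data X. \<Delta> y y' F \<le> R \<longrightarrow> (\<forall>x\<in>F. \<psi> x y \<le> r)"
    by blast
  define DG where "DG p p' = (dist (vG (snd p)) (vG (snd p')))\<^sup>2" for p p' :: "('a set \<Rightarrow> 'b) \<times> 'a"
  define DH where "DH p p' = (\<Sum>x\<in>d p p'. (dist (vH (fst p x)) (vH (fst p' x)))\<^sup>2)" for p p' :: "('a set \<Rightarrow> 'b) \<times> 'a"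
  define DW where "DW p p' = \<Delta> (\<pi> p) (\<pi> p') (d p p')" for p p'
  have DG_neg: "neg_type (carrier W) DG" unfolding DG_def by (rule neg_type_dist_squared)
  have DH_neg: "neg_type (carrier W) DH"
    unfolding DH_def d_def by (rule neg_type_finite_support) (use fin in \<open>simp add: d_def\<close>)
  have DW_neg: "neg_type (carrier W) DW" unfolding DW_def by (rule \<Delta>_neg)

  \<comment> \<open>The translation action on the quotient\<close>
  have \<alpha>_coset: "\<alpha> h (N #>\<^bsub>G\<^esub> g) = N #>\<^bsub>G\<^esub> (h \<otimes>\<^bsub>G\<^esub> g)" if "h \<in> carrier G" "g \<in> carrier G" for h g
    unfolding \<alpha>_def using that by (rule quotient_translation_r_coset)
  have \<alpha>_X: "\<alpha> h x \<in> X" if "h \<in> carrier G" "x \<in> X" for h x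
    using A.element_image that by blast
  have \<alpha>_inv: "\<alpha> (inv\<^bsub>G\<^esub> h) (\<alpha> h x) = x" "\<alpha> h (\<alpha> (inv\<^bsub>G\<^esub> h) x) = x" if "h \<in> carrier G" "x \<in> X" for h x
    using that by (auto simp: X_eq \<alpha>_coset m_assoc [symmetric])
  have \<alpha>_inj: "inj_on (\<alpha> h) X" if "h \<in> carrier G" for h
    using \<alpha>_inv(1) [OF that] by (rule inj_on_inverseI)
  have \<alpha>_\<psi>: "\<psi> (\<alpha> h x) (\<alpha> h y) = \<psi> x y" if "h \<in> carrier G" "x \<in> X" "y \<in> X" for h x y
  proof -
    \<comment> \<open>Translation by \<open>h\<close> is left multiplication by the coset of
      \<open>h\<close>, so the invariance of \<open>vQ\<close> applies.\<close>
    have "\<alpha> h z = (N #>\<^bsub>G\<^esub> h) \<otimes>\<^bsub>G Mod N\<^esub> z" if "z \<in> X" for z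
      using that \<open>h \<in> carrier G\<close> by (auto simp: X_eq \<alpha>_coset FactGroup_def rcos_sum)
    moreover have "N #>\<^bsub>G\<^esub> h \<in> X" using that by (auto simp: X_eq)
    ultimately show ?thesis using vQ that by (simp add: \<psi>_def)
  qed

  \<comment> \<open>Invariance under left multiplication\<close>
  have mult: "fst (q \<otimes>\<^bsub>W\<^esub> p) x = fst q x \<otimes>\<^bsub>H\<^esub> fst p (\<alpha> (inv\<^bsub>G\<^esub> (snd q)) x)"
    "snd (q \<otimes>\<^bsub>W\<^esub> p) = snd q \<otimes>\<^bsub>G\<^esub> snd p" if "x \<in> X" for p q x
    using that by (simp_all add: W_def perm_wreath_def coordinate_action_def split: prod.splits)
  \<comment> \<open>The common left factor cancels in \<open>H\<close>, so only the permutation of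
    the coordinates remains.\<close>
  have d_mult: "d (q \<otimes>\<^bsub>W\<^esub> p) (q \<otimes>\<^bsub>W\<^esub> p') = \<alpha> (snd q) ` d p p'"
    if W: "q \<in> carrier W" "p \<in> carrier W" "p' \<in> carrier W" for q p p'
  proof -
    have q: "snd q \<in> carrier G" using W(1) by (auto simp: carrier_W)
    have sub: "d (q \<otimes>\<^bsub>W\<^esub> p) (q \<otimes>\<^bsub>W\<^esub> p') \<subseteq> X" "d p p' \<subseteq> X" by (auto simp: d_def)
    have mem: "x \<in> d (q \<otimes>\<^bsub>W\<^esub> p) (q \<otimes>\<^bsub>W\<^esub> p') \<longleftrightarrow> \<alpha> (inv\<^bsub>G\<^esub> (snd q)) x \<in> d p p'" if x: "x \<in> X" for x
    proof -
      have y: "\<alpha> (inv\<^bsub>G\<^esub> (snd q)) x \<in> X" using q x by (intro \<alpha>_X) simp_all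
      then show ?thesis
        using closed [OF W(1) x] closed [OF W(2) y] closed [OF W(3) y] x
        by (simp add: d_def mult)
    qed
    show ?thesis
    proof (intro subset_antisym subsetI)
      fix x assume x: "x \<in> d (q \<otimes>\<^bsub>W\<^esub> p) (q \<otimes>\<^bsub>W\<^esub> p')"
      then have "x \<in> X" using sub by blast
      then show "x \<in> \<alpha> (snd q) ` d p p'"
        using mem x \<alpha>_inv(2) [OF q] by (intro image_eqI [of _ _ "\<alpha> (inv\<^bsub>G\<^esub> (snd q)) x"]) simp_all
    next
      fix x assume "x \<in> \<alpha> (snd q) ` d p p'"
      then obtain y where y: "y \<in> d p p'" "x = \<alpha> (snd q) y" by blast
      then have "y \<in> X" using sub by blast
      then show "x \<in> d (q \<otimes>\<^bsub>W\<^esub> p) (q \<otimes>\<^bsub>W\<^esub> p')"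
        using y \<alpha>_X [OF q] \<alpha>_inv(1) [OF q] by (simp add: mem)
    qed
  qed
  have DG_inv: "DG (q \<otimes>\<^bsub>W\<^esub> p) (q \<otimes>\<^bsub>W\<^esub> p') = DG p p'"
    if "q \<in> carrier W" "p \<in> carrier W" "p' \<in> carrier W" for q p p'
    using that vG by (auto simp: DG_def W_def perm_wreath_def)
  have DW_inv: "DW (q \<otimes>\<^bsub>W\<^esub> p) (q \<otimes>\<^bsub>W\<^esub> p') = DW p p'"
    if q: "q \<in> carrier W" and p: "p \<in> carrier W" "p' \<in> carrier W" for q p p'
  proof -
    have h: "snd q \<in> carrier G" using q by (auto simp: carrier_W)
    have "\<pi> (q \<otimes>\<^bsub>W\<^esub> p) = \<alpha> (snd q) (\<pi> p)" if "p \<in> carrier W" for p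
      using that h by (auto simp: \<pi>_def carrier_W \<alpha>_coset W_def perm_wreath_def split: prod.splits)
    then show ?thesis
      unfolding DW_def d_mult [OF q p]
      using \<Delta>_inv [OF \<alpha>_inj [OF h] _ \<alpha>_\<psi> [OF h] data [OF p]] \<alpha>_X [OF h] p by auto
  qed
  have DH_inv: "DH (q \<otimes>\<^bsub>W\<^esub> p) (q \<otimes>\<^bsub>W\<^esub> p') = DH p p'"
    if q: "q \<in> carrier W" and p: "p \<in> carrier W" "p' \<in> carrier W" for q p p'
  proof -
    have h: "snd q \<in> carrier G" using q by (auto simp: carrier_W)
    have X': "x \<in> X" if "x \<in> d p p'" for x using that by (simp add: d_def)
    have inj: "inj_on (\<alpha> (snd q)) (d p p')"
      using \<alpha>_inj [OF h] by (rule inj_on_subset) (auto simp: d_def)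
    show ?thesis
      \<comment> \<open>Reindexing along the translation undoes the permutation; the common left
        factor disappears by the invariance of \<open>vH\<close>.\<close>
      unfolding DH_def d_mult [OF q p] sum.reindex [OF inj] o_def
    proof (rule sum.cong [OF refl])
      fix x assume "x \<in> d p p'"
      then have x: "x \<in> X" by (rule X')
      show "(dist (vH (fst (q \<otimes>\<^bsub>W\<^esub> p) (\<alpha> (snd q) x))) (vH (fst (q \<otimes>\<^bsub>W\<^esub> p') (\<alpha> (snd q) x))))\<^sup>2 =
          (dist (vH (fst p x)) (vH (fst p' x)))\<^sup>2"
        using closed [OF q \<alpha>_X [OF h x]] closed [OF p(1) x] closed [OF p(2) x]
        by (simp add: mult(1) \<alpha>_X [OF h x] \<alpha>_inv(1) [OF h x] vH)
    qed
  qed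

  \<comment> \<open>Finiteness of balls\<close>
  have one: "fst \<one>\<^bsub>W\<^esub> x = \<one>\<^bsub>H\<^esub>" "snd \<one>\<^bsub>W\<^esub> = \<one>\<^bsub>G\<^esub>" if "x \<in> X" for x
    using that by (simp_all add: W_def perm_wreath_def)
  \<comment> \<open>This ball is covered by the translate by \<open>y\<close> of a ball about the
    identity.\<close>
  have ball_fin: "finite {x \<in> X. \<psi> x y \<le> r}" if y: "y \<in> X" for y r
  proof (rule finite_subset)
    show "{x \<in> X. \<psi> x y \<le> r} \<subseteq> (\<lambda>z. y \<otimes>\<^bsub>G Mod N\<^esub> z) ` {z \<in> X. (dist (vQ z) (vQ \<one>\<^bsub>G Mod N\<^esub>))\<^sup>2 \<le> r}"
    proof
      fix x assume x: "x \<in> {x \<in> X. \<psi> x y \<le> r}"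
      let ?z = "inv\<^bsub>G Mod N\<^esub> y \<otimes>\<^bsub>G Mod N\<^esub> x"
      have z: "?z \<in> X" "y \<otimes>\<^bsub>G Mod N\<^esub> ?z = x" "\<one>\<^bsub>G Mod N\<^esub> \<in> X" "y \<otimes>\<^bsub>G Mod N\<^esub> \<one>\<^bsub>G Mod N\<^esub> = y"
        using x y by (simp_all add: X_def Q.m_assoc [symmetric] del: mult_FactGroup one_FactGroup)
      have "dist (vQ ?z) (vQ \<one>\<^bsub>G Mod N\<^esub>) = dist (vQ x) (vQ y)"
        using vQ [OF y z(1,3)] z(2,4) by simp
      then show "x \<in> (\<lambda>z. y \<otimes>\<^bsub>G Mod N\<^esub> z) ` {z \<in> X. (dist (vQ z) (vQ \<one>\<^bsub>G Mod N\<^esub>))\<^sup>2 \<le> r}"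
        using x z by (intro image_eqI [of _ _ ?z]) (auto simp: \<psi>_def)
    qed
  qed (intro finite_imageI vQ_fin)

  show ?thesis
    unfolding X_def [symmetric] \<alpha>_def [symmetric] W_def [symmetric]
  proof (rule haagerup_ell2I [where D = "\<lambda>p p'. DG p p' + DH p p' + DW p p'"])
    show "group W" by (rule W.is_group)
    show "countable (carrier W)"
      unfolding carrier_W using countable_sum_group [OF assms(3,4) countable_X] assms(2) by simp
    show "neg_type (carrier W) (\<lambda>p p'. DG p p' + DH p p' + DW p p')"
      by (intro neg_type_add DG_neg DH_neg DW_neg)
    show "DG (q \<otimes>\<^bsub>W\<^esub> p) (q \<otimes>\<^bsub>W\<^esub> p') + DH (q \<otimes>\<^bsub>W\<^esub> p) (q \<otimes>\<^bsub>W\<^esub> p') + DW (q \<otimes>\<^bsub>W\<^esub> p) (q \<otimes>\<^bsub>W\<^esub> p') =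
        DG p p' + DH p p' + DW p p'"
      if "q \<in> carrier W" "p \<in> carrier W" "p' \<in> carrier W" for q p p'
      using that by (simp only: DG_inv DH_inv DW_inv)
    show "finite {p \<in> carrier W. DG p \<one>\<^bsub>W\<^esub> + DH p \<one>\<^bsub>W\<^esub> + DW p \<one>\<^bsub>W\<^esub> \<le> R}" for R
    proof -
      obtain r where r: "\<And>p. p \<in> carrier W \<Longrightarrow> DW p \<one>\<^bsub>W\<^esub> \<le> R \<Longrightarrow> \<forall>x\<in>d p \<one>\<^bsub>W\<^esub>. \<psi> x (\<pi> p) \<le> r"
        using \<Delta>_proper [of R] data [OF _ W.one_closed] unfolding DW_def by blast
      define AG where "AG = {g \<in> carrier G. (dist (vG g) (vG \<one>\<^bsub>G\<^esub>))\<^sup>2 \<le> R}"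
      define AH where "AH = {h \<in> carrier H. (dist (vH h) (vH \<one>\<^bsub>H\<^esub>))\<^sup>2 \<le> R}"
      \<comment> \<open>With \<open>g\<close> confined to the finite set \<open>AG\<close>, the
        support is confined to finitely many points, those within \<open>r\<close> of the coset of
        some such \<open>g\<close>.\<close>
      define T where "T = (\<Union>g\<in>AG. {x \<in> X. \<psi> x (N #>\<^bsub>G\<^esub> g) \<le> r})"
      have "finite T"
        unfolding T_def using vG_fin by (intro finite_UN_I ball_fin) (auto simp: AG_def X_eq)
      define WS where "WS = {w \<in> carrier ?S. {x \<in> X. w x \<noteq> \<one>\<^bsub>H\<^esub>} \<subseteq> T \<and> (\<forall>x\<in>X. w x \<noteq> \<one>\<^bsub>H\<^esub> \<longrightarrow> w x \<in> AH)}"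
      have "finite WS"
        using \<open>group H\<close> \<open>finite T\<close> vH_fin unfolding WS_def AH_def by (rule finite_sum_group_subset)
      moreover have "finite AG" unfolding AG_def by (rule vG_fin)
      ultimately have "finite (WS \<times> AG)" by (rule finite_cartesian_product)
      moreover have "p \<in> WS \<times> AG"
        if p: "p \<in> carrier W" and le: "DG p \<one>\<^bsub>W\<^esub> + DH p \<one>\<^bsub>W\<^esub> + DW p \<one>\<^bsub>W\<^esub> \<le> R" for p
      proof -
        \<comment> \<open>The three kernels are nonnegative, so a bound on their sum bounds each of
          them.\<close>
        have le_R: "DG p \<one>\<^bsub>W\<^esub> \<le> R" "DH p \<one>\<^bsub>W\<^esub> \<le> R" "DW p \<one>\<^bsub>W\<^esub> \<le> R"
          using neg_type_nonneg [OF DG_neg p W.one_closed] neg_type_nonneg [OF DH_neg p W.one_closed]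
            neg_type_nonneg [OF DW_neg p W.one_closed] le by linarith+
        have d_one: "d p \<one>\<^bsub>W\<^esub> = {x \<in> X. fst p x \<noteq> \<one>\<^bsub>H\<^esub>}"
          using one(1) by (auto simp: d_def)
        have AG: "snd p \<in> AG"
          \<comment> \<open>The fact \<open>one\<close> is stated under the premise that
            \<open>X\<close> has an element; \<open>\<pi> p\<close> provides one.\<close>
          using p le_R(1) by (auto simp: AG_def carrier_W DG_def one(2) [OF \<pi> [OF p]])
        have "x \<in> T" if "x \<in> X" "fst p x \<noteq> \<one>\<^bsub>H\<^esub>" for x
        proof -
          have "\<psi> x (\<pi> p) \<le> r" using r [OF p le_R(3)] that d_one by simp
          then show ?thesis using that AG by (auto simp: T_def \<pi>_def)
        qed
        moreover have "fst p x \<in> AH" if "x \<in> X" "fst p x \<noteq> \<one>\<^bsub>H\<^esub>" for x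
        proof -
          have "(dist (vH (fst p x)) (vH (fst \<one>\<^bsub>W\<^esub> x)))\<^sup>2 \<le> DH p \<one>\<^bsub>W\<^esub>"
            unfolding DH_def using that d_one fin [OF p W.one_closed]
            by (intro member_le_sum [where f = "\<lambda>x. (dist (vH (fst p x)) (vH (fst \<one>\<^bsub>W\<^esub> x)))\<^sup>2"]) auto
          then show ?thesis
            using le_R(2) closed [OF p that(1)] one(1) [OF that(1)] by (simp add: AH_def)
        qed
        ultimately have "fst p \<in> WS"
          using p by (auto simp: carrier_W WS_def)
        with AG show ?thesis by (simp add: mem_Times_iff)
      qed
      then have "{p \<in> carrier W. DG p \<one>\<^bsub>W\<^esub> + DH p \<one>\<^bsub>W\<^esub> + DW p \<one>\<^bsub>W\<^esub> \<le> R} \<subseteq> WS \<times> AG" by blast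
      ultimately show ?thesis by (rule rev_finite_subset)
    qed
  qed
qed

end
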